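(* Let $\Omega\subset\mathbb{R}^d$ be open and let $(M_p)_{p\in\mathbb{N}}$ be a weight sequence satisfying (M.1), (M.2), (M.3). Let $g=[(g_\varepsilon)]\in\mathcal{G}^{\infty,(M_p)}(\Omega)$ be a regular generalized Beurling ultradistribution which is strongly $B$-associated to a Beurling ultradistribution $T\in\mathcal{D}'^{(M_p)}(\Omega)$. Then $T\in\mathcal{E}^{(M_p)}(\Omega)$, i.e. $T$ is (given by integration against) an ultradifferentiable function of Beurling type.
   Context: Conventions: $\mathbb{N}=\{0,1,2,\dots\}$, $\mathbb{Z}_+=\{1,2,\dots\}$. Functions are complex valued. For nets indexed by $\varepsilon\in(0,1)$, $a_\varepsilon=O(b_\varepsilon)$ means that there are $C>0$ and $\varepsilon_0\in(0,1)$ with $|a_\varepsilon|\le C b_\varepsilon$ for $\varepsilon\in(0,\varepsilon_0)$. All compact sets $K\subset\subset\Omega$ are assumed regular in the sense of Komatsu (Whitney-type regularity: finitely many connected components, and any two points $x,y$ of the same component can be joined by a rectifiable curve in $K$ of length at most $C_K|x-y|$). Weight sequence: $(M_p)_{p\in\mathbb{N}}$ is a sequence of positive numbers with $M_0=1$ such that, for some constants $c_0,H\ge1$: (M.1) $M_p^2\le M_{p-1}M_{p+1}$, $p\in\mathbb{Z}_+$; (M.2) $M_p\le c_0H^p\min_{0\le q\le p}M_{p-q}M_q$, $p\in\mathbb{N}$; (M.3) $\sum_{j=p+1}^\infty M_{j-1}/M_j\le c_0\,p\,M_p/M_{p+1}$, $p\in\mathbb{Z}_+$. For $\alpha\in\mathbb{N}^d$,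 $M_\alpha:=M_{|\alpha|}$. The associated function is $M(\rho)=\sup_{p\in\mathbb{N}}\ln_+(\rho^p/M_p)$ for $\rho>0$, $M(0)=0$, where $\ln_+=\max(\ln,0)$. Function spaces: for $K\subset\subset\Omega$, $h>0$, $\phi\in C^\infty(\Omega)$ put $\|\phi\|_{K,h}=\sup_{x\in K,\alpha\in\mathbb{N}^d}\frac{|\phi^{(\alpha)}(x)|}{h^{|\alpha|}M_\alpha}$. $\mathcal{E}^{(M_p)}(\Omega)$ is the space of $\phi\in C^\infty(\Omega)$ with $\|\phi\|_{K,h}<\infty$ for all $K\subset\subset\Omega$ and all $h>0$. $\mathcal{D}^{(M_p)}(K)$ is the Fréchet space of those $\phi\in\mathcal{E}^{(M_p)}(\Omega)$ with support in $K$, with the norms $\|\cdot\|_{K,h}$, $h>0$; $\mathcal{D}^{(M_p)}(\Omega)=\varinjlim_{K\subset\subset\Omega}\mathcal{D}^{(M_p)}(K)$, and $\mathcal{D}'^{(M_p)}(\Omega)$ (Beurling ultradistributions) is its dual. Generalized ultradistributions: $\mathcal{E}_M^{(M_p)}(\Omega)$ is the set of nets $(g_\varepsilon)\in(\mathcal{E}^{(M_p)}(\Omega))^{(0,1)}$ such that for all $K\subset\subset\Omega$ and $h>0$ there is $k\ge0$ with $\|g_\varepsilon\|_{K,h}=O(e^{M(k/\varepsilon)})$. $\mathcal{N}^{(M_p)}(\Omega)$ is the set of nets such that for all $K\subset\subset\Omega$, $h>0$, $k\ge0$: $\|g_\varepsilon\|_{K,h}=O(e^{-M(k/\varepsilon)})$.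 $\mathcal{G}^{(M_p)}(\Omega)=\mathcal{E}_M^{(M_p)}(\Omega)/\mathcal{N}^{(M_p)}(\Omega)$; the class of $(g_\varepsilon)$ is $[(g_\varepsilon)]$. Regularity: $g\in\mathcal{G}^{\infty,(M_p)}(\Omega)$ if $g$ has a representative $(g_\varepsilon)\in\mathcal{E}_M^{(M_p)}(\Omega)$ such that for every $K\subset\subset\Omega$ there is $k>0$ such that for every $h>0$: $\|g_\varepsilon\|_{K,h}=O(e^{M(k/\varepsilon)})$. Strong $B$-association: $g=[(g_\varepsilon)]\in\mathcal{G}^{(M_p)}(\Omega)$ is strongly $B$-associated to $T\in\mathcal{D}'^{(M_p)}(\Omega)$ if for every compact $K\subset\Omega$ there is $b>0$ such that for every $\phi\in\mathcal{D}^{(M_p)}(K)$: $|\langle g_\varepsilon-T,\phi\rangle|=O(e^{-M(b/\varepsilon)})$, where $\langle g_\varepsilon,\phi\rangle=\int_\Omega g_\varepsilon\phi\,dx$. *)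

theory Defs
  imports "HOL-Analysis.Analysis"
begin

text \<open>
  The space $R^d$ is \<open>real ^ 'n\<close>, so $d \ge 1$ is the cardinality of \<open>'n\<close>. Functions on an open set
  \<open>\<Omega>\<close> are total functions of which only the values on \<open>\<Omega>\<close> matter; likewise, nets are indexed by
  all reals, but only the indices in the open interval from 0 to 1 matter.
\<close>


section \<open>Weight sequences\<close>

definition weight_sequence :: "(nat \<Rightarrow> real) \<Rightarrow> bool" where
  "weight_sequence M \<longleftrightarrow> (\<forall>p. M p > 0) \<and> M 0 = 1 \<and>
     (\<exists>c\<^sub>0\<ge>1. \<exists>H\<ge>1.
        (\<forall>p\<ge>1. (M p)\<^sup>2 \<le> M (p - 1) * M (p + 1)) \<and>
        (\<forall>p. M p \<le> c\<^sub>0 * H ^ p * Min ((\<lambda>q. M (p - q) * M q) ` {0..p})) \<and>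
        (\<forall>p\<ge>1. summable (\<lambda>i. M (p + i) / M (p + i + 1)) \<and>
               (\<Sum>i. M (p + i) / M (p + i + 1)) \<le> c\<^sub>0 * real p * M p / M (p + 1)))"

text \<open>The supremum is finite for weight sequences, as the last condition forces \<open>M (p + 1) / M p\<close> to tend to
  infinity.\<close>

definition assoc_fun :: "(nat \<Rightarrow> real) \<Rightarrow> real \<Rightarrow> real" where
  "assoc_fun M \<rho> = (if \<rho> = 0 then 0 else (SUP p. max (ln (\<rho> ^ p / M p)) 0))"


section \<open>Derivatives and smooth functions\<close>

definition partial_deriv :: "'n::finite \<Rightarrow> (real ^ 'n \<Rightarrow> complex) \<Rightarrow> real ^ 'n \<Rightarrow> complex" where
  "partial_deriv i f x = frechet_derivative f (at x) (axis i 1)"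

primrec iter_partial :: "'n::finite list \<Rightarrow> (real ^ 'n \<Rightarrow> complex) \<Rightarrow> real ^ 'n \<Rightarrow> complex" where
  "iter_partial [] f = f"
| "iter_partial (i # is) f = partial_deriv i (iter_partial is f)"

definition smooth_on :: "(real ^ 'n::finite) set \<Rightarrow> (real ^ 'n \<Rightarrow> complex) \<Rightarrow> bool" where
  "smooth_on \<Omega> f \<longleftrightarrow> (\<forall>is. iter_partial is f differentiable_on \<Omega>)"

text \<open>An arbitrary but fixed order of the coordinates; it is immaterial for the derivatives of
  smooth functions, where partial derivatives commute.\<close>

definition coords :: "'n::finite list" where
  "coords = (SOME is. distinct is \<and> set is = UNIV)"

lemma coords: "distinct (coords :: 'n::finite list)" "set (coords :: 'n list) = UNIV"
proof -
  have "\<exists>is :: 'n list. distinct is \<and> set is = UNIV"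
    using finite_distinct_list[of "UNIV :: 'n set"] by auto
  then have "distinct (coords :: 'n list) \<and> set (coords :: 'n list) = UNIV"
    unfolding coords_def by (rule someI_ex)
  then show "distinct (coords :: 'n list)" "set (coords :: 'n list) = UNIV" by auto
qed

definition multi_deriv :: "('n::finite \<Rightarrow> nat) \<Rightarrow> (real ^ 'n \<Rightarrow> complex) \<Rightarrow> real ^ 'n \<Rightarrow> complex" where
  "multi_deriv \<alpha> f = iter_partial (concat (map (\<lambda>i. replicate (\<alpha> i) i) coords)) f"


section \<open>Regular compact sets\<close>

definition curve_length :: "(real \<Rightarrow> 'a::metric_space) \<Rightarrow> ennreal" where
  "curve_length \<gamma> =
     (SUP ts\<in>{ts. sorted ts \<and> set ts \<subseteq> {0..1}}.
        \<Sum>i<length ts - 1. ennreal (dist (\<gamma> (ts ! i)) (\<gamma> (ts ! Suc i))))"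

definition regular_compact :: "'a::metric_space set \<Rightarrow> bool" where
  "regular_compact K \<longleftrightarrow> compact K \<and> finite (components K) \<and>
     (\<exists>C>0. \<forall>x y. connected_component K x y \<longrightarrow>
        (\<exists>\<gamma>. path \<gamma> \<and> path_image \<gamma> \<subseteq> K \<and> pathstart \<gamma> = x \<and> pathfinish \<gamma> = y \<and>
             curve_length \<gamma> \<le> ennreal (C * dist x y)))"

definition regular_compacts :: "'a::metric_space set \<Rightarrow> 'a set set" where
  "regular_compacts \<Omega> = {K. K \<subseteq> \<Omega> \<and> regular_compact K}"


section \<open>Ultradifferentiable functions and ultradistributions of Beurling type\<close>

definition ultra_norm ::
    "(nat \<Rightarrow> real) \<Rightarrow> (real ^ 'n::finite) set \<Rightarrow> real \<Rightarrow> (real ^ 'n \<Rightarrow> complex) \<Rightarrow> ennreal" where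
  "ultra_norm M K h \<phi> =
     (SUP x\<in>K. SUP \<alpha>. let p = (\<Sum>i\<in>UNIV. \<alpha> i) in
        ennreal (cmod (multi_deriv \<alpha> \<phi> x) / (h ^ p * M p)))"

definition ultra_diff :: "(nat \<Rightarrow> real) \<Rightarrow> (real ^ 'n::finite) set \<Rightarrow> (real ^ 'n \<Rightarrow> complex) set" where
  "ultra_diff M \<Omega> =
     {\<phi>. smooth_on \<Omega> \<phi> \<and> (\<forall>K\<in>regular_compacts \<Omega>. \<forall>h>0. ultra_norm M K h \<phi> < \<infinity>)}"

text \<open>Test functions are extended by zero outside \<open>\<Omega>\<close>. Since \<open>K\<close> is closed, vanishing outside \<open>K\<close>
  means that the support lies in \<open>K\<close>.\<close>

definition test_functions_on ::
    "(nat \<Rightarrow> real) \<Rightarrow> (real ^ 'n::finite) set \<Rightarrow> (real ^ 'n) set \<Rightarrow> (real ^ 'n \<Rightarrow> complex) set" where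
  "test_functions_on M \<Omega> K = {\<phi> \<in> ultra_diff M \<Omega>. \<forall>x. x \<notin> K \<longrightarrow> \<phi> x = 0}"

definition test_functions ::
    "(nat \<Rightarrow> real) \<Rightarrow> (real ^ 'n::finite) set \<Rightarrow> (real ^ 'n \<Rightarrow> complex) set" where
  "test_functions M \<Omega> = (\<Union>K\<in>regular_compacts \<Omega>. test_functions_on M \<Omega> K)"

definition test_topology_on ::
    "(nat \<Rightarrow> real) \<Rightarrow> (real ^ 'n::finite) set \<Rightarrow> (real ^ 'n) set \<Rightarrow> (real ^ 'n \<Rightarrow> complex) topology" where
  "test_topology_on M \<Omega> K = topology_generated_by
     {{\<phi> \<in> test_functions_on M \<Omega> K. ultra_norm M K h (\<lambda>x. \<phi> x - \<psi> x) < ennreal r} | \<psi> h r.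
        \<psi> \<in> test_functions_on M \<Omega> K \<and> h > 0 \<and> r > 0}"

text \<open>The locally convex inductive limit topology: a basis of neighbourhoods of 0 is given by the
  absolutely convex sets whose traces on all the steps are neighbourhoods of 0.\<close>

definition abs_convex :: "('a \<Rightarrow> complex) set \<Rightarrow> bool" where
  "abs_convex V \<longleftrightarrow>
     (\<forall>\<phi>\<in>V. \<forall>\<psi>\<in>V. \<forall>a b. cmod a + cmod b \<le> 1 \<longrightarrow> (\<lambda>x. a * \<phi> x + b * \<psi> x) \<in> V)"

definition basic_nhd ::
    "(nat \<Rightarrow> real) \<Rightarrow> (real ^ 'n::finite) set \<Rightarrow> (real ^ 'n \<Rightarrow> complex) set \<Rightarrow> bool" where
  "basic_nhd M \<Omega> V \<longleftrightarrow> V \<subseteq> test_functions M \<Omega> \<and> abs_convex V \<and>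
     (\<forall>K\<in>regular_compacts \<Omega>. \<exists>W. openin (test_topology_on M \<Omega> K) W \<and> (\<lambda>x. 0) \<in> W \<and> W \<subseteq> V)"

definition test_topology ::
    "(nat \<Rightarrow> real) \<Rightarrow> (real ^ 'n::finite) set \<Rightarrow> (real ^ 'n \<Rightarrow> complex) topology" where
  "test_topology M \<Omega> = topology (\<lambda>U. U \<subseteq> test_functions M \<Omega> \<and>
     (\<forall>\<phi>\<in>U. \<exists>V. basic_nhd M \<Omega> V \<and> (\<forall>\<psi>\<in>V. (\<lambda>x. \<phi> x + \<psi> x) \<in> U)))"

lemma basic_nhd_Int:
  assumes "basic_nhd M \<Omega> V" "basic_nhd M \<Omega> V'"
  shows "basic_nhd M \<Omega> (V \<inter> V')"
  unfolding basic_nhd_def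
proof (intro conjI ballI)
  show "V \<inter> V' \<subseteq> test_functions M \<Omega>"
    using assms unfolding basic_nhd_def by blast
  show "abs_convex (V \<inter> V')"
    using assms unfolding basic_nhd_def abs_convex_def by blast
next
  fix K assume K: "K \<in> regular_compacts \<Omega>"
  obtain W where W: "openin (test_topology_on M \<Omega> K) W" "(\<lambda>x. 0) \<in> W" "W \<subseteq> V"
    using assms(1) K unfolding basic_nhd_def by blast
  obtain W' where W': "openin (test_topology_on M \<Omega> K) W'" "(\<lambda>x. 0) \<in> W'" "W' \<subseteq> V'"
    using assms(2) K unfolding basic_nhd_def by blast
  have "openin (test_topology_on M \<Omega> K) (W \<inter> W')"
    using W(1) W'(1) by (rule openin_Int)
  then show "\<exists>W. openin (test_topology_on M \<Omega> K) W \<and> (\<lambda>x. 0) \<in> W \<and> W \<subseteq> V \<inter> V'"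
    using W W' by blast
qed

lemma openin_test_topology:
  "openin (test_topology M \<Omega>) U \<longleftrightarrow> U \<subseteq> test_functions M \<Omega> \<and>
     (\<forall>\<phi>\<in>U. \<exists>V. basic_nhd M \<Omega> V \<and> (\<forall>\<psi>\<in>V. (\<lambda>x. \<phi> x + \<psi> x) \<in> U))"
proof -
  let ?P = "\<lambda>U. U \<subseteq> test_functions M \<Omega> \<and>
     (\<forall>\<phi>\<in>U. \<exists>V. basic_nhd M \<Omega> V \<and> (\<forall>\<psi>\<in>V. (\<lambda>x. \<phi> x + \<psi> x) \<in> U))"
  have "?P (S \<inter> T)" if S: "?P S" and T: "?P T" for S T
  proof (intro conjI ballI)
    show "S \<inter> T \<subseteq> test_functions M \<Omega>" using S by blast
    fix \<phi> assume \<phi>: "\<phi> \<in> S \<inter> T"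
    obtain V where V: "basic_nhd M \<Omega> V" "\<forall>\<psi>\<in>V. (\<lambda>x. \<phi> x + \<psi> x) \<in> S" using S \<phi> by blast
    obtain V' where V': "basic_nhd M \<Omega> V'" "\<forall>\<psi>\<in>V'. (\<lambda>x. \<phi> x + \<psi> x) \<in> T" using T \<phi> by blast
    show "\<exists>V. basic_nhd M \<Omega> V \<and> (\<forall>\<psi>\<in>V. (\<lambda>x. \<phi> x + \<psi> x) \<in> S \<inter> T)"
      using basic_nhd_Int[OF V(1) V'(1)] V(2) V'(2) by blast
  qed
  moreover have "?P (\<Union>\<K>)" if \<K>: "\<forall>S\<in>\<K>. ?P S" for \<K>
  proof (intro conjI ballI)
    show "\<Union>\<K> \<subseteq> test_functions M \<Omega>" using \<K> by blast
    fix \<phi> assume "\<phi> \<in> \<Union>\<K>"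
    then obtain S where S: "S \<in> \<K>" "\<phi> \<in> S" by blast
    then obtain V where "basic_nhd M \<Omega> V" "\<forall>\<psi>\<in>V. (\<lambda>x. \<phi> x + \<psi> x) \<in> S" using \<K> by blast
    then show "\<exists>V. basic_nhd M \<Omega> V \<and> (\<forall>\<psi>\<in>V. (\<lambda>x. \<phi> x + \<psi> x) \<in> \<Union>\<K>)" using S(1) by blast
  qed
  ultimately have "istopology ?P" unfolding istopology_def by blast
  then show ?thesis unfolding test_topology_def by (simp add: topology_inverse')
qed

definition ultradistributions ::
    "(nat \<Rightarrow> real) \<Rightarrow> (real ^ 'n::finite) set \<Rightarrow> ((real ^ 'n \<Rightarrow> complex) \<Rightarrow> complex) set" where
  "ultradistributions M \<Omega> =
     {T. (\<forall>\<phi>\<in>test_functions M \<Omega>. \<forall>\<psi>\<in>test_functions M \<Omega>. \<forall>a b.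
            T (\<lambda>x. a * \<phi> x + b * \<psi> x) = a * T \<phi> + b * T \<psi>) \<and>
         continuous_map (test_topology M \<Omega>) euclidean T}"

definition pairing ::
    "(real ^ 'n::finite) set \<Rightarrow> (real ^ 'n \<Rightarrow> complex) \<Rightarrow> (real ^ 'n \<Rightarrow> complex) \<Rightarrow> complex" where
  "pairing \<Omega> f \<phi> = (LINT x:\<Omega>|lborel. f x * \<phi> x)"


section \<open>Generalized ultradistributions\<close>

type_synonym 'n net = "real \<Rightarrow> real ^ 'n \<Rightarrow> complex"

definition net_bigo :: "(real \<Rightarrow> ennreal) \<Rightarrow> (real \<Rightarrow> real) \<Rightarrow> bool" where
  "net_bigo a b \<longleftrightarrow> (\<exists>C>0. \<exists>\<epsilon>\<^sub>0\<in>{0<..<1}. \<forall>\<epsilon>\<in>{0<..<\<epsilon>\<^sub>0}. a \<epsilon> \<le> ennreal (C * b \<epsilon>))"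

definition moderate_nets :: "(nat \<Rightarrow> real) \<Rightarrow> (real ^ 'n::finite) set \<Rightarrow> 'n net set" where
  "moderate_nets M \<Omega> = {g. (\<forall>\<epsilon>\<in>{0<..<1}. g \<epsilon> \<in> ultra_diff M \<Omega>) \<and>
     (\<forall>K\<in>regular_compacts \<Omega>. \<forall>h>0. \<exists>k\<ge>0.
        net_bigo (\<lambda>\<epsilon>. ultra_norm M K h (g \<epsilon>)) (\<lambda>\<epsilon>. exp (assoc_fun M (k / \<epsilon>))))}"

definition negligible_nets :: "(nat \<Rightarrow> real) \<Rightarrow> (real ^ 'n::finite) set \<Rightarrow> 'n net set" where
  "negligible_nets M \<Omega> = {g. (\<forall>\<epsilon>\<in>{0<..<1}. g \<epsilon> \<in> ultra_diff M \<Omega>) \<and>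
     (\<forall>K\<in>regular_compacts \<Omega>. \<forall>h>0. \<forall>k\<ge>0.
        net_bigo (\<lambda>\<epsilon>. ultra_norm M K h (g \<epsilon>)) (\<lambda>\<epsilon>. exp (- assoc_fun M (k / \<epsilon>))))}"

definition net_equiv :: "(nat \<Rightarrow> real) \<Rightarrow> (real ^ 'n::finite) set \<Rightarrow> ('n net \<times> 'n net) set" where
  "net_equiv M \<Omega> = {(f, g). f \<in> moderate_nets M \<Omega> \<and> g \<in> moderate_nets M \<Omega> \<and>
     (\<lambda>\<epsilon> x. f \<epsilon> x - g \<epsilon> x) \<in> negligible_nets M \<Omega>}"

definition generalized_ultradistributions ::
    "(nat \<Rightarrow> real) \<Rightarrow> (real ^ 'n::finite) set \<Rightarrow> 'n net set set" where
  "generalized_ultradistributions M \<Omega> = moderate_nets M \<Omega> // net_equiv M \<Omega>"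

definition regular_generalized_ultradistributions ::
    "(nat \<Rightarrow> real) \<Rightarrow> (real ^ 'n::finite) set \<Rightarrow> 'n net set set" where
  "regular_generalized_ultradistributions M \<Omega> =
     {G \<in> generalized_ultradistributions M \<Omega>. \<exists>g\<in>G.
        \<forall>K\<in>regular_compacts \<Omega>. \<exists>k>0. \<forall>h>0.
          net_bigo (\<lambda>\<epsilon>. ultra_norm M K h (g \<epsilon>)) (\<lambda>\<epsilon>. exp (assoc_fun M (k / \<epsilon>)))}"

text \<open>The condition does not depend on the representative: the pairing of a negligible net with a
  test function is \<open>O(exp (- M (b / \<epsilon>)))\<close> for all \<open>b\<close>.\<close>

definition strongly_B_associated ::
    "(nat \<Rightarrow> real) \<Rightarrow> (real ^ 'n::finite) set \<Rightarrow> 'n net set \<Rightarrow>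
     ((real ^ 'n \<Rightarrow> complex) \<Rightarrow> complex) \<Rightarrow> bool" where
  "strongly_B_associated M \<Omega> G T \<longleftrightarrow> (\<exists>g\<in>G.
     \<forall>K\<in>regular_compacts \<Omega>. \<exists>b>0. \<forall>\<phi>\<in>test_functions_on M \<Omega> K.
       net_bigo (\<lambda>\<epsilon>. ennreal (cmod (pairing \<Omega> (g \<epsilon>) \<phi> - T \<phi>)))
                (\<lambda>\<epsilon>. exp (- assoc_fun M (b / \<epsilon>))))"

end

theory Submission
  imports Defs "HOL-Probability.Probability"
begin

text \<open>
  Let \<open>E = exp \<circ> assoc_fun M\<close> and let \<open>u n\<close> be the difference of the members of the net at the parameters
  \<open>1 / \<tau>\<close> for two consecutive powers \<open>\<tau>\<close> of 2. Fix a cutoff \<open>\<chi>\<^sub>0\<close> and consider the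
  Fourier transform of \<open>\<chi>\<^sub>0 u n\<close> at \<open>\<xi>\<close>. Association, made uniform by a gliding hump along trigonometric series, bounds
  it by a multiple of \<open>E (l |\<xi>|) / E (b \<tau>)\<close> with fixed \<open>l\<close> and \<open>b\<close>; regularity bounds it by a multiple of
  \<open>E (\<kappa> \<tau>) / E (|\<xi>| / h)\<close> with fixed \<open>\<kappa>\<close> and arbitrarily small \<open>h\<close>. Using the first bound where
  \<open>|\<xi>|\<close> is at most a small multiple of \<open>\<tau>\<close>, and the second one elsewhere, shows that it is
  \<open>O(1 / (\<tau> E (L |\<xi>|)))\<close> for every \<open>L\<close>. Hence the net converges along the powers of 2 in the space of ultradifferentiable
  functions, and its limit represents \<open>T\<close>.

  Nontrivial test functions need not be constructed: if there are none, the claim is void, and otherwise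
  cutoff functions are obtained from any given one by scaling \<open>|\<phi>|\<^sup>2\<close> and averaging over boxes.
\<close>

section \<open>The weight function\<close>

text \<open>The obstacle is that association comes with a separate constant for each test function,
  and that making it uniform costs a growing factor in |\<xi>|. The gliding hump plays the part of
  the uniform boundedness principle: rapidly convergent series of exponentials, cut off by
  \<open>\<chi>\<^sub>0\<close>, are again admissible test functions. The growing factor is harmless
  because in the regularity condition \<open>\<kappa>\<close> is fixed before \<open>h\<close>: the
  decay in |\<xi>| can still be prescribed after \<open>l\<close>, \<open>b\<close> and
  \<open>\<kappa>\<close> are known. Condition (M.2) enters as
  \<open>E \<rho> ^ 4 \<le> c * E (H * \<rho>)\<close>: one dilation of the argument pays for all
  losses at once, namely the growth in |\<xi>|, the wanted weight
  \<open>E (L * maxnorm \<xi>)\<close>, the factor \<open>\<tau>\<close>, and a weight that makes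
  the bound integrable in \<xi>. Differences of members are studied because \<open>T\<close> cancels
  in them. Along the powers of 2 the parameter just doubles, so both members of a difference obey
  bounds of the same form, while the reciprocals of \<open>\<tau>\<close> are summable.\<close>

definition weight_exp :: "(nat \<Rightarrow> real) \<Rightarrow> real \<Rightarrow> real" where
  "weight_exp M \<rho> = exp (assoc_fun M \<rho>)"

lemma exp_neg_assoc_fun: "exp (- assoc_fun M \<rho>) = 1 / weight_exp M \<rho>"
  by (simp add: weight_exp_def exp_minus field_simps)

locale weight =
  fixes M :: "nat \<Rightarrow> real"
  assumes weight: "weight_sequence M"
begin

abbreviation "E \<equiv> weight_exp M"

lemma M_pos: "M p > 0" and M_0: "M 0 = 1"
  using weight by (auto simp: weight_sequence_def)

lemma M_mult_Suc_le: "M a * M (Suc b) \<le> M (Suc a) * M b" if "b \<le> a"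
proof -
  have quot: "M (Suc p) / M p \<le> M (Suc (Suc p)) / M (Suc p)" for p
  proof -
    have "(M (Suc p))\<^sup>2 \<le> M p * M (Suc (Suc p))"
      using weight unfolding weight_sequence_def
      by (metis One_nat_def Suc_eq_plus1 diff_Suc_1 le_add2)
    then show ?thesis using M_pos[of p] M_pos[of "Suc p"]
      by (simp add: field_simps power2_eq_square)
  qed
  have "M (Suc b) / M b \<le> M (Suc a) / M a"
    using lift_Suc_mono_le[of "\<lambda>p. M (Suc p) / M p", OF quot \<open>b \<le> a\<close>] .
  then show ?thesis using M_pos[of a] M_pos[of b] by (simp add: field_simps)
qed

text \<open>Since the quotients \<open>M (Suc p) / M p\<close> increase, the one at \<open>b\<close>
  is at most the one at \<open>a + b\<close>; induction on \<open>b\<close> starts from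
  \<open>M 0 = 1\<close>. This supermultiplicativity keeps Leibniz' rule within the weights.\<close>

lemma M_mult_le: "M a * M b \<le> M (a + b)"
proof (induction b)
  case (Suc b)
  have "M a * M (Suc b) / M b \<le> M (Suc (a + b)) * M b / M b * M a / M (a + b)"
    using M_mult_Suc_le[of b "a + b"] M_pos[of b] M_pos[of a] M_pos[of "a + b"]
    by (simp add: field_simps)
  also have "\<dots> \<le> M (Suc (a + b)) / M b"
    using Suc M_pos[of b] M_pos[of a] M_pos[of "a + b"] M_pos[of "Suc (a + b)"]
    by (simp add: field_simps)
  finally show ?case using M_pos[of b] by (simp add: field_simps)
qed (simp add: M_0)

text \<open>By (M.3) the quotients \<open>M p / M (Suc p)\<close> are summable, hence tend to 0, and
  the terms eventually decrease. The bound is what gives the supremum in \<open>assoc_fun\<close>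
  its meaning, since \<open>SUP\<close> of an unbounded set of reals has no specified value.\<close>

lemma powers_bounded:
  fixes \<rho> :: real
  assumes "\<rho> \<ge> 0"
  shows "\<exists>C>0. \<forall>p. \<rho> ^ p / M p \<le> C"
proof -
  have "summable (\<lambda>i. M (1 + i) / M (1 + i + 1))"
    using weight unfolding weight_sequence_def by blast
  then have "(\<lambda>i. M (1 + i) / M (1 + i + 1)) \<longlonglongrightarrow> 0"
    by (rule summable_LIMSEQ_zero)
  then have "eventually (\<lambda>i. M (1 + i) / M (1 + i + 1) < 1 / (\<rho> + 1)) sequentially"
    by (rule order_tendstoD) (use assms in simp)
  then obtain N where N: "\<And>i. i \<ge> N \<Longrightarrow> M (Suc i) / M (Suc (Suc i)) < 1 / (\<rho> + 1)"
    unfolding eventually_sequentially by auto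
  define c where "c p = \<rho> ^ p / M p" for p
  have c: "c p \<ge> 0" for p using assms M_pos[of p] by (simp add: c_def)
  have step: "c (Suc p) \<le> c p" if p: "p \<ge> Suc N" for p
  proof -
    obtain i where i: "p = Suc i" using p by (cases p) auto
    have "M p * (\<rho> + 1) < M (Suc p)"
      using N[of i] p M_pos[of p] M_pos[of "Suc p"] assms by (simp add: i field_simps)
    then have "M p * \<rho> \<le> M (Suc p)" using M_pos[of p] by (simp add: algebra_simps)
    then have "\<rho> / M (Suc p) \<le> 1 / M p" using M_pos[of p] M_pos[of "Suc p"] by (simp add: field_simps)
    then have "\<rho> ^ p * (\<rho> / M (Suc p)) \<le> \<rho> ^ p * (1 / M p)"
      by (rule mult_left_mono) (use assms in simp)
    then show ?thesis by (simp add: c_def algebra_simps)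
  qed
  have late: "c p \<le> c (Suc N)" if "p \<ge> Suc N" for p
    using that by (induction p rule: dec_induct) (auto intro: order_trans[OF step])
  have "c p \<le> 1 + (\<Sum>q\<le>Suc N. c q)" for p
  proof -
    have le: "c q \<le> (\<Sum>q\<le>Suc N. c q)" if "q \<le> Suc N" for q
      by (rule member_le_sum) (use that c in auto)
    show ?thesis
    proof (cases "p \<le> Suc N")
      case True then show ?thesis using le[of p] by simp
    next
      case False then show ?thesis using late[of p] le[of "Suc N"] by simp
    qed
  qed
  moreover have "1 + (\<Sum>q\<le>Suc N. c q) > 0" using c by (smt (verit) sum_nonneg)
  ultimately show ?thesis unfolding c_def by blast
qed

lemma assoc_fun_bdd:
  assumes "\<rho> > 0"
  shows "bdd_above (range (\<lambda>p. max (ln (\<rho> ^ p / M p)) 0))"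
proof -
  obtain C where C: "C > 0" "\<And>p. \<rho> ^ p / M p \<le> C" using powers_bounded[of \<rho>] assms by auto
  have "ln (\<rho> ^ p / M p) \<le> ln C" for p
    using C assms M_pos[of p] by (simp add: ln_le_cancel_iff)
  then show ?thesis by (intro bdd_aboveI[of _ "max (ln C) 0"]) (auto simp: le_max_iff_disj)
qed

lemma E_ge_1: "\<rho> \<ge> 0 \<Longrightarrow> E \<rho> \<ge> 1"
proof (cases "\<rho> = 0")
  case False
  assume "\<rho> \<ge> 0"
  then have "0 \<le> assoc_fun M \<rho>"
    unfolding assoc_fun_def using False cSUP_upper[OF UNIV_I assoc_fun_bdd, of \<rho> 0] by (auto simp: M_0)
  then show ?thesis by (simp add: weight_exp_def)
qed (simp add: weight_exp_def assoc_fun_def)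

lemma E_pos: "E \<rho> > 0" by (simp add: weight_exp_def)

lemma power_le_E: "\<rho> \<ge> 0 \<Longrightarrow> \<rho> ^ p \<le> M p * E \<rho>"
proof (cases "\<rho> = 0")
  case True
  then show ?thesis using M_pos[of p] E_pos[of \<rho>] E_ge_1[of 0] M_0 by (cases p) auto
next
  case False
  assume "\<rho> \<ge> 0"
  then have "\<rho> > 0" using False by simp
  then have "ln (\<rho> ^ p / M p) \<le> assoc_fun M \<rho>"
    unfolding assoc_fun_def using cSUP_upper[OF UNIV_I assoc_fun_bdd, of \<rho> p] by auto
  then have "\<rho> ^ p / M p \<le> E \<rho>"
    using \<open>\<rho> > 0\<close> M_pos[of p] unfolding weight_exp_def
    by (metis divide_pos_pos exp_le_cancel_iff exp_ln zero_less_power)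
  then show ?thesis using M_pos[of p] by (simp add: field_simps)
qed

text \<open>With \<open>power_le_E\<close> this characterises \<open>E \<rho>\<close> as the
  supremum of \<open>\<rho> ^ p / M p\<close>; the truncation of the logarithm disappears because
  the term for \<open>p = 0\<close> is 1. The factor \<open>X\<close> lets a quantity be multiplied
  by \<open>E \<rho>\<close> once it has been estimated against every power.\<close>

lemma E_least:
  assumes "\<rho> \<ge> 0" "X \<ge> 0" "\<And>p. X * \<rho> ^ p \<le> C * M p"
  shows "X * E \<rho> \<le> C"
proof (cases "\<rho> = 0 \<or> X = 0")
  case True
  then show ?thesis using assms(3)[of 0] by (auto simp: M_0 weight_exp_def assoc_fun_def)
next
  case False
  then have pos: "\<rho> > 0" "X > 0" using assms by auto
  have XC: "X \<le> C" using assms(3)[of 0] by (simp add: M_0)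
  then have "C > 0" using pos by linarith
  have "max (ln (\<rho> ^ p / M p)) 0 \<le> ln (C / X)" for p
  proof -
    have "\<rho> ^ p / M p \<le> C / X" using assms(3)[of p] pos M_pos[of p] by (simp add: field_simps)
    then have "ln (\<rho> ^ p / M p) \<le> ln (C / X)"
      using pos M_pos[of p] \<open>C > 0\<close> by (subst ln_le_cancel_iff) auto
    moreover have "0 \<le> ln (C / X)" using XC pos by (intro ln_ge_zero) (simp add: field_simps)
    ultimately show ?thesis by simp
  qed
  then have "assoc_fun M \<rho> \<le> ln (C / X)"
    unfolding assoc_fun_def using pos by (auto intro: cSUP_least)
  then have "E \<rho> \<le> C / X"
    unfolding weight_exp_def using \<open>C > 0\<close> pos by (metis divide_pos_pos exp_le_cancel_iff exp_ln)
  then show ?thesis using pos by (simp add: field_simps)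
qed

lemma E_mono: "0 \<le> \<rho> \<Longrightarrow> \<rho> \<le> \<sigma> \<Longrightarrow> E \<rho> \<le> E \<sigma>"
  using E_least[of \<rho> 1 "E \<sigma>"] power_le_E[of \<sigma>] power_mono[of \<rho> \<sigma>]
  by (smt (verit) mult.commute mult_1)

text \<open>This is (M.2) in terms of \<open>E\<close>: the product
  \<open>\<rho> ^ p * \<rho> ^ q\<close> is compared with \<open>M p * M q\<close> by way of
  \<open>M (p + q)\<close>, and two nested uses of \<open>E_least\<close> replace one power after
  the other by \<open>E \<rho>\<close>.\<close>

lemma E_square: "\<exists>c H. c \<ge> 1 \<and> H \<ge> 1 \<and> (\<forall>\<rho>\<ge>0. E \<rho> * E \<rho> \<le> c * E (H * \<rho>))"
proof -
  obtain c H where c: "c \<ge> 1" "H \<ge> 1"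
    and M2: "\<And>p. M p \<le> c * H ^ p * Min ((\<lambda>q. M (p - q) * M q) ` {0..p})"
    using weight unfolding weight_sequence_def by blast
  have M2': "M (p + q) \<le> c * H ^ (p + q) * (M p * M q)" for p q
  proof -
    have "Min ((\<lambda>r. M (p + q - r) * M r) ` {0..p + q}) \<le> M p * M q"
      by (rule Min_le) (auto intro!: image_eqI[of _ _ q])
    then show ?thesis using M2[of "p + q"] c
      by (meson mult_left_mono order_trans mult_nonneg_nonneg zero_le_power zero_le_one)
  qed
  have "E \<rho> * E \<rho> \<le> c * E (H * \<rho>)" if "\<rho> \<ge> 0" for \<rho>
  proof (rule E_least[OF that])
    fix p
    have "\<rho> ^ p * E \<rho> \<le> c * E (H * \<rho>) * M p"
    proof (rule E_least[OF that])
      fix q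
      have "\<rho> ^ p * \<rho> ^ q * M (p + q) \<le> c * (H * \<rho>) ^ (p + q) * (M p * M q)"
        using mult_left_mono[OF M2'[of p q], of "\<rho> ^ p * \<rho> ^ q"] that
        by (simp add: power_mult_distrib power_add algebra_simps)
      also have "\<dots> \<le> c * (M (p + q) * E (H * \<rho>)) * (M p * M q)"
        using power_le_E[of "H * \<rho>" "p + q"] c that M_pos[of p] M_pos[of q]
        by (intro mult_right_mono mult_left_mono) auto
      finally show "\<rho> ^ p * \<rho> ^ q \<le> c * E (H * \<rho>) * M p * M q"
        using M_pos[of "p + q"] by (simp add: algebra_simps)
    qed (use that in auto)
    then show "E \<rho> * \<rho> ^ p \<le> c * E (H * \<rho>) * M p" by (simp add: algebra_simps)
  qed (simp add: E_pos less_imp_le)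
  then show ?thesis using c by blast
qed

text \<open>Four is the number of factors that \<open>ft_estimate\<close> has to absorb into a
  single dilation.\<close>

lemma E_fourth: "\<exists>c H. c \<ge> 1 \<and> H \<ge> 1 \<and> (\<forall>\<rho>\<ge>0. E \<rho> ^ 4 \<le> c * E (H * \<rho>))"
proof -
  obtain c H where c: "c \<ge> 1" "H \<ge> 1" "\<And>\<rho>. \<rho> \<ge> 0 \<Longrightarrow> E \<rho> * E \<rho> \<le> c * E (H * \<rho>)"
    using E_square by blast
  have EE: "0 \<le> E \<rho> * E \<rho>" for \<rho> using E_pos[of \<rho>] by simp
  have "E \<rho> ^ 4 \<le> c ^ 3 * E (H * H * \<rho>)" if "\<rho> \<ge> 0" for \<rho>
  proof -
    have "E \<rho> ^ 4 = (E \<rho> * E \<rho>) * (E \<rho> * E \<rho>)" by (simp add: power4_eq_xxxx)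
    also have "\<dots> \<le> (c * E (H * \<rho>)) * (c * E (H * \<rho>))"
      by (rule mult_mono[OF c(3)[OF that] c(3)[OF that] order_trans[OF EE c(3)[OF that]] EE])
    also have "\<dots> = c\<^sup>2 * (E (H * \<rho>) * E (H * \<rho>))" by (simp add: power2_eq_square)
    also have "\<dots> \<le> c\<^sup>2 * (c * E (H * (H * \<rho>)))"
      using c(1,2) that by (intro mult_left_mono c(3)) auto
    finally show ?thesis by (simp add: power3_eq_cube power2_eq_square algebra_simps)
  qed
  moreover have "c ^ 3 \<ge> 1" "H * H \<ge> 1" using c by (auto simp: one_le_power mult_ge1_I)
  ultimately show ?thesis by blast
qed

end

section \<open>Uniform boundedness\<close>

text \<open>If no level \<open>l\<close> works, indices and points are chosen recursively so that
  each term of one series stands out at its own function: the earlier terms are controlled by bounds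
  in \<open>n\<close> at their points, the later ones by the bounds \<open>bdd\<close> of the
  functions already used. The values of that series are unbounded in \<open>n\<close>, against
  \<open>pt\<close>.\<close>

lemma uniform_bound_gliding_hump:
  fixes \<Lambda> :: "nat \<Rightarrow> 'x \<Rightarrow> complex" and w :: "nat \<Rightarrow> 'x \<Rightarrow> real"
  assumes w1: "\<And>l x. w l x \<ge> 1" and w_mono: "\<And>l m x. l \<le> m \<Longrightarrow> w l x \<le> w m x"
    and bdd: "\<And>n. \<exists>B. \<forall>x. cmod (\<Lambda> n x) \<le> B"
    and pt: "\<And>(a :: nat \<Rightarrow> real) \<xi>. (\<And>l. summable (\<lambda>j. \<bar>a j\<bar> * w l (\<xi> j))) \<Longrightarrow>
               \<exists>C. \<forall>n. cmod (\<Sum>j. a j * \<Lambda> n (\<xi> j)) \<le> C"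
  shows "\<exists>l C. \<forall>n x. cmod (\<Lambda> n x) \<le> C * w l x"
proof (rule ccontr)
  assume "\<not> ?thesis"
  then have neg: "\<exists>n x. C * w l x < cmod (\<Lambda> n x)" for l C by (meson not_le)
  obtain B where B: "\<And>n x. cmod (\<Lambda> n x) \<le> B n" using bdd by metis
  have B0: "B n \<ge> 0" for n using B[of n undefined] norm_ge_zero order_trans by blast
  \<comment> \<open>The series with a single unit coefficient turns \<open>pt\<close> into
    boundedness in \<open>n\<close> at each point.\<close>
  have "\<exists>C. \<forall>n. cmod (\<Lambda> n x) \<le> C" for x
  proof -
    have "summable (\<lambda>j. \<bar>if j = (0::nat) then 1 else 0 :: real\<bar> * w l x)" for l
      by (rule summable_finite[of "{0}"]) auto
    from pt[of "\<lambda>j. if j = (0::nat) then 1 else 0" "\<lambda>_. x", OF this]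
    obtain C where "\<forall>n. cmod (\<Sum>j. complex_of_real (if j = (0::nat) then 1 else 0) * \<Lambda> n x) \<le> C" by blast
    moreover have "(\<Sum>j. complex_of_real (if j = (0::nat) then 1 else 0) * \<Lambda> n x) = \<Lambda> n x" for n
      by (subst suminf_finite[of "{0}"]) auto
    ultimately show ?thesis by auto
  qed
  then obtain P where P: "\<And>n x. cmod (\<Lambda> n x) \<le> P x" by metis
  have P0: "P x \<ge> 0" for x using P[of 0 x] norm_ge_zero order_trans by blast
  \<comment> \<open>A state consists of the index and the point of the current hump, its coefficient, a bound for the
    contribution of the humps up to the current one, and a bound for the functions used so far.\<close>
  define ok where "ok = (\<lambda>(j::nat) (n::nat, x::'x, a::real, S::real, R::real).
     0 < a \<and> a * w j x \<le> (1/2) ^ j \<and> 0 \<le> S \<and> 0 \<le> R \<and> B n \<le> R)"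
  \<comment> \<open>The first condition makes the new coefficient negligible for all functions used
    so far, which \<open>R\<close> bounds; the second lets the new hump exceed the contribution
    \<open>S\<close> of the earlier ones by more than \<open>j + 1\<close>.\<close>
  define nxt where "nxt = (\<lambda>(j::nat) (n::nat, x::'x, a::real, S::real, R::real) (n'::nat, x'::'x, a'::real, S'::real, R'::real).
     a' * (1 + R) \<le> (1/2) ^ Suc j \<and> real j + 1 + S < a' * cmod (\<Lambda> n' x')
     \<and> S + a' * P x' \<le> S' \<and> R \<le> R')"
  have "\<exists>f. \<forall>j. ok j (f j) \<and> nxt j (f j) (f (Suc j))"
  proof (rule dependent_nat_choice)
    have "ok 0 (0, undefined, 1 / w 0 undefined, 0, B 0)"
      using w1[of 0 undefined] B0[of 0] by (simp add: ok_def)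
    then show "\<exists>x. ok 0 x" by blast
  next
    fix s j assume "ok j s"
    obtain n x a S R where s: "s = (n, x, a, S, R)" by (cases s)
    have SR: "S \<ge> 0" "R \<ge> 0" using \<open>ok j s\<close> by (auto simp: s ok_def)
    define \<delta> where "\<delta> = (1/2) ^ Suc j / (1 + R)"
    have \<delta>: "\<delta> > 0" using SR by (simp add: \<delta>_def)
    \<comment> \<open>The claim fails at level \<open>Suc j\<close> for this constant, which becomes
      \<open>real j + 1 + S\<close> after multiplication by
      \<open>a' = \<delta> / w (Suc j) x'\<close>.\<close>
    obtain n' x' where nx: "(real j + 1 + S) / \<delta> * w (Suc j) x' < cmod (\<Lambda> n' x')" using neg by blast
    define a' where "a' = \<delta> / w (Suc j) x'"
    have w': "w (Suc j) x' \<ge> 1" by (rule w1)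
    have a': "a' > 0" "a' \<le> \<delta>" using \<delta> w' by (auto simp: a'_def field_simps)
    have "\<delta> \<le> (1/2) ^ Suc j / 1" unfolding \<delta>_def by (rule divide_left_mono) (use SR in auto)
    then have "a' * w (Suc j) x' \<le> (1/2) ^ Suc j" using w' by (simp add: a'_def)
    then have "ok (Suc j) (n', x', a', S + a' * P x', max R (B n'))"
      using a' SR P0[of x'] B0[of n'] by (auto simp: ok_def le_max_iff_disj)
    moreover have "real j + 1 + S < a' * cmod (\<Lambda> n' x')"
      using nx \<delta> w' by (simp add: a'_def field_simps)
    moreover have "a' * (1 + R) \<le> (1/2) ^ Suc j"
    proof -
      have "\<delta> * (1 + R) = (1/2) ^ Suc j" using SR by (simp add: \<delta>_def del: power_Suc)
      moreover have "a' * (1 + R) \<le> \<delta> * (1 + R)" by (rule mult_right_mono[OF a'(2)]) (use SR in simp)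
      ultimately show ?thesis by (simp only:)
    qed
    ultimately have "ok (Suc j) (n', x', a', S + a' * P x', max R (B n')) \<and>
       nxt j s (n', x', a', S + a' * P x', max R (B n'))"
      by (simp add: s nxt_def)
    then show "\<exists>y. ok (Suc j) y \<and> nxt j s y" by blast
  qed
  then obtain f where f: "\<And>j. ok j (f j)" "\<And>j. nxt j (f j) (f (Suc j))" by blast
  define n where "n j = fst (f j)" for j
  define \<xi> where "\<xi> j = fst (snd (f j))" for j
  define a where "a j = fst (snd (snd (f j)))" for j
  define S where "S j = fst (snd (snd (snd (f j))))" for j
  define R where "R j = snd (snd (snd (snd (f j))))" for j
  have fj: "f j = (n j, \<xi> j, a j, S j, R j)" for j
    by (simp add: n_def \<xi>_def a_def S_def R_def)
  have a: "a j > 0" "a j * w j (\<xi> j) \<le> (1/2) ^ j" "S j \<ge> 0" "R j \<ge> 0" "B (n j) \<le> R j" for j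
    using f(1)[of j] by (auto simp: fj ok_def)
  have nx: "a (Suc j) * (1 + R j) \<le> (1/2) ^ Suc j"
     "real j + 1 + S j < a (Suc j) * cmod (\<Lambda> (n (Suc j)) (\<xi> (Suc j)))"
     "S j + a (Suc j) * P (\<xi> (Suc j)) \<le> S (Suc j)" "R j \<le> R (Suc j)" for j
    using f(2)[of j] by (auto simp: fj nxt_def)
  \<comment> \<open>The zeroth state has no hump; its coefficient is dropped.\<close>
  define b where "b j = (if j = 0 then 0 else a j)" for j
  have b: "b j \<ge> 0" "b j \<le> a j" for j using a(1)[of j] by (auto simp: b_def)
  have R_mono: "R i \<le> R j" if "i \<le> j" for i j using lift_Suc_mono_le[of R, OF nx(4) that] .
  \<comment> \<open>From index \<open>l\<close> on, level \<open>l\<close> is dominated by level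
    \<open>j\<close>, so the geometric bound at level \<open>j\<close> serves every
    \<open>l\<close>.\<close>
  have summ: "summable (\<lambda>j. \<bar>b j\<bar> * w l (\<xi> j))" for l
  proof (rule summable_comparison_test_ev)
    show "\<forall>\<^sub>F j in sequentially. norm (\<bar>b j\<bar> * w l (\<xi> j)) \<le> (1/2) ^ j"
    proof (rule eventually_sequentiallyI[of l])
      fix j assume "l \<le> j"
      have "b j * w l (\<xi> j) \<le> a j * w j (\<xi> j)"
        using b[of j] w_mono[OF \<open>l \<le> j\<close>, of "\<xi> j"] w1[of l "\<xi> j"] by (intro mult_mono) auto
      then show "norm (\<bar>b j\<bar> * w l (\<xi> j)) \<le> (1/2) ^ j"
        using b(1)[of j] w1[of l "\<xi> j"] a(2)[of j] by (simp add: abs_mult)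
    qed
  qed (simp add: summable_geometric)
  obtain C where C: "\<And>m. cmod (\<Sum>j. b j * \<Lambda> m (\<xi> j)) \<le> C" using pt[OF summ] by blast
  \<comment> \<open>At the function of hump \<open>Suc j\<close> the earlier terms contribute at
    most \<open>S j\<close>, the later ones at most 1, and the whole series at most
    \<open>C\<close>. The hump exceeds \<open>j + 1 + S j\<close>, which leaves \<open>j\<close>
    below \<open>C\<close>.\<close>
  have big: "real j \<le> C" for j
  proof -
    let ?m = "n (Suc j)"
    define t where "t i = complex_of_real (b i) * \<Lambda> ?m (\<xi> i)" for i
    have tail: "norm (t (i + Suc (Suc j))) \<le> (1/2) ^ (i + Suc (Suc j))" for i
    proof -
      have "cmod (\<Lambda> ?m (\<xi> (i + Suc (Suc j)))) \<le> 1 + R (Suc (i + j))"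
        using B[of ?m] a(5)[of "Suc j"] R_mono[of "Suc j" "Suc (i + j)"] by (smt (verit) le_add2 Suc_le_mono)
      then have "norm (t (i + Suc (Suc j))) \<le> a (Suc (Suc (i + j))) * (1 + R (Suc (i + j)))"
        using a(1)[of "Suc (Suc (i + j))"] by (simp add: t_def b_def norm_mult)
      then show ?thesis using nx(1)[of "Suc (i + j)"] by simp
    qed
    have st: "summable t"
    proof (subst summable_iff_shift[of t "Suc (Suc j)", symmetric], rule summable_comparison_test_ev)
      show "\<forall>\<^sub>F i in sequentially. norm (t (i + Suc (Suc j))) \<le> (1/2) ^ i * (1/2) ^ Suc (Suc j)"
        using tail by (auto simp: power_add)
    qed (intro summable_mult2 summable_geometric, simp)
    have tl: "cmod (\<Sum>i. t (i + Suc (Suc j))) \<le> 1"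
    proof -
      have "cmod (\<Sum>i. t (i + Suc (Suc j))) \<le> (\<Sum>i. (1/2) ^ i * (1/2) ^ Suc (Suc j) :: real)"
        by (rule norm_suminf_le) (use tail in \<open>auto intro!: summable_mult2 summable_geometric simp: power_add\<close>)
      also have "\<dots> = 2 * (1/2) ^ Suc (Suc j)"
        by (subst suminf_mult2[symmetric]) (auto simp: suminf_geometric intro: summable_geometric)
      also have "\<dots> \<le> 1" using power_le_one[of "1/2 :: real" j] by simp
      finally show ?thesis .
    qed
    have hd: "cmod (\<Sum>i<Suc j. t i) \<le> S j"
    proof -
      have "(\<Sum>i<Suc k. cmod (t i)) \<le> S k" for k
      proof (induction k)
        case 0 then show ?case using a(3)[of 0] by (simp add: t_def b_def)
      next
        case (Suc k)
        have "cmod (t (Suc k)) \<le> a (Suc k) * P (\<xi> (Suc k))"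
          using a(1)[of "Suc k"] P by (simp add: t_def b_def norm_mult)
        then show ?case using Suc nx(3)[of k] by simp
      qed
      from order_trans[OF norm_sum this[of j]] show ?thesis .
    qed
    have "(\<Sum>i. t i) = (\<Sum>i. t (i + Suc (Suc j))) + (\<Sum>i<Suc (Suc j). t i)"
      by (rule suminf_split_initial_segment[OF st])
    then have eq: "t (Suc j) = (\<Sum>i. t i) - (\<Sum>i. t (i + Suc (Suc j))) - (\<Sum>i<Suc j. t i)" by simp
    have "cmod (\<Sum>i. t i) \<le> C" using C[of ?m] by (simp add: t_def)
    then have "cmod (t (Suc j)) \<le> C + 1 + S j"
      unfolding eq using tl hd
      by (intro order_trans[OF norm_triangle_ineq4] add_mono) auto
    moreover have "cmod (t (Suc j)) = a (Suc j) * cmod (\<Lambda> ?m (\<xi> (Suc j)))"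
      using a(1)[of "Suc j"] by (simp add: t_def b_def norm_mult)
    ultimately show ?thesis using nx(2)[of j] by linarith
  qed
  then show False using reals_Archimedean2[of C] by (meson not_le)
qed

section \<open>Iterated partial derivatives\<close>

text \<open>\<open>frechet_derivative\<close> is a choice among all derivatives at the point, so it
  suffices that both functions have the same ones.\<close>

lemma frechet_derivative_cong_open:
  assumes "open S" "x \<in> S" "\<And>y. y \<in> S \<Longrightarrow> f y = g y"
  shows "frechet_derivative f (at x) = frechet_derivative g (at x)"
proof -
  have "(f has_derivative D) (at x) = (g has_derivative D) (at x)" for D
    using has_derivative_transform_within_open[of f D x UNIV S g]
      has_derivative_transform_within_open[of g D x UNIV S f] assms by auto
  then show ?thesis by (simp add: frechet_derivative_def)
qed

lemma partial_deriv_cong: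
  assumes "open S" "x \<in> S" "\<And>y. y \<in> S \<Longrightarrow> f y = g y"
  shows "partial_deriv i f x = partial_deriv i g x"
  using frechet_derivative_cong_open[OF assms] by (simp add: partial_deriv_def)

lemma iter_partial_cong:
  assumes "open S" "x \<in> S" "\<And>y. y \<in> S \<Longrightarrow> f y = g y"
  shows "iter_partial is f x = iter_partial is g x"
  using assms(2)
proof (induction "is" arbitrary: x)
  case (Cons i "is")
  then show ?case using partial_deriv_cong[OF assms(1), of x "iter_partial is f" "iter_partial is g"] by simp
qed (use assms(3) in simp)

lemma partial_deriv_unique:
  "(f has_derivative D) (at x) \<Longrightarrow> partial_deriv i f x = D (axis i 1)"
  unfolding partial_deriv_def using frechet_derivative_at by metis

text \<open>The differential with partial derivatives \<open>d\<close>. With this normal form every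
  differentiation rule becomes an identity between families of partial derivatives.\<close>

definition gradient_map :: "('n::finite \<Rightarrow> complex) \<Rightarrow> real ^ 'n \<Rightarrow> complex" where
  "gradient_map d h = (\<Sum>i\<in>UNIV. h $ i *\<^sub>R d i)"

lemma gradient_map_axis: "gradient_map d (axis i 1) = d i"
  by (simp add: gradient_map_def axis_def if_distrib[where f="\<lambda>c. c *\<^sub>R _"] cong: if_cong)

lemma gradient_map_simps:
  "c * gradient_map d h = gradient_map (\<lambda>i. c * d i) h"
  "gradient_map d h * c = gradient_map (\<lambda>i. d i * c) h"
  "gradient_map d h + gradient_map d' h = gradient_map (\<lambda>i. d i + d' i) h"
  "r *\<^sub>R gradient_map d h = gradient_map (\<lambda>i. r *\<^sub>R d i) h"
  "cnj (gradient_map d h) = gradient_map (\<lambda>i. cnj (d i)) h"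
  "gradient_map d (r *\<^sub>R h) = gradient_map (\<lambda>i. r *\<^sub>R d i) h"
  by (simp_all add: gradient_map_def sum_distrib_left sum_distrib_right sum.distrib scaleR_add_right
      scaleR_sum_right scaleR_left_commute ac_simps)

lemma norm_gradient_map_le:
  assumes "\<And>i. cmod (d i) \<le> e"
  shows "cmod (gradient_map d h) \<le> real CARD('n) * e * norm (h :: real ^ 'n::finite)"
proof -
  have "cmod (gradient_map d h) \<le> (\<Sum>i\<in>(UNIV :: 'n set). norm h * e)"
    unfolding gradient_map_def
    by (rule sum_norm_le) (auto intro!: mult_mono assms component_le_norm_cart)
  then show ?thesis by (simp add: mult_ac)
qed

lemma has_derivative_gradient_map:
  assumes "f differentiable (at x)"
  shows "(f has_derivative gradient_map (\<lambda>i. partial_deriv i f x)) (at x)"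
proof -
  let ?D = "frechet_derivative f (at x)"
  have D: "(f has_derivative ?D) (at x)" using assms frechet_derivative_works by blast
  then have lin: "linear ?D" by (simp add: has_derivative_linear)
  have "?D h = gradient_map (\<lambda>i. partial_deriv i f x) h" for h
  proof -
    have "?D h = ?D (\<Sum>i\<in>UNIV. h $ i *\<^sub>R axis i 1)"
      by (metis basis_expansion scalar_mult_eq_scaleR)
    then show ?thesis
      using lin by (simp add: gradient_map_def partial_deriv_def linear_sum linear_scale o_def)
  qed
  then have "?D = gradient_map (\<lambda>i. partial_deriv i f x)" by blast
  then show ?thesis using D by simp
qed

lemma smooth_on_iff_at:
  "open S \<Longrightarrow> smooth_on S f \<longleftrightarrow> (\<forall>is. \<forall>x\<in>S. iter_partial is f differentiable (at x))"
  by (simp add: smooth_on_def differentiable_on_eq_differentiable_at)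

lemma smooth_on_has_derivative:
  assumes "open S" "smooth_on S f" "x \<in> S"
  shows "(iter_partial is f has_derivative gradient_map (\<lambda>i. iter_partial (i # is) f x)) (at x)"
  using has_derivative_gradient_map[of "iter_partial is f" x] assms by (simp add: smooth_on_iff_at)

lemma smooth_on_continuous:
  "smooth_on S f \<Longrightarrow> continuous_on S (iter_partial is f)"
  by (simp add: smooth_on_def differentiable_imp_continuous_on)

lemma iter_partial_append: "iter_partial js (iter_partial is f) = iter_partial (js @ is) f"
  by (induction js) auto

lemma smooth_on_iter_partial: "smooth_on S f \<Longrightarrow> smooth_on S (iter_partial is f)"
  by (simp add: smooth_on_def iter_partial_append)

lemma smooth_on_subset: "smooth_on S f \<Longrightarrow> T \<subseteq> S \<Longrightarrow> smooth_on T f"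
  unfolding smooth_on_def using differentiable_on_subset by blast

text \<open>Smoothness and the iterated derivatives are always obtained by exhibiting a family of functions,
  indexed by lists of coordinates, which is closed under differentiation.\<close>

lemma
  assumes "open S" "\<And>x. x \<in> S \<Longrightarrow> F [] x = f x"
    and deriv: "\<And>is x. x \<in> S \<Longrightarrow> (F is has_derivative gradient_map (\<lambda>i. F (i # is) x)) (at x)"
  shows smooth_on_family: "smooth_on S f"
    and iter_partial_family: "x \<in> S \<Longrightarrow> iter_partial is f x = F is x"
proof -
  show eq: "iter_partial is f x = F is x" if "x \<in> S" for x "is"
    using that
  proof (induction "is" arbitrary: x)
    case (Cons i "is")
    have "iter_partial (i # is) f x = partial_deriv i (F is) x"
      using partial_deriv_cong[OF assms(1) Cons.prems, of "iter_partial is f" "F is"] Cons.IH by simp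
    also have "\<dots> = F (i # is) x"
      using partial_deriv_unique[OF deriv[OF Cons.prems]] by (simp add: gradient_map_axis)
    finally show ?case .
  qed (use assms(2) in simp)
  show "smooth_on S f"
    unfolding smooth_on_iff_at[OF assms(1)]
  proof (intro allI ballI)
    fix "is" x assume "x \<in> S"
    have "(iter_partial is f has_derivative gradient_map (\<lambda>i. F (i # is) x)) (at x)"
      using has_derivative_transform_within_open[OF deriv[OF \<open>x \<in> S\<close>] assms(1) \<open>x \<in> S\<close>] eq by simp
    then show "iter_partial is f differentiable (at x)" by (auto simp: differentiable_def)
  qed
qed

lemma
  assumes "open S" "smooth_on S f" "smooth_on S g"
  shows smooth_on_linear: "smooth_on S (\<lambda>x. a * f x + b * g x)"
    and iter_partial_linear: "x \<in> S \<Longrightarrow>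
      iter_partial is (\<lambda>x. a * f x + b * g x) x = a * iter_partial is f x + b * iter_partial is g x"
proof -
  let ?F = "\<lambda>is x. a * iter_partial is f x + b * iter_partial is g x"
  have *: "(?F is has_derivative gradient_map (\<lambda>i. ?F (i # is) x)) (at x)" if "x \<in> S" for "is" x
    using smooth_on_has_derivative[OF assms(1,2) that, of "is"]
      smooth_on_has_derivative[OF assms(1,3) that, of "is"]
    by (auto intro!: derivative_eq_intros simp: gradient_map_simps)
  show "smooth_on S (\<lambda>x. a * f x + b * g x)" by (rule smooth_on_family[of S ?F]) (use * assms(1) in auto)
  show "iter_partial is (\<lambda>x. a * f x + b * g x) x = ?F is x" if "x \<in> S"
    by (rule iter_partial_family[of S ?F]) (use * assms(1) that in auto)
qed

lemma
  assumes "open S" "smooth_on S f" "smooth_on S g"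
  shows smooth_on_diff: "smooth_on S (\<lambda>x. f x - g x)"
    and iter_partial_diff: "x \<in> S \<Longrightarrow>
      iter_partial is (\<lambda>x. f x - g x) x = iter_partial is f x - iter_partial is g x"
  using smooth_on_linear[OF assms, of 1 "-1"] iter_partial_linear[OF assms, of x "is" 1 "-1"] by simp_all

lemma
  assumes "smooth_on UNIV f"
  shows smooth_on_cnj: "smooth_on UNIV (\<lambda>x. cnj (f x))"
    and iter_partial_cnj: "iter_partial is (\<lambda>x. cnj (f x)) x = cnj (iter_partial is f x)"
proof -
  let ?F = "\<lambda>is x. cnj (iter_partial is f x)"
  have *: "(?F is has_derivative gradient_map (\<lambda>i. ?F (i # is) x)) (at x)" for "is" x
    using has_derivative_cnj[OF smooth_on_has_derivative[OF open_UNIV assms UNIV_I, of "is" x]]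
    by (simp add: gradient_map_simps)
  show "smooth_on UNIV (\<lambda>x. cnj (f x))" by (rule smooth_on_family[of UNIV ?F]) (use * in auto)
  show "iter_partial is (\<lambda>x. cnj (f x)) x = ?F is x"
    by (rule iter_partial_family[of UNIV ?F]) (use * in auto)
qed

lemma
  assumes "smooth_on UNIV f"
  shows smooth_on_affine: "smooth_on UNIV (\<lambda>x. f (a + t *\<^sub>R x))"
    and iter_partial_affine: "iter_partial is (\<lambda>x. f (a + t *\<^sub>R x)) x
      = of_real (t ^ length is) * iter_partial is f (a + t *\<^sub>R x)"
proof -
  let ?F = "\<lambda>is x. of_real (t ^ length is) * iter_partial is f (a + t *\<^sub>R x)"
  have *: "(?F is has_derivative gradient_map (\<lambda>i. ?F (i # is) x)) (at x)" for "is" x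
  proof -
    have "((\<lambda>x. a + t *\<^sub>R x) has_derivative (\<lambda>h. t *\<^sub>R h)) (at x)"
      by (auto intro!: derivative_eq_intros)
    from has_derivative_compose[OF this smooth_on_has_derivative[OF open_UNIV assms UNIV_I, of "is"]]
    have "((\<lambda>x. iter_partial is f (a + t *\<^sub>R x)) has_derivative
       gradient_map (\<lambda>i. t *\<^sub>R iter_partial (i # is) f (a + t *\<^sub>R x))) (at x)"
      by (simp add: gradient_map_simps)
    from has_derivative_mult_right[OF this, of "of_real (t ^ length is)"] show ?thesis
      by (simp add: gradient_map_simps scaleR_conv_of_real mult_ac)
  qed
  show "smooth_on UNIV (\<lambda>x. f (a + t *\<^sub>R x))" by (rule smooth_on_family[of UNIV ?F]) (use * in auto)
  show "iter_partial is (\<lambda>x. f (a + t *\<^sub>R x)) x = ?F is x"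
    by (rule iter_partial_family[of UNIV ?F]) (use * in auto)
qed

text \<open>The open sets \<open>S\<close> and \<open>- K\<close> cover the space, and all
  derivatives vanish on the second.\<close>

lemma
  assumes "open S" "smooth_on S f" "closed K" "K \<subseteq> S" "\<And>x. x \<notin> K \<Longrightarrow> f x = 0"
  shows smooth_on_extend: "smooth_on UNIV f"
    and iter_partial_outside: "x \<notin> K \<Longrightarrow> iter_partial is f x = 0"
proof -
  have zero: "iter_partial is f x = 0" if "x \<notin> K" for x "is"
  proof -
    have "iter_partial is (\<lambda>_. 0) x = (0::complex)" for x :: "real ^ 'a"
      by (rule iter_partial_family[of UNIV "\<lambda>_ _. 0"]) (auto simp: gradient_map_def[abs_def])
    moreover have "iter_partial is f x = iter_partial is (\<lambda>_. 0) x"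
      by (rule iter_partial_cong[of "- K"]) (use assms that in auto)
    ultimately show ?thesis by simp
  qed
  then show "x \<notin> K \<Longrightarrow> iter_partial is f x = 0" by blast
  show "smooth_on UNIV f"
    unfolding smooth_on_iff_at[OF open_UNIV]
  proof (intro allI ballI)
    fix "is" x
    show "iter_partial is f differentiable (at x)"
    proof (cases "x \<in> K")
      case True
      then show ?thesis using assms by (auto simp: smooth_on_iff_at)
    next
      case False
      have "((\<lambda>_. 0 :: complex) has_derivative (\<lambda>_. 0)) (at x)" by simp
      then have "(iter_partial is f has_derivative (\<lambda>_. 0)) (at x)"
        by (rule has_derivative_transform_within_open[of _ _ _ _ "- K"])
          (use assms(3) False zero in auto)
      then show ?thesis by (auto simp: differentiable_def)
    qed
  qed
qed

text \<open>All ways to distribute the entries of a list over two lists, in order and with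
  multiplicity. The multiplicities take the place of the binomial coefficients in Leibniz'
  rule.\<close>

primrec splits :: "'a list \<Rightarrow> ('a list \<times> 'a list) list" where
  "splits [] = [([], [])]"
| "splits (i # is) = concat (map (\<lambda>(a, b). [(i # a, b), (a, i # b)]) (splits is))"

lemma has_derivative_sum_list:
  "(\<And>z. z \<in> set zs \<Longrightarrow> (f z has_derivative f' z) F) \<Longrightarrow>
    ((\<lambda>x. \<Sum>z\<leftarrow>zs. f z x) has_derivative (\<lambda>h. \<Sum>z\<leftarrow>zs. f' z h)) F"
  by (induction zs) (auto intro!: has_derivative_add)

lemma sum_list_gradient_map:
  "(\<Sum>z\<leftarrow>zs. gradient_map (d z) h) = gradient_map (\<lambda>i. \<Sum>z\<leftarrow>zs. d z i) h"
  by (induction zs) (simp_all add: gradient_map_simps, simp add: gradient_map_def)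

lemma sum_list_splits_Cons:
  "(\<Sum>(a, b)\<leftarrow>splits (i # is). t a b) = (\<Sum>(a, b)\<leftarrow>splits is. t (i # a) b + t a (i # b))"
  for t :: "'a list \<Rightarrow> 'a list \<Rightarrow> 'b::comm_monoid_add"
proof -
  have "(\<Sum>(a, b)\<leftarrow>concat (map (\<lambda>(a, b). [(i # a, b), (a, i # b)]) zs). t a b)
    = (\<Sum>(a, b)\<leftarrow>zs. t (i # a) b + t a (i # b))" for zs
    by (induction zs) (auto simp: add_ac)
  then show ?thesis by simp
qed

lemma
  assumes "open S" "smooth_on S f" "smooth_on S g"
  shows smooth_on_mult: "smooth_on S (\<lambda>x. f x * g x)"
    and iter_partial_mult: "x \<in> S \<Longrightarrow> iter_partial is (\<lambda>x. f x * g x) x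
      = (\<Sum>(a, b)\<leftarrow>splits is. iter_partial a f x * iter_partial b g x)"
proof -
  let ?F = "\<lambda>is x. \<Sum>(a, b)\<leftarrow>splits is. iter_partial a f x * iter_partial b g x"
  have *: "(?F is has_derivative gradient_map (\<lambda>i. ?F (i # is) x)) (at x)" if "x \<in> S" for "is" x
  proof -
    have "((\<lambda>x. \<Sum>z\<leftarrow>splits is. iter_partial (fst z) f x * iter_partial (snd z) g x) has_derivative
      (\<lambda>h. \<Sum>z\<leftarrow>splits is. gradient_map (\<lambda>i. iter_partial (i # fst z) f x * iter_partial (snd z) g x
          + iter_partial (fst z) f x * iter_partial (i # snd z) g x) h)) (at x)"
    proof (rule has_derivative_sum_list)
      fix z assume "z \<in> set (splits is)"
      show "((\<lambda>x. iter_partial (fst z) f x * iter_partial (snd z) g x) has_derivative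
        gradient_map (\<lambda>i. iter_partial (i # fst z) f x * iter_partial (snd z) g x
          + iter_partial (fst z) f x * iter_partial (i # snd z) g x)) (at x)"
        using has_derivative_mult[OF smooth_on_has_derivative[OF assms(1,2) that, of "fst z"]
          smooth_on_has_derivative[OF assms(1,3) that, of "snd z"]]
        by (simp add: gradient_map_simps add.commute)
    qed
    then show ?thesis
      unfolding sum_list_gradient_map sum_list_splits_Cons by (simp add: case_prod_unfold)
  qed
  show "smooth_on S (\<lambda>x. f x * g x)" by (rule smooth_on_family[of S ?F]) (use * assms(1) in auto)
  show "iter_partial is (\<lambda>x. f x * g x) x = ?F is x" if "x \<in> S"
    by (rule iter_partial_family[of S ?F]) (use * assms(1) that in auto)
qed

lemma length_splits: "(a, b) \<in> set (splits is) \<Longrightarrow> length a + length b = length is"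
  by (induction "is" arbitrary: a b) auto

text \<open>The binomial theorem; it turns bounds at \<open>s\<close> and \<open>t\<close> for two
  factors into a bound at \<open>s + t\<close> for their product.\<close>

lemma sum_list_splits_power:
  "(\<Sum>(a, b)\<leftarrow>splits is. s ^ length a * t ^ length b) = (s + t) ^ length is" for s t :: real
proof (induction "is")
  case (Cons i "is")
  show ?case
    unfolding sum_list_splits_Cons
    by (simp add: Cons.IH[symmetric] case_prod_unfold sum_list_const_mult[symmetric] algebra_simps)
qed simp

section \<open>Multi-indices as lists\<close>

definition midx :: "('n::finite \<Rightarrow> nat) \<Rightarrow> 'n list" where
  "midx \<alpha> = concat (map (\<lambda>i. replicate (\<alpha> i) i) coords)"

lemma multi_deriv_midx: "multi_deriv \<alpha> f = iter_partial (midx \<alpha>) f"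
  by (simp add: multi_deriv_def midx_def)

lemma length_midx: "length (midx \<alpha>) = (\<Sum>i\<in>UNIV. \<alpha> i)"
  by (simp add: midx_def length_concat o_def sum_list_distinct_conv_sum_set coords)

lemma replicate_is_midx: "\<exists>\<alpha>. replicate p i = midx \<alpha>"
proof -
  have "concat (map (\<lambda>j. replicate (if j = i then p else 0) j) cs) = replicate (if i \<in> set cs then p else 0) i"
    if "distinct cs" for cs
    using that by (induction cs) auto
  from this[of coords] show ?thesis by (auto simp: midx_def coords intro!: exI[of _ "\<lambda>j. if j = i then p else 0"])
qed

lemma splits_replicate_append:
  "(a, b) \<in> set (splits (replicate n c @ js)) \<Longrightarrow>
    \<exists>k l a' b'. a = replicate k c @ a' \<and> b = replicate l c @ b' \<and> (a', b') \<in> set (splits js)"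
proof (induction n arbitrary: a b)
  case 0 then show ?case by (intro exI[of _ 0] exI[of _ a] exI[of _ b]) auto
next
  case (Suc n)
  then obtain a1 b1 where ab: "(a1, b1) \<in> set (splits (replicate n c @ js))"
    "(a = c # a1 \<and> b = b1) \<or> (a = a1 \<and> b = c # b1)" by auto
  from Suc.IH[OF ab(1)] obtain k l a' b' where
    "a1 = replicate k c @ a'" "b1 = replicate l c @ b'" "(a', b') \<in> set (splits js)" by blast
  then show ?case using ab(2) by (metis append_Cons replicate_Suc)
qed

text \<open>Both parts of a list sorted by \<open>coords\<close> are sorted again. Hence bounds that
  are assumed only for \<open>multi_deriv\<close>, that is for sorted lists, cover all terms of
  Leibniz' rule.\<close>

lemma splits_midx:
  assumes "(a, b) \<in> set (splits (midx \<alpha>))"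
  shows "\<exists>\<beta> \<gamma>. a = midx \<beta> \<and> b = midx \<gamma>"
proof -
  have "\<exists>\<beta> \<gamma>. a = concat (map (\<lambda>i. replicate (\<beta> i) i) cs) \<and> b = concat (map (\<lambda>i. replicate (\<gamma> i) i) cs)"
    if "distinct cs" "(a, b) \<in> set (splits (concat (map (\<lambda>i. replicate (\<alpha> i) i) cs)))" for cs
    using that
  proof (induction cs arbitrary: a b)
    case (Cons c cs)
    obtain k l a' b' where ab: "a = replicate k c @ a'" "b = replicate l c @ b'"
       "(a', b') \<in> set (splits (concat (map (\<lambda>i. replicate (\<alpha> i) i) cs)))"
      using splits_replicate_append Cons.prems(2) by force
    obtain \<beta> \<gamma> where "a' = concat (map (\<lambda>i. replicate (\<beta> i) i) cs)" "b' = concat (map (\<lambda>i. replicate (\<gamma> i) i) cs)"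
      using Cons.IH[OF _ ab(3)] Cons.prems(1) by auto
    then have "a = concat (map (\<lambda>i. replicate ((\<beta>(c := k)) i) i) (c # cs))"
      "b = concat (map (\<lambda>i. replicate ((\<gamma>(c := l)) i) i) (c # cs))"
      using Cons.prems(1) ab(1,2) by (auto intro!: arg_cong[of _ _ concat])
    then show ?case by blast
  qed auto
  then show ?thesis using assms coords by (simp add: midx_def)
qed

text \<open>The family \<open>P\<close> is closed under differentiation by the theorem on
  derivatives of a limit: near a point the differentials converge uniformly because their finitely
  many partial derivatives do.\<close>

lemma
  fixes f :: "nat \<Rightarrow> real ^ 'n::finite \<Rightarrow> complex"
  assumes "open S" "\<And>n. smooth_on S (f n)"
    and lim: "\<And>x is. x \<in> S \<Longrightarrow> \<exists>r>0. ball x r \<subseteq> S \<and>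
       uniform_limit (ball x r) (\<lambda>n. iter_partial is (f n)) (P is) sequentially"
    and g: "\<And>x. x \<in> S \<Longrightarrow> g x = P [] x"
  shows smooth_on_limit: "smooth_on S g"
    and iter_partial_limit: "x \<in> S \<Longrightarrow> iter_partial is g x = P is x"
proof -
  have *: "(P is has_derivative gradient_map (\<lambda>i. P (i # is) x)) (at x)" if x: "x \<in> S" for "is" x
  proof -
    have "\<exists>r. \<forall>js. r js > 0 \<and> ball x (r js) \<subseteq> S \<and>
       uniform_limit (ball x (r js)) (\<lambda>n. iter_partial js (f n)) (P js) sequentially"
      using lim[OF x] by metis
    then obtain r where r: "\<And>js. r js > 0" "\<And>js. ball x (r js) \<subseteq> S"
      "\<And>js. uniform_limit (ball x (r js)) (\<lambda>n. iter_partial js (f n)) (P js) sequentially"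
      by blast
    \<comment> \<open>The radius may depend on the list. Differentiating \<open>P is\<close>
      involves only \<open>is\<close> and its finitely many extensions by one coordinate, so the
      minimum is positive.\<close>
    define R where "R = Min (insert (r is) (range (\<lambda>i. r (i # is))))"
    have R: "R > 0" "R \<le> r is" "\<And>i. R \<le> r (i # is)"
      unfolding R_def using r(1) by (auto intro: Min_le simp del: Min_insert simp: Min_gr_iff)
    have ul: "uniform_limit (ball x R) (\<lambda>n. iter_partial js (f n)) (P js) sequentially"
      if "js = is \<or> (\<exists>i. js = i # is)" for js
      by (rule uniform_limit_on_subset[OF r(3)[of js]]) (use that R subset_ball[of R "r js" x] in auto)
    have "\<exists>G. \<forall>y\<in>ball x R. (\<lambda>n. iter_partial is (f n) y) \<longlonglongrightarrow> G y \<and>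
       (G has_derivative gradient_map (\<lambda>i. P (i # is) y)) (at y within ball x R)"
    proof (rule has_derivative_sequence[of "ball x R" "\<lambda>n. iter_partial is (f n)"
          "\<lambda>n y. gradient_map (\<lambda>i. iter_partial (i # is) (f n) y)"
          "\<lambda>y. gradient_map (\<lambda>i. P (i # is) y)" x "P is x"])
      show "convex (ball x R)" by simp
      show "x \<in> ball x R" using R(1) by simp
      show "(iter_partial is (f n) has_derivative gradient_map (\<lambda>i. iter_partial (i # is) (f n) y)) (at y within ball x R)"
        if "y \<in> ball x R" for n y
      proof -
        have "y \<in> S" using that R(2) r(2)[of "is"] subset_ball[OF R(2), of x] by blast
        then show ?thesis by (rule has_derivative_at_withinI[OF smooth_on_has_derivative[OF assms(1,2)]])
      qed
      show "\<forall>\<^sub>F n in sequentially. \<forall>y\<in>ball x R. \<forall>h.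
        norm (gradient_map (\<lambda>i. iter_partial (i # is) (f n) y) h - gradient_map (\<lambda>i. P (i # is) y) h) \<le> e * norm h"
        if "e > 0" for e
      proof -
        let ?d = "e / real CARD('n)"
        have "?d > 0" using that by simp
        have "\<forall>\<^sub>F n in sequentially. \<forall>y\<in>ball x R. dist (iter_partial (i # is) (f n) y) (P (i # is) y) < ?d" for i
          using uniform_limitD[OF ul[of "i # is"] \<open>?d > 0\<close>] by auto
        from eventually_all_finite[OF this]
        have "\<forall>\<^sub>F n in sequentially. \<forall>i. \<forall>y\<in>ball x R. dist (iter_partial (i # is) (f n) y) (P (i # is) y) < ?d" .
        then show ?thesis
        proof eventually_elim
          case (elim n)
          show ?case
          proof (intro ballI allI)
            fix y h assume y: "y \<in> ball x R"
            have "gradient_map (\<lambda>i. iter_partial (i # is) (f n) y) h - gradient_map (\<lambda>i. P (i # is) y) h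
              = gradient_map (\<lambda>i. iter_partial (i # is) (f n) y - P (i # is) y) h"
              by (simp add: gradient_map_def sum_subtractf scaleR_diff_right)
            also have "cmod \<dots> \<le> real CARD('n) * ?d * norm h"
              by (rule norm_gradient_map_le) (use elim y in \<open>auto simp: dist_norm intro: less_imp_le\<close>)
            finally show "norm (gradient_map (\<lambda>i. iter_partial (i # is) (f n) y) h - gradient_map (\<lambda>i. P (i # is) y) h) \<le> e * norm h"
              by simp
          qed
        qed
      qed
      show "(\<lambda>n. iter_partial is (f n) x) \<longlonglongrightarrow> P is x"
        using tendsto_uniform_limitI[OF ul[of "is"], of x] R(1) by auto
    qed
    then obtain G where "\<forall>y\<in>ball x R. (\<lambda>n. iter_partial is (f n) y) \<longlonglongrightarrow> G y \<and>
       (G has_derivative gradient_map (\<lambda>i. P (i # is) y)) (at y within ball x R)" by (rule exE)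
    note G = bspec[OF this, THEN conjunct1] bspec[OF this, THEN conjunct2]
    have "(G has_derivative gradient_map (\<lambda>i. P (i # is) x)) (at x)"
      using G(2)[of x] R(1) at_within_open[of x "ball x R"] by simp
    moreover have "G y = P is y" if "y \<in> ball x R" for y
      using LIMSEQ_unique[OF G(1)[OF that] tendsto_uniform_limitI[OF ul[of "is"], of y]] that by auto
    ultimately show ?thesis
      using has_derivative_transform_within_open[of G _ x UNIV "ball x R" "P is"] R(1) by auto
  qed
  show "smooth_on S g" by (rule smooth_on_family[of S P]) (use * assms(1) g in auto)
  show "iter_partial is g x = P is x" if "x \<in> S"
    by (rule iter_partial_family[of S P]) (use * assms(1) g that in auto)
qed

section \<open>Plane waves\<close>

definition wave :: "real ^ 'n::finite \<Rightarrow> real ^ 'n \<Rightarrow> complex" where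
  "wave \<xi> x = cis (\<xi> \<bullet> x)"

lemma norm_wave [simp]: "cmod (wave \<xi> x) = 1" by (simp add: wave_def)

lemma continuous_on_wave [continuous_intros]: "continuous_on S (wave \<xi>)"
  unfolding wave_def cis_conv_exp by (intro continuous_intros)

lemma
  shows smooth_on_wave: "smooth_on S (wave \<xi>)"
    and iter_partial_wave: "iter_partial is (wave \<xi>) x = (\<Prod>k\<leftarrow>is. \<i> * \<xi> $ k) * wave \<xi> x"
proof -
  let ?F = "\<lambda>is x. (\<Prod>k\<leftarrow>is. \<i> * \<xi> $ k) * wave \<xi> x"
  have w: "(wave \<xi> has_derivative gradient_map (\<lambda>i. \<i> * \<xi> $ i * wave \<xi> x)) (at x)" for x
  proof -
    have "bounded_linear (\<lambda>h. \<i> * of_real (\<xi> \<bullet> h))"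
      by (intro bounded_linear_const_mult bounded_linear_compose[OF bounded_linear_of_real] bounded_linear_inner_right)
    from has_derivative_compose[OF bounded_linear_imp_has_derivative[OF this]
        DERIV_exp[THEN has_field_derivative_imp_has_derivative]]
    have "((\<lambda>x. exp (\<i> * of_real (\<xi> \<bullet> x))) has_derivative (\<lambda>h. exp (\<i> * of_real (\<xi> \<bullet> x)) * (\<i> * of_real (\<xi> \<bullet> h)))) (at x)" .
    moreover have "exp (\<i> * of_real (\<xi> \<bullet> x)) * (\<i> * of_real (\<xi> \<bullet> h)) = gradient_map (\<lambda>i. \<i> * \<xi> $ i * exp (\<i> * of_real (\<xi> \<bullet> x))) h" for h
      by (simp add: gradient_map_def inner_vec_def wave_def cis_conv_exp sum_distrib_left sum_distrib_right
          scaleR_conv_of_real mult_ac)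
    ultimately show ?thesis unfolding wave_def[abs_def] cis_conv_exp by (simp only:)
  qed
  have *: "(?F is has_derivative gradient_map (\<lambda>i. ?F (i # is) x)) (at x)" for "is" x
    using has_derivative_mult_right[OF w[of x], of "\<Prod>k\<leftarrow>is. \<i> * \<xi> $ k"]
    by (simp add: gradient_map_simps mult_ac)
  have "smooth_on UNIV (wave \<xi>)" by (rule smooth_on_family[of UNIV ?F]) (use * in auto)
  then show "smooth_on S (wave \<xi>)" by (rule smooth_on_subset) simp
  show "iter_partial is (wave \<xi>) x = ?F is x"
    by (rule iter_partial_family[of UNIV ?F]) (use * in auto)
qed

section \<open>Ultradifferentiable functions\<close>

text \<open>Segments stay in \<open>K\<close>, and their length is the distance of their ends, so
  the constant 1 works. This admits closed balls as supports of cutoff functions.\<close>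

lemma regular_compact_convex:
  fixes K :: "'a::real_normed_vector set"
  assumes "compact K" "convex K"
  shows "regular_compact K"
  unfolding regular_compact_def
proof (intro conjI exI[of _ "1::real"] allI impI)
  have "components K \<subseteq> {K}"
    using assms(2) convex_connected components_eq_sing_iff by (cases "K = {}") auto
  then show "finite (components K)" by (rule finite_subset) simp
  fix x y assume "connected_component K x y"
  then have xy: "x \<in> K" "y \<in> K" using connected_component_in by metis+
  have len: "curve_length (linepath x y) \<le> ennreal (1 * dist x y)"
    unfolding curve_length_def
  proof (rule SUP_least, clarify)
    fix ts :: "real list" assume ts: "sorted ts" "set ts \<subseteq> {0..1}"
    have "dist (linepath x y s) (linepath x y t) = \<bar>s - t\<bar> * dist x y" for s t
    proof -
      have "linepath x y s - linepath x y t = (s - t) *\<^sub>R (y - x)" by (simp add: linepath_def algebra_simps)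
      then show ?thesis by (simp add: dist_norm norm_minus_commute)
    qed
    then have d: "dist (linepath x y (ts ! i)) (linepath x y (ts ! Suc i)) = (ts ! Suc i - ts ! i) * dist x y"
      if "i < length ts - 1" for i
      using sorted_nth_mono[OF ts(1), of i "Suc i"] that by simp
    have "(\<Sum>i<length ts - 1. ennreal (dist (linepath x y (ts ! i)) (linepath x y (ts ! Suc i))))
      = ennreal (\<Sum>i<length ts - 1. (ts ! Suc i - ts ! i) * dist x y)"
    proof (subst sum_ennreal[symmetric])
      show "0 \<le> (ts ! Suc i - ts ! i) * dist x y" if "i \<in> {..<length ts - 1}" for i
        using sorted_nth_mono[OF ts(1), of i "Suc i"] that by simp
    qed (use d in simp)
    \<comment> \<open>The increments of a sorted list telescope. For the empty list both indices on
      the right are 0 by truncated subtraction, so that the value is 0 there too.\<close>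
    also have "(\<Sum>i<length ts - 1. (ts ! Suc i - ts ! i) * dist x y) = (ts ! (length ts - 1) - ts ! 0) * dist x y"
      by (simp add: sum_distrib_right[symmetric] sum_lessThan_telescope)
    also have "\<dots> \<le> 1 * dist x y"
    proof (cases "ts = []")
      case False
      then have "ts ! (length ts - 1) \<le> 1" "ts ! 0 \<ge> 0" using ts(2) nth_mem[of _ ts] by (auto simp: subset_iff)
      then show ?thesis by (intro mult_right_mono) auto
    qed simp
    finally show "(\<Sum>i<length ts - 1. ennreal (dist (linepath x y (ts ! i)) (linepath x y (ts ! Suc i)))) \<le> ennreal (1 * dist x y)"
      by (simp add: ennreal_leI)
  qed
  have "path_image (linepath x y) \<subseteq> K" using assms(2) xy by (simp add: closed_segment_subset)
  then show "\<exists>\<gamma>. path \<gamma> \<and> path_image \<gamma> \<subseteq> K \<and> pathstart \<gamma> = x \<and> pathfinish \<gamma> = y \<and>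
             curve_length \<gamma> \<le> ennreal (1 * dist x y)"
    using len by (intro exI[of _ "linepath x y"]) auto
qed (use assms in auto)

lemma compact_regular_compacts: "K \<in> regular_compacts \<Omega> \<Longrightarrow> compact K \<and> K \<subseteq> \<Omega>"
  by (simp add: regular_compacts_def regular_compact_def)

lemma norm_sum_list_le: "norm (\<Sum>z\<leftarrow>zs. f z) \<le> (\<Sum>z\<leftarrow>zs. norm (f z))"
  for f :: "'a \<Rightarrow> 'b::real_normed_vector"
  by (induction zs) (auto intro: norm_triangle_mono)

context weight begin

lemma ultra_norm_le_iff:
  assumes "h > 0"
  shows "ultra_norm M K h \<phi> \<le> ennreal C \<longleftrightarrow> (\<forall>x\<in>K. \<forall>\<alpha>. ennreal (cmod (multi_deriv \<alpha> \<phi> x) / (h ^ (\<Sum>i\<in>UNIV. \<alpha> i) * M (\<Sum>i\<in>UNIV. \<alpha> i))) \<le> ennreal C)"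
  by (simp add: ultra_norm_def SUP_le_iff Let_def)

lemma ultra_norm_leI:
  assumes "h > 0" "\<And>x \<alpha>. x \<in> K \<Longrightarrow> cmod (multi_deriv \<alpha> \<phi> x) \<le> C * h ^ (\<Sum>i\<in>UNIV. \<alpha> i) * M (\<Sum>i\<in>UNIV. \<alpha> i)"
  shows "ultra_norm M K h \<phi> \<le> ennreal C"
  unfolding ultra_norm_le_iff[OF assms(1)]
proof (intro ballI allI ennreal_leI)
  fix x \<alpha> assume "x \<in> K"
  then show "cmod (multi_deriv \<alpha> \<phi> x) / (h ^ (\<Sum>i\<in>UNIV. \<alpha> i) * M (\<Sum>i\<in>UNIV. \<alpha> i)) \<le> C"
    using assms(2)[of x \<alpha>] assms(1) M_pos[of "\<Sum>i\<in>UNIV. \<alpha> i"] by (simp add: field_simps)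
qed

lemma ultra_norm_leD:
  assumes "h > 0" "C \<ge> 0" "ultra_norm M K h \<phi> \<le> ennreal C" "x \<in> K"
  shows "cmod (multi_deriv \<alpha> \<phi> x) \<le> C * h ^ (\<Sum>i\<in>UNIV. \<alpha> i) * M (\<Sum>i\<in>UNIV. \<alpha> i)"
proof -
  have "ennreal (cmod (multi_deriv \<alpha> \<phi> x) / (h ^ (\<Sum>i\<in>UNIV. \<alpha> i) * M (\<Sum>i\<in>UNIV. \<alpha> i))) \<le> ennreal C"
    using assms ultra_norm_le_iff by blast
  then have "cmod (multi_deriv \<alpha> \<phi> x) / (h ^ (\<Sum>i\<in>UNIV. \<alpha> i) * M (\<Sum>i\<in>UNIV. \<alpha> i)) \<le> C"
    using assms(2) by (simp add: ennreal_le_iff)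
  then show ?thesis
    using assms(1) M_pos[of "\<Sum>i\<in>UNIV. \<alpha> i"] by (simp add: field_simps)
qed

lemma ultra_norm_finiteD:
  assumes "h > 0" "ultra_norm M K h \<phi> < \<infinity>"
  shows "\<exists>C\<ge>0. \<forall>x\<in>K. \<forall>\<alpha>. cmod (multi_deriv \<alpha> \<phi> x) \<le> C * h ^ (\<Sum>i\<in>UNIV. \<alpha> i) * M (\<Sum>i\<in>UNIV. \<alpha> i)"
proof -
  obtain C where "C \<ge> 0" "ultra_norm M K h \<phi> = ennreal C"
    using assms(2) by (cases "ultra_norm M K h \<phi>") auto
  then show ?thesis using ultra_norm_leD[OF assms(1) \<open>C \<ge> 0\<close>, of K \<phi>] by (intro exI[of _ C]) simp
qed

text \<open>Leibniz' rule, supermultiplicativity of \<open>M\<close> and the binomial theorem. In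
  the Beurling case every scale is available, so a product is estimated at \<open>h\<close> by
  giving \<open>h / 2\<close> to each factor.\<close>

lemma multi_deriv_mult_bound:
  assumes "open S" "smooth_on S f" "smooth_on S g" "x \<in> S" "A \<ge> 0" "B \<ge> 0" "s \<ge> 0" "t \<ge> 0"
    and f: "\<And>\<alpha>. cmod (multi_deriv \<alpha> f x) \<le> A * s ^ (\<Sum>i\<in>UNIV. \<alpha> i) * M (\<Sum>i\<in>UNIV. \<alpha> i)"
    and g: "\<And>\<alpha>. cmod (multi_deriv \<alpha> g x) \<le> B * t ^ (\<Sum>i\<in>UNIV. \<alpha> i) * M (\<Sum>i\<in>UNIV. \<alpha> i)"
  shows "cmod (multi_deriv \<alpha> (\<lambda>x. f x * g x) x) \<le> A * B * (s + t) ^ (\<Sum>i\<in>UNIV. \<alpha> i) * M (\<Sum>i\<in>UNIV. \<alpha> i)"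
proof -
  define p where "p = (\<Sum>i\<in>UNIV. \<alpha> i)"
  have tm: "cmod (iter_partial a f x * iter_partial b g x) \<le> A * B * M p * (s ^ length a * t ^ length b)"
    if ab: "(a, b) \<in> set (splits (midx \<alpha>))" for a b
  proof -
    obtain \<beta> \<gamma> where bg: "a = midx \<beta>" "b = midx \<gamma>" using splits_midx[OF ab] by blast
    have "length a + length b = p" using length_splits[OF ab] by (simp add: length_midx p_def)
    then have MM: "M (length a) * M (length b) \<le> M p" using M_mult_le by metis
    have "cmod (iter_partial a f x) \<le> A * s ^ length a * M (length a)"
      using f[of \<beta>] by (simp add: multi_deriv_midx bg length_midx)
    moreover have "cmod (iter_partial b g x) \<le> B * t ^ length b * M (length b)"
      using g[of \<gamma>] by (simp add: multi_deriv_midx bg length_midx)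
    ultimately have "cmod (iter_partial a f x * iter_partial b g x) \<le> (A * s ^ length a * M (length a)) * (B * t ^ length b * M (length b))"
      unfolding norm_mult using assms M_pos by (intro mult_mono) (auto simp: less_imp_le)
    also have "\<dots> = A * B * (s ^ length a * t ^ length b) * (M (length a) * M (length b))" by (simp add: mult_ac)
    also have "\<dots> \<le> A * B * (s ^ length a * t ^ length b) * M p"
      by (intro mult_left_mono MM mult_nonneg_nonneg zero_le_power assms)
    finally show ?thesis by (simp add: mult_ac)
  qed
  have "cmod (multi_deriv \<alpha> (\<lambda>x. f x * g x) x) = cmod (\<Sum>(a, b)\<leftarrow>splits (midx \<alpha>). iter_partial a f x * iter_partial b g x)"
    by (simp add: multi_deriv_midx iter_partial_mult[OF assms(1-4)])
  also have "\<dots> \<le> (\<Sum>z\<leftarrow>splits (midx \<alpha>). cmod (case z of (a, b) \<Rightarrow> iter_partial a f x * iter_partial b g x))"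
    by (rule norm_sum_list_le)
  also have "\<dots> \<le> (\<Sum>z\<leftarrow>splits (midx \<alpha>). case z of (a, b) \<Rightarrow> A * B * M p * (s ^ length a * t ^ length b))"
    by (rule sum_list_mono) (use tm in auto)
  also have "\<dots> = A * B * M p * (\<Sum>(a, b)\<leftarrow>splits (midx \<alpha>). s ^ length a * t ^ length b)"
    by (simp add: sum_list_const_mult case_prod_unfold)
  also have "\<dots> = A * B * M p * (s + t) ^ p"
    by (simp only: sum_list_splits_power length_midx p_def)
  finally show ?thesis by (simp add: p_def mult_ac)
qed

text \<open>The Beurling estimates on the whole space. Test functions extended by zero and series of
  plane waves both satisfy them, so these can be multiplied, scaled and averaged without regard to
  supports.\<close>

definition ultra_bounded :: "(real ^ 'n::finite \<Rightarrow> complex) \<Rightarrow> bool" where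
  "ultra_bounded f \<longleftrightarrow> smooth_on UNIV f \<and>
     (\<forall>h>0. \<exists>C\<ge>0. \<forall>x \<alpha>. cmod (multi_deriv \<alpha> f x) \<le> C * h ^ (\<Sum>i\<in>UNIV. \<alpha> i) * M (\<Sum>i\<in>UNIV. \<alpha> i))"

lemma ultra_bounded_ultra_diff: "ultra_bounded f \<Longrightarrow> f \<in> ultra_diff M \<Omega>"
proof -
  assume f: "ultra_bounded f"
  have "ultra_norm M K h f < \<infinity>" if h: "h > 0" for K h
  proof -
    obtain C where "\<And>x \<alpha>. cmod (multi_deriv \<alpha> f x) \<le> C * h ^ (\<Sum>i\<in>UNIV. \<alpha> i) * M (\<Sum>i\<in>UNIV. \<alpha> i)"
      using f h unfolding ultra_bounded_def by blast
    then have "ultra_norm M K h f \<le> ennreal C" by (intro ultra_norm_leI h)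
    also have "\<dots> < \<infinity>" by simp
    finally show ?thesis .
  qed
  moreover have "smooth_on \<Omega> f" using f smooth_on_subset unfolding ultra_bounded_def by blast
  ultimately show ?thesis by (simp add: ultra_diff_def)
qed

lemma test_functions_ultra_bounded:
  assumes "open \<Omega>" "K \<in> regular_compacts \<Omega>" "\<phi> \<in> test_functions_on M \<Omega> K"
  shows "ultra_bounded \<phi>"
  unfolding ultra_bounded_def
proof (intro conjI allI impI)
  have K: "compact K" "K \<subseteq> \<Omega>" using compact_regular_compacts assms(2) by blast+
  have \<phi>: "smooth_on \<Omega> \<phi>" "\<And>x. x \<notin> K \<Longrightarrow> \<phi> x = 0" "\<And>h. h > 0 \<Longrightarrow> ultra_norm M K h \<phi> < \<infinity>"
    using assms(2,3) by (auto simp: test_functions_on_def ultra_diff_def)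
  note ext = assms(1) \<phi>(1) compact_imp_closed[OF K(1)] K(2) \<phi>(2)
  show "smooth_on UNIV \<phi>" by (rule smooth_on_extend[OF ext])
  fix h :: real assume "h > 0"
  obtain C where C: "C \<ge> 0" "\<forall>x\<in>K. \<forall>\<alpha>. cmod (multi_deriv \<alpha> \<phi> x) \<le> C * h ^ (\<Sum>i\<in>UNIV. \<alpha> i) * M (\<Sum>i\<in>UNIV. \<alpha> i)"
    using ultra_norm_finiteD[OF \<open>h > 0\<close> \<phi>(3)[OF \<open>h > 0\<close>]] by blast
  have "cmod (multi_deriv \<alpha> \<phi> x) \<le> C * h ^ (\<Sum>i\<in>UNIV. \<alpha> i) * M (\<Sum>i\<in>UNIV. \<alpha> i)" for x \<alpha>
  proof (cases "x \<in> K")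
    case False
    then have "multi_deriv \<alpha> \<phi> x = 0" unfolding multi_deriv_midx by (intro iter_partial_outside[OF ext])
    then show ?thesis using C(1) \<open>h > 0\<close> M_pos[of "\<Sum>i\<in>UNIV. \<alpha> i"] by simp
  qed (use C in blast)
  then show "\<exists>C\<ge>0. \<forall>x \<alpha>. cmod (multi_deriv \<alpha> \<phi> x) \<le> C * h ^ (\<Sum>i\<in>UNIV. \<alpha> i) * M (\<Sum>i\<in>UNIV. \<alpha> i)"
    using C(1) by blast
qed

lemma ultra_bounded_mult:
  assumes "ultra_bounded f" "ultra_bounded g"
  shows "ultra_bounded (\<lambda>x. f x * g x)"
  unfolding ultra_bounded_def
proof (intro conjI allI impI)
  have sm: "smooth_on UNIV f" "smooth_on UNIV g" using assms by (auto simp: ultra_bounded_def)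
  then show "smooth_on UNIV (\<lambda>x. f x * g x)" by (rule smooth_on_mult[OF open_UNIV])
  fix h :: real assume "h > 0"
  then have "h / 2 > 0" by simp
  obtain A where A: "A \<ge> 0" "\<And>x \<alpha>. cmod (multi_deriv \<alpha> f x) \<le> A * (h / 2) ^ (\<Sum>i\<in>UNIV. \<alpha> i) * M (\<Sum>i\<in>UNIV. \<alpha> i)"
    using assms(1) \<open>h / 2 > 0\<close> unfolding ultra_bounded_def by blast
  obtain B where B: "B \<ge> 0" "\<And>x \<alpha>. cmod (multi_deriv \<alpha> g x) \<le> B * (h / 2) ^ (\<Sum>i\<in>UNIV. \<alpha> i) * M (\<Sum>i\<in>UNIV. \<alpha> i)"
    using assms(2) \<open>h / 2 > 0\<close> unfolding ultra_bounded_def by blast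
  have "cmod (multi_deriv \<alpha> (\<lambda>x. f x * g x) x) \<le> A * B * h ^ (\<Sum>i\<in>UNIV. \<alpha> i) * M (\<Sum>i\<in>UNIV. \<alpha> i)" for x \<alpha>
    using multi_deriv_mult_bound[OF open_UNIV sm UNIV_I A(1) B(1) _ _ A(2) B(2), of \<alpha>] \<open>h > 0\<close> by simp
  then show "\<exists>C\<ge>0. \<forall>x \<alpha>. cmod (multi_deriv \<alpha> (\<lambda>x. f x * g x) x) \<le> C * h ^ (\<Sum>i\<in>UNIV. \<alpha> i) * M (\<Sum>i\<in>UNIV. \<alpha> i)"
    using A(1) B(1) by (intro exI[of _ "A * B"]) auto
qed

lemma ultra_bounded_cnj: "ultra_bounded f \<Longrightarrow> ultra_bounded (\<lambda>x. cnj (f x))"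
  by (simp add: ultra_bounded_def smooth_on_cnj multi_deriv_midx iter_partial_cnj)

lemma ultra_bounded_cmult:
  assumes "ultra_bounded f"
  shows "ultra_bounded (\<lambda>x. c * f x)"
proof -
  have sm: "smooth_on UNIV f" using assms by (simp add: ultra_bounded_def)
  have d: "multi_deriv \<alpha> (\<lambda>x. c * f x) x = c * multi_deriv \<alpha> f x" for \<alpha> x
    using iter_partial_linear[OF open_UNIV sm sm UNIV_I, of "midx \<alpha>" c 0 x] by (simp add: multi_deriv_midx)
  show ?thesis
    unfolding ultra_bounded_def
  proof (intro conjI allI impI)
    show "smooth_on UNIV (\<lambda>x. c * f x)" using smooth_on_linear[OF open_UNIV sm sm, of c 0] by simp
    fix h :: real assume "h > 0"
    then obtain C where C: "C \<ge> 0" "\<And>x \<alpha>. cmod (multi_deriv \<alpha> f x) \<le> C * h ^ (\<Sum>i\<in>UNIV. \<alpha> i) * M (\<Sum>i\<in>UNIV. \<alpha> i)"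
      using assms unfolding ultra_bounded_def by blast
    have "cmod (multi_deriv \<alpha> (\<lambda>x. c * f x) x) \<le> (cmod c * C) * h ^ (\<Sum>i\<in>UNIV. \<alpha> i) * M (\<Sum>i\<in>UNIV. \<alpha> i)" for x \<alpha>
    proof -
      have "cmod c * cmod (multi_deriv \<alpha> f x) \<le> cmod c * (C * h ^ (\<Sum>i\<in>UNIV. \<alpha> i) * M (\<Sum>i\<in>UNIV. \<alpha> i))"
        by (intro mult_left_mono C(2) norm_ge_zero)
      then show ?thesis by (simp add: d norm_mult mult_ac)
    qed
    then show "\<exists>C\<ge>0. \<forall>x \<alpha>. cmod (multi_deriv \<alpha> (\<lambda>x. c * f x) x) \<le> C * h ^ (\<Sum>i\<in>UNIV. \<alpha> i) * M (\<Sum>i\<in>UNIV. \<alpha> i)"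
      using C(1) by (intro exI[of _ "cmod c * C"]) auto
  qed
qed

lemma ultra_bounded_affine:
  assumes "ultra_bounded f" "t > 0"
  shows "ultra_bounded (\<lambda>x. f (a + t *\<^sub>R x))"
  unfolding ultra_bounded_def
proof (intro conjI allI impI)
  have sm: "smooth_on UNIV f" using assms by (simp add: ultra_bounded_def)
  then show "smooth_on UNIV (\<lambda>x. f (a + t *\<^sub>R x))" by (rule smooth_on_affine)
  fix h :: real assume "h > 0"
  then have "h / t > 0" using assms(2) by simp
  then obtain C where C: "C \<ge> 0" "\<And>x \<alpha>. cmod (multi_deriv \<alpha> f x) \<le> C * (h / t) ^ (\<Sum>i\<in>UNIV. \<alpha> i) * M (\<Sum>i\<in>UNIV. \<alpha> i)"
    using assms(1) unfolding ultra_bounded_def by blast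
  have "cmod (multi_deriv \<alpha> (\<lambda>x. f (a + t *\<^sub>R x)) x) \<le> C * h ^ (\<Sum>i\<in>UNIV. \<alpha> i) * M (\<Sum>i\<in>UNIV. \<alpha> i)" for x \<alpha>
  proof -
    have "cmod (multi_deriv \<alpha> (\<lambda>x. f (a + t *\<^sub>R x)) x) = t ^ (\<Sum>i\<in>UNIV. \<alpha> i) * cmod (multi_deriv \<alpha> f (a + t *\<^sub>R x))"
      using assms(2) by (simp add: multi_deriv_midx iter_partial_affine[OF sm] length_midx norm_mult norm_power)
    also have "\<dots> \<le> t ^ (\<Sum>i\<in>UNIV. \<alpha> i) * (C * (h / t) ^ (\<Sum>i\<in>UNIV. \<alpha> i) * M (\<Sum>i\<in>UNIV. \<alpha> i))"
      by (rule mult_left_mono[OF C(2)]) (use assms(2) in simp)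
    also have "\<dots> = C * h ^ (\<Sum>i\<in>UNIV. \<alpha> i) * M (\<Sum>i\<in>UNIV. \<alpha> i)"
      using assms(2) by (simp add: power_divide)
    finally show ?thesis .
  qed
  then show "\<exists>C\<ge>0. \<forall>x \<alpha>. cmod (multi_deriv \<alpha> (\<lambda>x. f (a + t *\<^sub>R x)) x) \<le> C * h ^ (\<Sum>i\<in>UNIV. \<alpha> i) * M (\<Sum>i\<in>UNIV. \<alpha> i)"
    using C(1) by blast
qed

end

section \<open>Bump functions\<close>

text \<open>Differentiation under the integral sign. The differentials are wrapped as elements of
  the space of bounded linear maps because the Leibniz rule asks for continuous dependence there;
  the continuity is checked componentwise.\<close>

lemma has_derivative_integral_translate:
  fixes F :: "real ^ 'n::finite \<Rightarrow> complex"
  assumes F: "\<And>x. (F has_derivative gradient_map (\<lambda>i. d i x)) (at x)"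
    and d: "\<And>i. continuous_on UNIV (d i)"
  shows "((\<lambda>x. integral (cbox a b) (\<lambda>y. F (x - y))) has_derivative
    gradient_map (\<lambda>i. integral (cbox a b) (\<lambda>y. d i (x - y)))) (at x)"
proof -
  define D where "D x y = Blinfun (gradient_map (\<lambda>i. d i (x - y)))" for x y
  have bl: "bounded_linear (gradient_map (\<lambda>i. d i z))" for z using has_derivative_bounded_linear[OF F] .
  then have D: "blinfun_apply (D x y) = gradient_map (\<lambda>i. d i (x - y))" for x y
    by (simp add: D_def bounded_linear_Blinfun_apply)
  have cF: "continuous_on UNIV F"
    using F has_derivative_continuous continuous_at_imp_continuous_on by blast
  have cont: "continuous_on (UNIV \<times> cbox a b) (\<lambda>(x, t). D x t)"
  proof (rule continuous_on_blinfun_componentwise)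
    fix k :: "real ^ 'n"
    have "continuous_on (UNIV \<times> cbox a b) (\<lambda>p. gradient_map (\<lambda>i. d i (fst p - snd p)) k)"
      unfolding gradient_map_def
      by (intro continuous_intros continuous_on_compose2[OF d]) auto
    then show "continuous_on (UNIV \<times> cbox a b) (\<lambda>p. blinfun_apply (case p of (x, t) \<Rightarrow> D x t) k)"
      by (simp add: case_prod_unfold D)
  qed
  have "((\<lambda>x. integral (cbox a b) (\<lambda>y. F (x - y))) has_derivative blinfun_apply (integral (cbox a b) (D x))) (at x within UNIV)"
  proof (rule leibniz_rule[OF _ _ cont])
    show "((\<lambda>x. F (x - t)) has_derivative blinfun_apply (D x t)) (at x within UNIV)" for x t
    proof -
      have "((\<lambda>x. x - t) has_derivative (\<lambda>h. h)) (at x)" by (auto intro!: derivative_eq_intros)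
      from has_derivative_compose[OF this F] show ?thesis by (simp add: D)
    qed
    show "(\<lambda>y. F (x - y)) integrable_on cbox a b" for x
      by (intro integrable_continuous continuous_on_compose2[OF cF] continuous_intros) auto
  qed auto
  moreover have "blinfun_apply (integral (cbox a b) (D x)) h = gradient_map (\<lambda>i. integral (cbox a b) (\<lambda>y. d i (x - y))) h" for h
  proof -
    have "continuous_on (cbox a b) (\<lambda>t. case (x, t) of (x, t) \<Rightarrow> D x t)"
      by (rule continuous_on_compose2[OF cont]) (auto intro!: continuous_intros)
    then have "continuous_on (cbox a b) (D x)" by simp
    then have "D x integrable_on cbox a b" by (rule integrable_continuous)
    then have "blinfun_apply (integral (cbox a b) (D x)) h = integral (cbox a b) (\<lambda>y. blinfun_apply (D x y) h)"
      by (rule blinfun_apply_integral)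
    also have "\<dots> = (\<Sum>i\<in>UNIV. integral (cbox a b) (\<lambda>y. h $ i *\<^sub>R d i (x - y)))"
      unfolding D gradient_map_def
      by (rule integral_sum) (auto intro!: integrable_continuous continuous_intros continuous_on_compose2[OF d])
    finally show ?thesis by (simp add: gradient_map_def)
  qed
  then have "blinfun_apply (integral (cbox a b) (D x)) = gradient_map (\<lambda>i. integral (cbox a b) (\<lambda>y. d i (x - y)))" by (rule ext)
  ultimately show ?thesis by simp
qed

text \<open>Convolution with the indicator function of a box: all derivatives fall on
  \<open>f\<close>, so the average inherits the bounds of \<open>f\<close> up to the volume of the
  box.\<close>

lemma
  fixes f :: "real ^ 'n::finite \<Rightarrow> complex"
  assumes "smooth_on UNIV f"
  shows smooth_on_box_average: "smooth_on UNIV (\<lambda>x. integral (cbox a b) (\<lambda>y. f (x - y)))"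
    and iter_partial_box_average: "iter_partial is (\<lambda>x. integral (cbox a b) (\<lambda>y. f (x - y))) x
      = integral (cbox a b) (\<lambda>y. iter_partial is f (x - y))"
proof -
  let ?F = "\<lambda>is x. integral (cbox a b) (\<lambda>y. iter_partial is f (x - y))"
  have *: "(?F is has_derivative gradient_map (\<lambda>i. ?F (i # is) x)) (at x)" for "is" x
    by (rule has_derivative_integral_translate[where F="iter_partial is f" and d="\<lambda>i. iter_partial (i # is) f"])
      (rule smooth_on_has_derivative[OF open_UNIV assms UNIV_I], rule smooth_on_continuous[OF assms])
  show "smooth_on UNIV (\<lambda>x. integral (cbox a b) (\<lambda>y. f (x - y)))"
    by (rule smooth_on_family[of UNIV ?F]) (use * in auto)
  show "iter_partial is (\<lambda>x. integral (cbox a b) (\<lambda>y. f (x - y))) x = ?F is x"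
    by (rule iter_partial_family[of UNIV ?F]) (use * in auto)
qed

lemma (in weight) ultra_bounded_box_average:
  assumes "ultra_bounded f"
  shows "ultra_bounded (\<lambda>x. integral (cbox a b) (\<lambda>y. f (x - y)))"
  unfolding ultra_bounded_def
proof (intro conjI allI impI)
  have sm: "smooth_on UNIV f" using assms by (simp add: ultra_bounded_def)
  then show "smooth_on UNIV (\<lambda>x. integral (cbox a b) (\<lambda>y. f (x - y)))" by (rule smooth_on_box_average)
  fix h :: real assume "h > 0"
  then obtain C where C: "C \<ge> 0" "\<And>x \<alpha>. cmod (multi_deriv \<alpha> f x) \<le> C * h ^ (\<Sum>i\<in>UNIV. \<alpha> i) * M (\<Sum>i\<in>UNIV. \<alpha> i)"
    using assms unfolding ultra_bounded_def by blast
  have "cmod (multi_deriv \<alpha> (\<lambda>x. integral (cbox a b) (\<lambda>y. f (x - y))) x)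
    \<le> (C * measure lborel (cbox a b)) * h ^ (\<Sum>i\<in>UNIV. \<alpha> i) * M (\<Sum>i\<in>UNIV. \<alpha> i)" for x \<alpha>
  proof -
    let ?C = "C * h ^ (\<Sum>i\<in>UNIV. \<alpha> i) * M (\<Sum>i\<in>UNIV. \<alpha> i)"
    have "?C \<ge> 0" using C(1) \<open>h > 0\<close> M_pos[of "\<Sum>i\<in>UNIV. \<alpha> i"] by simp
    moreover have "(\<lambda>y. multi_deriv \<alpha> f (x - y)) integrable_on cbox a b"
      unfolding multi_deriv_midx
      by (intro integrable_continuous continuous_on_compose2[OF smooth_on_continuous[OF sm]] continuous_intros) auto
    ultimately have "norm (integral (cbox a b) (\<lambda>y. multi_deriv \<alpha> f (x - y))) \<le> ?C * measure lborel (cbox a b)"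
      using integrable_bound[of ?C "\<lambda>y. multi_deriv \<alpha> f (x - y)" a b] C(2) by blast
    then show ?thesis by (simp add: multi_deriv_midx iter_partial_box_average[OF sm] mult_ac)
  qed
  then show "\<exists>D\<ge>0. \<forall>x \<alpha>. cmod (multi_deriv \<alpha> (\<lambda>x. integral (cbox a b) (\<lambda>y. f (x - y))) x) \<le> D * h ^ (\<Sum>i\<in>UNIV. \<alpha> i) * M (\<Sum>i\<in>UNIV. \<alpha> i)"
    using C(1) by (intro exI[of _ "C * measure lborel (cbox a b)"]) auto
qed

section \<open>Fourier transforms\<close>

lemma Basis_cart: "(Basis :: (real ^ 'n::finite) set) = range (\<lambda>i. axis i 1)"
  by (auto simp: Basis_vec_def)

lemma inj_axis_1: "inj (\<lambda>i. axis i (1 :: real) :: real ^ 'n::finite)"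
  by (auto simp: inj_def axis_eq_axis)

text \<open>Fubini's theorem in coordinates. \<open>lborel\<close> is the image of a product measure
  indexed by basis vectors, so the factors are first reindexed from coordinates to the vectors
  \<open>axis i 1\<close>.\<close>

lemma
  fixes f :: "'n::finite \<Rightarrow> real \<Rightarrow> 'b::{real_normed_field,banach,second_countable_topology}"
  assumes f: "\<And>i. integrable lborel (f i)"
  shows lborel_integrable_prod_cart: "integrable lborel (\<lambda>x :: real ^ 'n. \<Prod>i\<in>UNIV. f i (x $ i))"
    and lborel_integral_prod_cart:
      "integral\<^sup>L lborel (\<lambda>x :: real ^ 'n. \<Prod>i\<in>UNIV. f i (x $ i)) = (\<Prod>i\<in>UNIV. \<integral>t. f i t \<partial>lborel)"
proof -
  interpret product_sigma_finite "\<lambda>_ :: real ^ 'n. lborel :: real measure" by standard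
  define g where "g b = f (inv (\<lambda>i. axis i 1) b)" for b :: "real ^ 'n"
  have reindex: "(\<Prod>i\<in>UNIV. h (axis i 1 :: real ^ 'n)) = (\<Prod>b\<in>Basis. h b)" for h :: "_ \<Rightarrow> 'b"
    unfolding Basis_cart using prod.reindex[OF inj_axis_1, of h] by (simp add: o_def)
  have g: "g (axis i 1) = f i" for i by (simp add: g_def inv_f_f[OF inj_axis_1])
  have [measurable]: "g b \<in> borel_measurable borel" for b
    using f[THEN borel_measurable_integrable] by (simp add: g_def)
  have eq: "(\<lambda>x :: real ^ 'n. \<Prod>i\<in>UNIV. f i (x $ i)) = (\<lambda>x. \<Prod>b\<in>Basis. g b (x \<bullet> b))"
    by (subst reindex[symmetric]) (simp add: g inner_axis)
  let ?T = "\<lambda>x :: real ^ 'n \<Rightarrow> real. \<Sum>b\<in>Basis. x b *\<^sub>R b"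
  have T: "?T \<in> measurable (\<Pi>\<^sub>M b\<in>Basis. lborel) borel" by simp
  have m: "(\<lambda>x :: real ^ 'n. \<Prod>b\<in>Basis. g b (x \<bullet> b)) \<in> borel_measurable borel" by simp
  have comp: "(\<Prod>b\<in>Basis. g b (?T x \<bullet> b)) = (\<Prod>b\<in>Basis. g b (x b))" for x
    by (rule prod.cong) simp_all
  have gi: "integrable lborel (g b)" for b using f by (simp add: g_def)
  show "integrable lborel (\<lambda>x :: real ^ 'n. \<Prod>i\<in>UNIV. f i (x $ i))"
    unfolding eq by (subst lborel_eq, subst integrable_distr_eq[OF T m])
      (simp only: comp, intro product_integrable_prod gi finite_Basis)
  have "integral\<^sup>L lborel (\<lambda>x :: real ^ 'n. \<Prod>b\<in>Basis. g b (x \<bullet> b)) = (\<Prod>b\<in>Basis. \<integral>t. g b t \<partial>lborel)"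
    by (subst lborel_eq, subst integral_distr[OF T m])
      (simp only: comp, intro product_integral_prod gi finite_Basis)
  then show "integral\<^sup>L lborel (\<lambda>x :: real ^ 'n. \<Prod>i\<in>UNIV. f i (x $ i)) = (\<Prod>i\<in>UNIV. \<integral>t. f i t \<partial>lborel)"
    unfolding eq by (subst (asm) reindex[symmetric]) (simp add: g)
qed

lemma lborel_integral_affine:
  fixes f :: "'a::euclidean_space \<Rightarrow> 'b::{banach, second_countable_topology}"
  assumes [measurable]: "f \<in> borel_measurable borel" and "c \<noteq> 0"
  shows "(\<integral>x. f x \<partial>lborel) = \<bar>c\<bar> ^ DIM('a) *\<^sub>R (\<integral>x. f (t + c *\<^sub>R x) \<partial>lborel)"
proof -
  have "(\<integral>x. f x \<partial>lborel) = (\<integral>x. f x \<partial>density (distr lborel borel (\<lambda>x. t + c *\<^sub>R x)) (\<lambda>_. ennreal (\<bar>c\<bar> ^ DIM('a))))"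
    using lborel_affine[OF assms(2), of t] by simp
  also have "\<dots> = (\<integral>x. \<bar>c\<bar> ^ DIM('a) *\<^sub>R f x \<partial>distr lborel borel (\<lambda>x. t + c *\<^sub>R x))"
    by (subst integral_density) auto
  also have "\<dots> = (\<integral>x. \<bar>c\<bar> ^ DIM('a) *\<^sub>R f (t + c *\<^sub>R x) \<partial>lborel)"
    by (subst integral_distr) auto
  finally show ?thesis by simp
qed

lemma integrable_compact_support:
  fixes v :: "'a::euclidean_space \<Rightarrow> 'b::{banach, second_countable_topology}"
  assumes "continuous_on UNIV v" "compact K" "\<And>x. x \<notin> K \<Longrightarrow> v x = 0"
  shows "integrable lborel v"
proof -
  have "integrable lborel (\<lambda>x. indicator K x *\<^sub>R v x)"
    by (rule borel_integrable_compact) (use assms(2) continuous_on_subset[OF assms(1)] in auto)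
  moreover have "(\<lambda>x. indicator K x *\<^sub>R v x) = v" using assms(3) by (auto simp: indicator_def fun_eq_iff)
  ultimately show ?thesis by simp
qed

lemma bounded_compact_support:
  fixes v :: "'a::euclidean_space \<Rightarrow> 'b::real_normed_vector"
  assumes "continuous_on UNIV v" "compact K" "\<And>x. x \<notin> K \<Longrightarrow> v x = 0"
  shows "\<exists>B>0. \<forall>x. norm (v x) \<le> B"
proof -
  have "bounded (v ` K)"
    using compact_imp_bounded[OF compact_continuous_image[OF continuous_on_subset[OF assms(1)] assms(2)]] by simp
  then obtain B where "B > 0" "\<And>x. x \<in> K \<Longrightarrow> norm (v x) \<le> B"
    by (auto simp: bounded_pos)
  then show ?thesis using assms(3) by (metis less_imp_le norm_zero)
qed

section \<open>Gaussian averages in place of Fourier inversion\<close>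

definition gauss :: "real ^ 'n::finite \<Rightarrow> real" where
  "gauss x = (\<Prod>i\<in>UNIV. std_normal_density (x $ i))"

lemma std_normal_density_le_1: "std_normal_density t \<le> 1"
proof -
  have "sqrt (2 * pi) \<ge> 1" using pi_gt3 by (auto intro!: real_le_rsqrt)
  then have "exp (- (t\<^sup>2 / 2)) \<le> sqrt (2 * pi)" by (smt (verit) exp_le_one_iff sum_power2_ge_zero zero_le_power2 divide_nonneg_pos)
  then show ?thesis using \<open>sqrt (2 * pi) \<ge> 1\<close> by (simp add: std_normal_density_def divide_le_eq)
qed

lemma gauss_bounds: "0 \<le> gauss x" "gauss x \<le> 1"
  by (auto simp: gauss_def intro!: prod_nonneg prod_le_1 std_normal_density_le_1)

lemma integral_std_normal_density: "integrable lborel std_normal_density" "(\<integral>t. std_normal_density t \<partial>lborel) = 1"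
  by (simp_all add: integrable_normal_density integral_normal_density)

lemma integrable_gauss: "integrable lborel (gauss :: real ^ 'n::finite \<Rightarrow> real)"
  unfolding gauss_def[abs_def] by (rule lborel_integrable_prod_cart) (rule integral_std_normal_density)

lemma integral_gauss: "(\<integral>x. gauss x \<partial>lborel) = 1"
  unfolding gauss_def by (subst lborel_integral_prod_cart) (simp_all add: integral_std_normal_density)

lemma wave_prod: "wave \<xi> x = (\<Prod>i\<in>UNIV. cis (\<xi> $ i * x $ i))"
proof -
  have "(\<Prod>i\<in>A. cis (\<xi> $ i * x $ i)) = cis (\<Sum>i\<in>A. \<xi> $ i * x $ i)" if "finite A" for A
    using that by (induction A) (auto simp: cis_mult)
  then show ?thesis by (simp add: wave_def inner_vec_def)
qed

text \<open>The Gaussian is a multiple of its own Fourier transform: in each coordinate this is the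
  characteristic function of the standard normal distribution.\<close>

lemma fourier_gauss:
  fixes y :: "real ^ 'n::finite"
  shows "of_real (gauss y) = of_real ((1 / sqrt (2 * pi)) ^ CARD('n)) * (\<integral>\<eta>. wave \<eta> y * of_real (gauss \<eta>) \<partial>lborel)"
proof -
  have one: "(\<integral>t. cis (t * s) * complex_of_real (std_normal_density t) \<partial>lborel) = of_real (exp (- s\<^sup>2 / 2))"
    and int: "integrable lborel (\<lambda>t. cis (t * s) * complex_of_real (std_normal_density t))" for s
  proof -
    have "(\<integral>t. cis (t * s) * complex_of_real (std_normal_density t) \<partial>lborel)
      = (\<integral>t. std_normal_density t *\<^sub>R iexp (s * t) \<partial>lborel)"
      by (rule Bochner_Integration.integral_cong) (auto simp: cis_conv_exp scaleR_conv_of_real mult_ac)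
    also have "\<dots> = char std_normal_distribution s"
      unfolding char_def by (subst integral_density) auto
    finally show "(\<integral>t. cis (t * s) * complex_of_real (std_normal_density t) \<partial>lborel) = of_real (exp (- s\<^sup>2 / 2))"
      by (simp add: char_std_normal_distribution)
    show "integrable lborel (\<lambda>t. cis (t * s) * complex_of_real (std_normal_density t))"
      by (rule Bochner_Integration.integrable_bound[OF integral_std_normal_density(1)])
        (auto simp: norm_mult cis_conv_exp)
  qed
  have "(\<integral>\<eta>. wave \<eta> y * of_real (gauss \<eta>) \<partial>lborel)
    = integral\<^sup>L lborel (\<lambda>\<eta> :: real ^ 'n. \<Prod>i\<in>UNIV. cis (\<eta> $ i * y $ i) * of_real (std_normal_density (\<eta> $ i)))"
    by (simp add: wave_prod gauss_def prod.distrib)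
  also have "\<dots> = (\<Prod>i\<in>UNIV. of_real (exp (- (y $ i)\<^sup>2 / 2)))"
    by (subst lborel_integral_prod_cart[where f="\<lambda>i t. cis (t * y $ i) * of_real (std_normal_density t)"])
      (simp_all only: one int)
  finally have "of_real ((1 / sqrt (2 * pi)) ^ CARD('n)) * (\<integral>\<eta>. wave \<eta> y * of_real (gauss \<eta>) \<partial>lborel)
    = (\<Prod>i\<in>(UNIV :: 'n set). complex_of_real (1 / sqrt (2 * pi) * exp (- (y $ i)\<^sup>2 / 2)))"
    by (simp add: prod_dividef power_divide)
  then show ?thesis by (simp add: gauss_def std_normal_density_def)
qed

text \<open>An integrable weight in frequency space. The product form reduces its integrability to
  that of \<open>1 / (1 + x\<^sup>2)\<close> on the line.\<close>

definition decay :: "real ^ 'n::finite \<Rightarrow> real" where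
  "decay \<xi> = (\<Prod>i\<in>UNIV. 1 / (1 + (\<xi> $ i)\<^sup>2))"

lemma integrable_decay: "integrable lborel (decay :: real ^ 'n::finite \<Rightarrow> real)"
proof -
  have "set_integrable lborel (einterval (- \<infinity>) \<infinity>) (\<lambda>x::real. inverse (1 + x\<^sup>2))"
    by (rule integrable_inverse_1_plus_square)
  then have "integrable lborel (\<lambda>x::real. 1 / (1 + x\<^sup>2))"
    by (simp add: set_integrable_def inverse_eq_divide)
  then show ?thesis
    unfolding decay_def[abs_def] by (intro lborel_integrable_prod_cart)
qed

lemma decay_pos: "decay \<xi> > 0"
  by (auto simp: decay_def intro!: prod_pos divide_pos_pos add_pos_nonneg)

text \<open>The averages \<open>J s\<close> of \<open>v\<close> against a Gaussian of width
  \<open>s\<close> centred at \<open>x0\<close> converge to \<open>v x0\<close> as \<open>s\<close>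
  tends to 0. Writing the Gaussian as a Fourier integral and exchanging the integrals expresses
  \<open>J s\<close> by the Fourier transform of \<open>v\<close>, with a bound independent of
  \<open>s\<close>.\<close>

lemma sup_le_fourier_decay:
  fixes v :: "real ^ 'n::finite \<Rightarrow> complex"
  assumes v: "continuous_on UNIV v" "compact K" "\<And>x. x \<notin> K \<Longrightarrow> v x = 0"
    and ft: "\<And>\<xi>. cmod (\<integral>x. v x * wave \<xi> x \<partial>lborel) \<le> C * decay \<xi>"
  shows "cmod (v x0) \<le> C * (\<integral>\<xi>. decay (\<xi> :: real ^ 'n) \<partial>lborel)"
proof -
  have [measurable]: "v \<in> borel_measurable borel" using v(1) by (rule borel_measurable_continuous_onI)
  have [measurable]: "(gauss :: real ^ 'n \<Rightarrow> real) \<in> borel_measurable borel"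
    using borel_measurable_integrable[OF integrable_gauss] by simp
  have [measurable]: "(decay :: real ^ 'n \<Rightarrow> real) \<in> borel_measurable borel"
    using borel_measurable_integrable[OF integrable_decay] by simp
  have wm[measurable]: "(\<lambda>p :: (real ^ 'n) \<times> (real ^ 'n). wave (snd p) (fst p)) \<in> borel_measurable (borel \<Otimes>\<^sub>M borel)"
    unfolding wave_def cis_conv_exp borel_prod
    by (intro borel_measurable_continuous_onI continuous_intros)
  obtain B where B: "B > 0" "\<And>x. cmod (v x) \<le> B" using bounded_compact_support[OF v] by blast
  define J where "J s = (\<integral>y. v (x0 + s *\<^sub>R y) * of_real (gauss y) \<partial>lborel)" for s
  define \<kappa> where "\<kappa> = (1 / sqrt (2 * pi)) ^ CARD('n)"
  have \<kappa>: "0 \<le> \<kappa>" "\<kappa> \<le> 1"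
  proof -
    have "sqrt (2 * pi) \<ge> 1" using pi_gt3 by (auto intro!: real_le_rsqrt)
    then show "0 \<le> \<kappa>" "\<kappa> \<le> 1" by (auto simp: \<kappa>_def intro!: power_le_one)
  qed
  have J: "cmod (J s) \<le> C * (\<integral>\<xi>. decay (\<xi> :: real ^ 'n) \<partial>lborel)" if "s > 0" for s
  proof -
    let ?f = "\<lambda>y \<eta>. v (x0 + s *\<^sub>R y) * (wave \<eta> y * of_real (gauss \<eta>))"
    have vs: "integrable lborel (\<lambda>y. v (x0 + s *\<^sub>R y))"
    proof (rule integrable_compact_support)
      show "continuous_on UNIV (\<lambda>y. v (x0 + s *\<^sub>R y))"
        by (rule continuous_on_compose2[OF v(1)]) (auto intro!: continuous_intros)
      show "compact ((\<lambda>x. (1 / s) *\<^sub>R (x - x0)) ` K)"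
        by (intro compact_continuous_image v(2) continuous_intros)
      fix y assume "y \<notin> (\<lambda>x. (1 / s) *\<^sub>R (x - x0)) ` K"
      moreover have "y = (1 / s) *\<^sub>R ((x0 + s *\<^sub>R y) - x0)" using that by simp
      ultimately have "x0 + s *\<^sub>R y \<notin> K" by blast
      then show "v (x0 + s *\<^sub>R y) = 0" by (rule v(3))
    qed
    have intg: "integrable (lborel \<Otimes>\<^sub>M lborel) (\<lambda>(y, \<eta>). ?f y \<eta>)"
    proof (rule lborel_pair.Fubini_integrable)
      show "(\<lambda>(y, \<eta>). ?f y \<eta>) \<in> borel_measurable (lborel \<Otimes>\<^sub>M lborel)"
        using wm unfolding case_prod_unfold by measurable
      have "(\<lambda>y. \<integral>\<eta>. cmod (case (y, \<eta>) of (y, \<eta>) \<Rightarrow> ?f y \<eta>) \<partial>lborel) = (\<lambda>y. cmod (v (x0 + s *\<^sub>R y)))"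
        by (auto simp: norm_mult gauss_bounds integral_gauss)
      then show "integrable lborel (\<lambda>y. \<integral>\<eta>. cmod (case (y, \<eta>) of (y, \<eta>) \<Rightarrow> ?f y \<eta>) \<partial>lborel)"
        using vs by simp
      have "integrable lborel (?f y)" for y
      proof (rule Bochner_Integration.integrable_bound[OF integrable_mult_left[OF integrable_gauss, of B]])
        show "?f y \<in> borel_measurable lborel"
          using measurable_compose[OF measurable_Pair1'[of y borel borel] wm] by simp
        show "AE \<eta> in lborel. cmod (?f y \<eta>) \<le> norm (gauss \<eta> * B)"
          using mult_right_mono[OF B(2) gauss_bounds(1)] B(1) by (auto simp: norm_mult gauss_bounds mult.commute)
      qed
      then show "AE y in lborel. integrable lborel (\<lambda>\<eta>. case (y, \<eta>) of (y, \<eta>) \<Rightarrow> ?f y \<eta>)" by simp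
    qed
    \<comment> \<open>The substitution \<open>x = x0 + s *\<^sub>R y\<close> turns the inner
      integral into the Fourier transform of \<open>v\<close> at
      \<open>(1 / s) *\<^sub>R \<eta>\<close>, up to a factor of modulus 1. The Jacobian
      \<open>(1 / s) ^ CARD('n)\<close> is undone by the later integration over \<eta>, and
      \<open>gauss \<eta>\<close> is bounded by 1.\<close>
    have inner: "cmod (\<integral>y. ?f y \<eta> \<partial>lborel) \<le> C * ((1 / s) ^ CARD('n) * decay ((1 / s) *\<^sub>R \<eta>))" for \<eta>
    proof -
      let ?\<zeta> = "(1 / s) *\<^sub>R \<eta>"
      have [measurable]: "wave \<zeta> \<in> borel_measurable borel" for \<zeta> :: "real ^ 'n"
        by (rule borel_measurable_continuous_onI) (rule continuous_on_wave)
      have w: "wave ?\<zeta> (x0 + s *\<^sub>R y) = wave ?\<zeta> x0 * wave \<eta> y" for y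
        using that by (simp add: wave_def cis_mult inner_add_right)
      have "(\<integral>x. v x * wave ?\<zeta> x \<partial>lborel)
        = s ^ CARD('n) *\<^sub>R (\<integral>y. v (x0 + s *\<^sub>R y) * wave ?\<zeta> (x0 + s *\<^sub>R y) \<partial>lborel)"
        by (subst lborel_integral_affine[of _ s x0]) (use that in auto)
      also have "(\<integral>y. v (x0 + s *\<^sub>R y) * wave ?\<zeta> (x0 + s *\<^sub>R y) \<partial>lborel)
        = wave ?\<zeta> x0 * (\<integral>y. v (x0 + s *\<^sub>R y) * wave \<eta> y \<partial>lborel)"
        by (subst integral_mult_right_zero[symmetric]) (simp add: w mult_ac)
      finally have "cmod (\<integral>y. v (x0 + s *\<^sub>R y) * wave \<eta> y \<partial>lborel)
        = (1 / s) ^ CARD('n) * cmod (\<integral>x. v x * wave ?\<zeta> x \<partial>lborel)"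
        using that by (simp add: norm_mult power_divide)
      also have "\<dots> \<le> (1 / s) ^ CARD('n) * (C * decay ?\<zeta>)"
        using that by (intro mult_left_mono ft) auto
      finally have *: "cmod (\<integral>y. v (x0 + s *\<^sub>R y) * wave \<eta> y \<partial>lborel) \<le> (1 / s) ^ CARD('n) * (C * decay ?\<zeta>)" .
      have "(\<integral>y. ?f y \<eta> \<partial>lborel) = (\<integral>y. v (x0 + s *\<^sub>R y) * wave \<eta> y \<partial>lborel) * of_real (gauss \<eta>)"
        by (subst integral_mult_left_zero[symmetric]) (simp add: mult_ac)
      then have "cmod (\<integral>y. ?f y \<eta> \<partial>lborel) \<le> cmod (\<integral>y. v (x0 + s *\<^sub>R y) * wave \<eta> y \<partial>lborel) * 1"
        using gauss_bounds[of \<eta>] by (simp only: norm_mult norm_of_real) (intro mult_left_mono, auto)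
      then show ?thesis using * by (simp add: mult_ac)
    qed
    have "J s = (\<integral>y. of_real \<kappa> * (\<integral>\<eta>. ?f y \<eta> \<partial>lborel) \<partial>lborel)"
      unfolding J_def
    proof (rule Bochner_Integration.integral_cong[OF refl])
      fix y
      have "(\<integral>\<eta>. ?f y \<eta> \<partial>lborel) = v (x0 + s *\<^sub>R y) * (\<integral>\<eta>. wave \<eta> y * of_real (gauss \<eta>) \<partial>lborel)"
        by (rule integral_mult_right_zero)
      then show "v (x0 + s *\<^sub>R y) * of_real (gauss y) = of_real \<kappa> * (\<integral>\<eta>. ?f y \<eta> \<partial>lborel)"
        unfolding fourier_gauss[of y] \<kappa>_def by (simp only: mult_ac)
    qed
    also have "\<dots> = of_real \<kappa> * (\<integral>y. (\<integral>\<eta>. ?f y \<eta> \<partial>lborel) \<partial>lborel)" by (rule integral_mult_right_zero)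
    also have "(\<integral>y. (\<integral>\<eta>. ?f y \<eta> \<partial>lborel) \<partial>lborel) = (\<integral>\<eta>. (\<integral>y. ?f y \<eta> \<partial>lborel) \<partial>lborel)"
      using lborel_pair.Fubini_integral[OF intg] by simp
    finally have "cmod (J s) \<le> 1 * cmod (\<integral>\<eta>. (\<integral>y. ?f y \<eta> \<partial>lborel) \<partial>lborel)"
      using \<kappa> by (simp only: norm_mult norm_of_real) (intro mult_right_mono, auto)
    \<comment> \<open>The summand \<open>0\<close> gives the integrand the shape required by
      \<open>lborel_integral_affine\<close>.\<close>
    also have "\<dots> \<le> (\<integral>\<eta>. C * ((1 / s) ^ CARD('n) * decay (0 + (1 / s) *\<^sub>R \<eta> :: real ^ 'n)) \<partial>lborel)"
    proof -
      have "integrable lborel (\<lambda>\<eta> :: real ^ 'n. decay (0 + (1 / s) *\<^sub>R \<eta>))"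
        unfolding decay_def
      proof (subst vector_add_component, subst vector_scaleR_component, subst zero_index, rule lborel_integrable_prod_cart)
        have "integrable lborel (\<lambda>x::real. 1 / (1 + x\<^sup>2))"
          using integrable_inverse_1_plus_square by (simp add: set_integrable_def inverse_eq_divide)
        from lborel_integrable_real_affine[OF this, of "1 / s" 0]
        show "integrable lborel (\<lambda>x::real. 1 / (1 + (0 + (1 / s) *\<^sub>R x)\<^sup>2))" using that by simp
      qed
      then have "integrable lborel (\<lambda>\<eta> :: real ^ 'n. C * ((1 / s) ^ CARD('n) * decay (0 + (1 / s) *\<^sub>R \<eta>)))"
        by (intro integrable_mult_right)
      then show ?thesis
        unfolding mult_1 by (rule order_trans[OF integral_norm_bound integral_mono'])
          (use inner order_trans[OF norm_ge_zero inner] in auto)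
    qed
    also have "\<dots> = C * (\<integral>\<xi>. decay (\<xi> :: real ^ 'n) \<partial>lborel)"
      by (subst lborel_integral_affine[of decay "1 / s" 0]) (use that in auto)
    finally show ?thesis .
  qed
  have "(\<lambda>n. J (1 / real (Suc n))) \<longlonglongrightarrow> (\<integral>y. v x0 * of_real (gauss (y :: real ^ 'n)) \<partial>lborel)"
    unfolding J_def
  proof (rule integral_dominated_convergence)
    show "integrable lborel (\<lambda>y :: real ^ 'n. B * gauss y)" by (intro integrable_mult_right integrable_gauss)
    have "(\<lambda>n. v (x0 + (1 / real (Suc n)) *\<^sub>R y)) \<longlonglongrightarrow> v x0" for y
    proof -
      have "(\<lambda>n. x0 + (1 / real (Suc n)) *\<^sub>R y) \<longlonglongrightarrow> x0 + 0 *\<^sub>R y"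
        by (intro tendsto_intros lim_1_over_n[THEN LIMSEQ_Suc])
      then have *: "(\<lambda>n. x0 + (1 / real (Suc n)) *\<^sub>R y) \<longlonglongrightarrow> x0" by simp
      have "isCont v x0" using v(1) by (simp add: continuous_on_eq_continuous_at)
      from isCont_tendsto_compose[OF this *] show ?thesis .
    qed
    then show "AE y in lborel. (\<lambda>n. v (x0 + (1 / real (Suc n)) *\<^sub>R y) * of_real (gauss y)) \<longlonglongrightarrow> v x0 * of_real (gauss y)"
      by (intro AE_I2 tendsto_mult tendsto_const)
    show "AE y in lborel. norm (v (x0 + (1 / real (Suc n)) *\<^sub>R y) * complex_of_real (gauss y)) \<le> B * gauss y" for n
      using B by (auto simp: norm_mult gauss_bounds intro!: mult_right_mono)
  qed auto
  moreover have "(\<integral>y. v x0 * of_real (gauss (y :: real ^ 'n)) \<partial>lborel) = v x0"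
    using integral_gauss[where 'a='n] by simp
  ultimately have "(\<lambda>n. J (1 / real (Suc n))) \<longlonglongrightarrow> v x0" by (simp only:)
  then have "(\<lambda>n. cmod (J (1 / real (Suc n)))) \<longlonglongrightarrow> cmod (v x0)" by (rule tendsto_norm)
  then show ?thesis by (rule LIMSEQ_le_const2) (use J in auto)
qed

section \<open>The Fourier transform of a derivative\<close>

lemma has_vector_derivative_quotient_limit:
  fixes F :: "real \<Rightarrow> complex"
  assumes "(F has_vector_derivative D) (at 0)"
  shows "((\<lambda>t. (F t - F 0) /\<^sub>R t) \<longlongrightarrow> D) (at 0)"
proof (rule LIM_zero_cancel, rule tendsto_norm_zero_cancel)
  have *: "((\<lambda>t. norm (F (0 + t) - F 0 - t *\<^sub>R D) / norm t) \<longlongrightarrow> 0) (at 0)"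
    using assms unfolding has_vector_derivative_def has_derivative_at by blast
  have "norm (F (0 + t) - F 0 - t *\<^sub>R D) / norm t = norm ((F t - F 0) /\<^sub>R t - D)" if "t \<noteq> 0" for t
  proof -
    have "F t - F 0 - t *\<^sub>R D = t *\<^sub>R ((F t - F 0) /\<^sub>R t - D)" using that by (simp add: algebra_simps)
    then show ?thesis using that by simp
  qed
  then have "\<forall>\<^sub>F t in at 0. norm (F (0 + t) - F 0 - t *\<^sub>R D) / norm t = norm ((F t - F 0) /\<^sub>R t - D)"
    by (auto simp: eventually_at_filter)
  from tendsto_cong[OF this] * show "((\<lambda>t. norm ((F t - F 0) /\<^sub>R t - D)) \<longlongrightarrow> 0) (at 0)" by simp
qed

text \<open>Difference quotients of \<open>w\<close> have integral 0 by translation invariance, and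
  they converge to the partial derivative. Compact support makes \<open>w\<close> Lipschitz, which
  supplies the dominating function.\<close>

lemma integral_partial_deriv_0:
  fixes w :: "real ^ 'n::finite \<Rightarrow> complex"
  assumes w: "smooth_on UNIV w" "compact K" "\<And>x. x \<notin> K \<Longrightarrow> w x = 0"
  shows "(\<integral>x. partial_deriv i w x \<partial>lborel) = 0"
proof -
  have cw: "continuous_on UNIV (iter_partial is w)" for "is" by (rule smooth_on_continuous[OF w(1)])
  have cw0: "continuous_on UNIV w" using cw[of "[]"] by simp
  have [measurable]: "iter_partial is w \<in> borel_measurable borel" for "is"
    by (rule borel_measurable_continuous_onI[OF cw])
  have [measurable]: "w \<in> borel_measurable borel" by (rule borel_measurable_continuous_onI[OF cw0])
  have zero: "x \<notin> K \<Longrightarrow> iter_partial is w x = 0" for x "is"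
    using iter_partial_outside[OF open_UNIV w(1) compact_imp_closed[OF w(2)] subset_UNIV] w(3) by blast
  have "\<forall>j. \<exists>B>0. \<forall>x. cmod (iter_partial [j] w x) \<le> B"
    using bounded_compact_support[OF cw w(2) zero] by blast
  then obtain B where B: "\<And>j. B j > 0" "\<And>j x. cmod (iter_partial [j] w x) \<le> B j" by metis
  define L where "L = real CARD('n) * (\<Sum>j\<in>UNIV. B j)"
  have lip: "cmod (w y - w x) \<le> L * norm (y - x)" for x y
  proof (rule differentiable_bound[of UNIV w "\<lambda>x. gradient_map (\<lambda>i. iter_partial [i] w x)"])
    fix x :: "real ^ 'n"
    show "(w has_derivative gradient_map (\<lambda>i. iter_partial [i] w x)) (at x within UNIV)"
      using smooth_on_has_derivative[OF open_UNIV w(1), of x "[]"] by simp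
    have "B j \<le> (\<Sum>j\<in>UNIV. B j)" for j using B(1) by (intro member_le_sum) (auto intro: less_imp_le)
    then show "onorm (gradient_map (\<lambda>i. iter_partial [i] w x)) \<le> L"
      unfolding L_def by (intro onorm_le norm_gradient_map_le) (meson B(2) order_trans)
  qed auto
  define q where "q n x = real (Suc n) *\<^sub>R (w (x + (1 / real (Suc n)) *\<^sub>R axis i 1) - w x)" for n x
  obtain R where R: "\<And>x. x \<in> K \<Longrightarrow> norm x \<le> R" using compact_imp_bounded[OF w(2)] by (auto simp: bounded_iff)
  have "(\<lambda>n. \<integral>x. q n x \<partial>lborel) \<longlonglongrightarrow> (\<integral>x. partial_deriv i w x \<partial>lborel)"
  proof (rule integral_dominated_convergence)
    \<comment> \<open>The increments have length at most 1, so all the difference quotients vanish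
      outside the ball of radius \<open>R + 1\<close>.\<close>
    show "integrable lborel (\<lambda>x :: real ^ 'n. indicator (cball 0 (R + 1)) x *\<^sub>R L)"
      by (rule borel_integrable_compact) auto
    show "AE x in lborel. norm (q n x) \<le> indicator (cball 0 (R + 1)) x *\<^sub>R L" for n
    proof (rule AE_I2)
      fix x :: "real ^ 'n"
      let ?h = "(1 / real (Suc n)) *\<^sub>R axis i 1 :: real ^ 'n"
      have h: "norm ?h = 1 / real (Suc n)" by (simp add: norm_axis_1)
      show "norm (q n x) \<le> indicator (cball 0 (R + 1)) x *\<^sub>R L"
      proof (cases "norm x \<le> R + 1")
        case True
        have "norm (q n x) = real (Suc n) * cmod (w (x + ?h) - w x)" by (simp add: q_def)
        also have "\<dots> \<le> real (Suc n) * (L * (1 / real (Suc n)))"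
          using lip[of "x + ?h" x] h by (intro mult_left_mono) auto
        finally show ?thesis using True by simp
      next
        case False
        have "norm ?h \<le> 1" unfolding h by simp
        then have "norm (x + ?h) > R" using False norm_diff_ineq[of x ?h] by linarith
        then have "x \<notin> K" "x + ?h \<notin> K" using False R[of x] R[of "x + ?h"] by auto
        then have "q n x = 0" using w(3) by (simp add: q_def)
        then show ?thesis using False by simp
      qed
    qed
    show "AE x in lborel. (\<lambda>n. q n x) \<longlonglongrightarrow> partial_deriv i w x"
    proof (rule AE_I2)
      fix x
      have "((\<lambda>t. w (x + t *\<^sub>R axis i 1)) has_derivative
        (\<lambda>t. gradient_map (\<lambda>i. iter_partial [i] w x) (t *\<^sub>R axis i 1))) (at 0)"
      proof (rule has_derivative_compose[of "\<lambda>t. x + t *\<^sub>R axis i 1" _ _ _ w])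
        show "((\<lambda>t. x + t *\<^sub>R axis i 1) has_derivative (\<lambda>t. t *\<^sub>R axis i 1)) (at 0)"
          by (auto intro!: derivative_eq_intros)
        show "(w has_derivative gradient_map (\<lambda>i. iter_partial [i] w x)) (at (x + 0 *\<^sub>R axis i 1))"
          using smooth_on_has_derivative[OF open_UNIV w(1), of x "[]"] by simp
      qed
      then have "((\<lambda>t. w (x + t *\<^sub>R axis i 1)) has_vector_derivative partial_deriv i w x) (at 0)"
        by (simp add: has_vector_derivative_def gradient_map_simps(6) gradient_map_simps(4)[symmetric] gradient_map_axis)
      then have "((\<lambda>t. (w (x + t *\<^sub>R axis i 1) - w x) /\<^sub>R t) \<longlongrightarrow> partial_deriv i w x) (at 0)"
        using has_vector_derivative_quotient_limit by fastforce
      moreover have "filterlim (\<lambda>n. 1 / real (Suc n)) (at 0) sequentially"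
        by (rule filterlim_atI[OF lim_1_over_n[THEN LIMSEQ_Suc]]) auto
      ultimately have "(\<lambda>n. (w (x + (1 / real (Suc n)) *\<^sub>R axis i 1) - w x) /\<^sub>R (1 / real (Suc n))) \<longlonglongrightarrow> partial_deriv i w x"
        by (rule filterlim_compose)
      then show "(\<lambda>n. q n x) \<longlonglongrightarrow> partial_deriv i w x" by (simp add: q_def)
    qed
    show "partial_deriv i w \<in> borel_measurable lborel"
      using borel_measurable_continuous_onI[OF cw[of "[i]"]] by simp
    show "q n \<in> borel_measurable lborel" for n unfolding q_def[abs_def] by measurable
  qed
  moreover have "(\<integral>x. q n x \<partial>lborel) = 0" for n
  proof -
    have iw: "integrable lborel w" by (rule integrable_compact_support[OF cw0 w(2,3)])
    let ?h = "(1 / real (Suc n)) *\<^sub>R axis i 1 :: real ^ 'n"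
    have "integrable lborel (\<lambda>x. w (x + ?h))"
    proof (rule integrable_compact_support)
      show "continuous_on UNIV (\<lambda>x. w (x + ?h))"
        by (rule continuous_on_compose2[OF cw0]) (auto intro!: continuous_intros)
      show "compact ((\<lambda>x. x - ?h) ` K)"
        by (intro compact_continuous_image w(2) continuous_intros)
      fix y assume "y \<notin> (\<lambda>x. x - ?h) ` K"
      moreover have "y = (y + ?h) - ?h" by simp
      ultimately have "y + ?h \<notin> K" by blast
      then show "w (y + ?h) = 0" by (rule w(3))
    qed
    moreover have "(\<integral>x. w (x + ?h) \<partial>lborel) = (\<integral>x. w x \<partial>lborel)"
      using lborel_integral_affine[of w 1 ?h] by (simp add: add.commute)
    ultimately show ?thesis using iw unfolding q_def by simp
  qed
  ultimately show ?thesis using LIMSEQ_unique[OF _ tendsto_const] by simp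
qed

text \<open>Integration by parts: the partial derivative of \<open>v\<close> times the plane wave
  has integral 0, and the derivative of the wave is a multiple of the wave.\<close>

lemma fourier_partial_deriv:
  fixes v :: "real ^ 'n::finite \<Rightarrow> complex"
  assumes v: "smooth_on UNIV v" "compact K" "\<And>x. x \<notin> K \<Longrightarrow> v x = 0"
  shows "(\<integral>x. partial_deriv i v x * wave \<xi> x \<partial>lborel) = - (\<i> * \<xi> $ i) * (\<integral>x. v x * wave \<xi> x \<partial>lborel)"
proof -
  have zero: "x \<notin> K \<Longrightarrow> iter_partial is v x = 0" for x "is"
    using iter_partial_outside[OF open_UNIV v(1) compact_imp_closed[OF v(2)] subset_UNIV] v(3) by blast
  have int: "integrable lborel (\<lambda>x. iter_partial is v x * wave \<xi> x)" for "is"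
    by (rule integrable_compact_support[OF _ v(2)])
      (auto intro!: continuous_intros smooth_on_continuous[OF v(1)] simp: zero)
  have "partial_deriv i (\<lambda>x. v x * wave \<xi> x) x = iter_partial [i] v x * wave \<xi> x + \<i> * \<xi> $ i * (iter_partial [] v x * wave \<xi> x)" for x
    using iter_partial_mult[OF open_UNIV v(1) smooth_on_wave[of UNIV \<xi>], of x "[i]"] iter_partial_wave[of "[i]" \<xi> x] by simp
  then have "(\<integral>x. iter_partial [i] v x * wave \<xi> x + \<i> * \<xi> $ i * (iter_partial [] v x * wave \<xi> x) \<partial>lborel) = 0"
    using integral_partial_deriv_0[OF smooth_on_mult[OF open_UNIV v(1) smooth_on_wave] v(2), of \<xi> i] v(3) by simp
  moreover have "(\<integral>x. iter_partial [i] v x * wave \<xi> x + \<i> * \<xi> $ i * (iter_partial [] v x * wave \<xi> x) \<partial>lborel)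
     = (\<integral>x. iter_partial [i] v x * wave \<xi> x \<partial>lborel) + \<i> * \<xi> $ i * (\<integral>x. iter_partial [] v x * wave \<xi> x \<partial>lborel)"
    by (subst Bochner_Integration.integral_add[OF int integrable_mult_right[OF int]]) (simp only: integral_mult_right_zero)
  ultimately show ?thesis by (simp add: eq_neg_iff_add_eq_0)
qed

lemma fourier_iter_partial:
  fixes v :: "real ^ 'n::finite \<Rightarrow> complex"
  assumes v: "smooth_on UNIV v" "compact K" "\<And>x. x \<notin> K \<Longrightarrow> v x = 0"
  shows "(\<integral>x. iter_partial is v x * wave \<xi> x \<partial>lborel)
    = (\<Prod>k\<leftarrow>is. - (\<i> * \<xi> $ k)) * (\<integral>x. v x * wave \<xi> x \<partial>lborel)"
proof (induction "is")
  case (Cons i "is")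
  have "x \<notin> K \<Longrightarrow> iter_partial is v x = 0" for x
    using iter_partial_outside[OF open_UNIV v(1) compact_imp_closed[OF v(2)] subset_UNIV] v(3) by blast
  then show ?case
    using fourier_partial_deriv[OF smooth_on_iter_partial[OF v(1)] v(2), of "is" i \<xi>] Cons.IH by simp
qed simp

section \<open>Cutoff functions\<close>

lemma integral_cbox_translate:
  fixes \<rho> :: "real ^ 'n::finite \<Rightarrow> complex"
  assumes "continuous_on UNIV \<rho>" "compact L" "\<And>x. x \<notin> L \<Longrightarrow> \<rho> x = 0"
    and supp: "\<And>y. x - y \<in> L \<Longrightarrow> y \<in> cbox a b"
  shows "integral (cbox a b) (\<lambda>y. \<rho> (x - y)) = (\<integral>y. \<rho> y \<partial>lborel)"
proof -
  have [measurable]: "\<rho> \<in> borel_measurable borel" using assms(1) by (rule borel_measurable_continuous_onI)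
  have "integrable lborel (\<lambda>y. \<rho> (x - y))"
  proof (rule integrable_compact_support)
    show "continuous_on UNIV (\<lambda>y. \<rho> (x - y))"
      by (intro continuous_on_compose2[OF assms(1)] continuous_intros) auto
    show "compact ((\<lambda>z. x - z) ` L)" by (intro compact_continuous_image assms(2) continuous_intros)
    fix y assume "y \<notin> (\<lambda>z. x - z) ` L"
    then have "x - y \<notin> L" by (metis diff_diff_eq2 add_diff_cancel_left' image_eqI)
    then show "\<rho> (x - y) = 0" by (rule assms(3))
  qed
  then have "(\<integral>y. \<rho> (x - y) \<partial>lborel) = integral UNIV (\<lambda>y. \<rho> (x - y))" by (simp add: integral_lborel)
  also have "\<dots> = integral UNIV (\<lambda>y. if y \<in> cbox a b then \<rho> (x - y) else 0)"
    using supp assms(3) by (intro integral_cong) auto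
  also have "\<dots> = integral (cbox a b) (\<lambda>y. \<rho> (x - y))" by (rule integral_restrict_UNIV)
  finally show ?thesis using lborel_integral_affine[of \<rho> "-1" x] by simp
qed

text \<open>The average of \<open>\<rho>\<close> over a box equals the full integral of
  \<open>\<rho>\<close> as long as the translated support stays in the box; this makes the plateau.
  Taking the squared modulus of \<open>\<phi>\<close> ensures that the integral, by which one
  divides, is not 0.\<close>

lemma (in weight) bump_function:
  fixes \<Omega> :: "(real ^ 'n::finite) set"
  assumes "open \<Omega>" "\<phi> \<in> test_functions M \<Omega>" "\<phi> z \<noteq> 0" "x\<^sub>0 \<in> \<Omega>"
  shows "\<exists>K \<eta> r. r > 0 \<and> K \<in> regular_compacts \<Omega> \<and> \<eta> \<in> test_functions_on M \<Omega> K \<and>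
    (\<forall>x\<in>ball x\<^sub>0 r. \<eta> x = 1)"
proof -
  obtain K\<^sub>0 where K\<^sub>0: "K\<^sub>0 \<in> regular_compacts \<Omega>" "\<phi> \<in> test_functions_on M \<Omega> K\<^sub>0"
    using assms(2) by (auto simp: test_functions_def)
  have \<phi>: "ultra_bounded \<phi>" using test_functions_ultra_bounded[OF assms(1) K\<^sub>0] .
  have "bounded K\<^sub>0" using K\<^sub>0(1) compact_regular_compacts compact_imp_bounded by blast
  then obtain R\<^sub>0 where R\<^sub>0: "R\<^sub>0 > 0" "\<And>x. x \<in> K\<^sub>0 \<Longrightarrow> norm x \<le> R\<^sub>0" by (auto simp: bounded_pos)
  define R where "R = R\<^sub>0 + norm z"
  have R: "R > 0" using R\<^sub>0 by (simp add: R_def add_pos_nonneg)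
  have \<phi>0: "\<phi> (z + y) = 0" if "norm y > R" for y
  proof -
    have "norm (z + y) > R\<^sub>0" using that norm_diff_ineq[of y z] by (simp add: R_def add.commute)
    then show ?thesis using R\<^sub>0(2)[of "z + y"] K\<^sub>0(2) by (auto simp: test_functions_on_def)
  qed
  obtain e where e: "e > 0" "cball x\<^sub>0 e \<subseteq> \<Omega>" using assms(1,4) open_contains_cball by blast
  \<comment> \<open>By the comparison with the sum norm, points of the box of half-width
    \<open>s\<close> lie within \<open>e / 2\<close> of the centre; together with the support radius
    \<open>s / 2\<close> of \<open>\<rho>\<close> this stays within \<open>e\<close>.\<close>
  define s where "s = e / (2 * real CARD('n))"
  have n1: "real CARD('n) \<ge> 1" by (simp add: Suc_leI)
  have s: "s > 0" "s \<le> e / 2" using e n1 by (auto simp: s_def field_simps)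
  define a where "a = x\<^sub>0 - s *\<^sub>R (\<chi> i. 1)"
  define b where "b = x\<^sub>0 + s *\<^sub>R (\<chi> i. 1)"
  have box: "y \<in> cbox a b \<longleftrightarrow> (\<forall>i. \<bar>(y - x\<^sub>0) $ i\<bar> \<le> s)" for y
    by (auto simp: mem_box_cart a_def b_def abs_le_iff algebra_simps)
  have box_small: "norm (y - x\<^sub>0) \<le> e / 2" if "y \<in> cbox a b" for y
  proof -
    have "norm (y - x\<^sub>0) \<le> (\<Sum>i\<in>UNIV. \<bar>(y - x\<^sub>0) $ i\<bar>)" by (rule norm_le_l1_cart)
    also have "\<dots> \<le> (\<Sum>i\<in>(UNIV :: 'n set). s)" by (rule sum_mono) (use that box in blast)
    also have "\<dots> = e / 2" by (simp add: s_def)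
    finally show ?thesis .
  qed
  have box_big: "y \<in> cbox a b" if "norm (y - x\<^sub>0) \<le> s" for y
    unfolding box using that component_le_norm_cart order_trans by blast
  \<comment> \<open>This dilation shrinks the support radius from \<open>R\<close> to
    \<open>s / 2\<close>. For a point within \<open>s / 2\<close> of the centre, the translated
    support then lies in the box.\<close>
  define t where "t = R / (s / 2)"
  have t: "t > 0" using R s by (simp add: t_def)
  define \<rho> where "\<rho> y = \<phi> (z + t *\<^sub>R y) * cnj (\<phi> (z + t *\<^sub>R y))" for y
  have ub: "ultra_bounded \<rho>"
    unfolding \<rho>_def by (intro ultra_bounded_mult ultra_bounded_cnj ultra_bounded_affine \<phi> t)
  then have sm: "smooth_on UNIV \<rho>" by (simp add: ultra_bounded_def)
  have c\<rho>: "continuous_on UNIV \<rho>" using smooth_on_continuous[OF sm, of "[]"] by simp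
  have \<rho>0: "\<rho> y = 0" if "y \<notin> cball 0 (s / 2)" for y
  proof -
    have "R < t * norm y" using that s R by (simp add: t_def field_simps)
    then have "norm (t *\<^sub>R y) > R" using t by simp
    then show ?thesis using \<phi>0 by (simp add: \<rho>_def)
  qed
  define \<Phi> where "\<Phi> x = integral (cbox a b) (\<lambda>y. \<rho> (x - y))" for x
  have \<Phi>: "ultra_bounded \<Phi>" unfolding \<Phi>_def by (rule ultra_bounded_box_average[OF ub])
  define c where "c = (\<integral>y. \<rho> y \<partial>lborel)"
  have \<Phi>c: "\<Phi> x = c" if "x \<in> ball x\<^sub>0 (s / 2)" for x
    unfolding \<Phi>_def c_def
  proof (rule integral_cbox_translate[OF c\<rho> compact_cball \<rho>0])
    fix y assume "x - y \<in> cball 0 (s / 2)"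
    then have "norm (x - y) \<le> s / 2" by simp
    moreover have "norm (x - x\<^sub>0) < s / 2" using that by (simp add: dist_norm norm_minus_commute)
    moreover have "norm (y - x\<^sub>0) \<le> norm (x - x\<^sub>0) + norm (x - y)"
      using norm_triangle_ineq4[of "x - x\<^sub>0" "x - y"] by simp
    ultimately show "y \<in> cbox a b" by (intro box_big) linarith
  qed
  \<comment> \<open>At the centre the average integrates a continuous nonnegative function over the
    box. If it were 0, the function would vanish at \<open>x\<^sub>0\<close>, where its value is the
    squared modulus of \<open>\<phi> z\<close>.\<close>
  have "c \<noteq> 0"
  proof
    assume "c = 0"
    define g where "g y = (cmod (\<phi> (z + t *\<^sub>R (x\<^sub>0 - y))))\<^sup>2" for y
    have g: "\<rho> (x\<^sub>0 - y) = of_real (g y)" for y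
      unfolding \<rho>_def g_def by (simp only: complex_norm_square)
    have cg: "continuous_on (cbox a b) g"
    proof -
      have "continuous_on UNIV \<phi>" using \<phi> smooth_on_continuous[of UNIV \<phi> "[]"] by (simp add: ultra_bounded_def)
      then have "continuous_on (cbox a b) (\<lambda>y. \<phi> (z + t *\<^sub>R (x\<^sub>0 - y)))"
        by (rule continuous_on_compose2) (auto intro!: continuous_intros)
      then show ?thesis unfolding g_def by (intro continuous_intros)
    qed
    have "0 = \<Phi> x\<^sub>0" using \<Phi>c[of x\<^sub>0] s \<open>c = 0\<close> by simp
    also have "\<dots> = complex_of_real (integral (cbox a b) g)"
      unfolding \<Phi>_def g using integral_linear[OF integrable_continuous[OF cg], of complex_of_real]
      by (simp add: o_def bounded_linear_of_real)
    finally have "integral (cbox a b) g = 0" by simp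
    moreover have "box a b \<noteq> {}"
      using s by (auto simp: box_ne_empty a_def b_def inner_diff_left inner_add_left Basis_cart inner_axis)
    moreover have "x\<^sub>0 \<in> cbox a b" using box_big[of x\<^sub>0] s by simp
    ultimately have "g x\<^sub>0 = 0" using integral_cbox_eq_0_iff[OF cg] by (auto simp: g_def)
    then show False using assms(3) by (simp add: g_def)
  qed
  define \<eta> where "\<eta> x = (1 / c) * \<Phi> x" for x
  have "\<eta> x = 0" if "x \<notin> cball x\<^sub>0 e" for x
  proof -
    have "\<rho> (x - y) = 0" if y: "y \<in> cbox a b" for y
    proof (rule \<rho>0)
      have "e < norm (x - x\<^sub>0)" using \<open>x \<notin> cball x\<^sub>0 e\<close> by (simp add: dist_norm norm_minus_commute)
      moreover have "norm (x - x\<^sub>0) \<le> norm (x - y) + norm (y - x\<^sub>0)"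
        using norm_triangle_ineq[of "x - y" "y - x\<^sub>0"] by simp
      ultimately show "x - y \<notin> cball 0 (s / 2)" using box_small[OF y] s by simp
    qed
    then have "\<Phi> x = integral (cbox a b) (\<lambda>y. 0)" unfolding \<Phi>_def by (intro integral_cong) auto
    then show ?thesis by (simp add: \<eta>_def)
  qed
  moreover have "\<eta> \<in> ultra_diff M \<Omega>"
    unfolding \<eta>_def by (intro ultra_bounded_ultra_diff ultra_bounded_cmult \<Phi>)
  ultimately have "\<eta> \<in> test_functions_on M \<Omega> (cball x\<^sub>0 e)" by (simp add: test_functions_on_def)
  moreover have "cball x\<^sub>0 e \<in> regular_compacts \<Omega>"
    using e(2) by (simp add: regular_compacts_def regular_compact_convex)
  moreover have "\<forall>x\<in>ball x\<^sub>0 (s / 2). \<eta> x = 1" using \<Phi>c \<open>c \<noteq> 0\<close> by (simp add: \<eta>_def)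
  ultimately show ?thesis using s(1) by (intro exI[of _ "cball x\<^sub>0 e"] exI[of _ \<eta>] exI[of _ "s / 2"]) auto
qed

section \<open>Trigonometric series\<close>

text \<open>The |\<xi>| of all estimates. A power of the maximum norm is attained by a power of one
  coordinate, hence by repeating a single partial derivative.\<close>

definition maxnorm :: "real ^ 'n::finite \<Rightarrow> real" where
  "maxnorm \<xi> = Max (range (\<lambda>i. \<bar>\<xi> $ i\<bar>))"

lemma component_le_maxnorm: "\<bar>\<xi> $ i\<bar> \<le> maxnorm \<xi>"
  by (auto simp: maxnorm_def)

lemma maxnorm_attained: "\<exists>i. maxnorm \<xi> = \<bar>\<xi> $ i\<bar>"
proof -
  have "maxnorm \<xi> \<in> range (\<lambda>i. \<bar>\<xi> $ i\<bar>)" unfolding maxnorm_def by (rule Max_in) auto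
  then show ?thesis by auto
qed

lemma maxnorm_nonneg: "0 \<le> maxnorm \<xi>"
  using order_trans[OF abs_ge_zero component_le_maxnorm] .

lemma prod_list_le_maxnorm: "cmod (\<Prod>k\<leftarrow>is. \<i> * \<xi> $ k) \<le> maxnorm \<xi> ^ length is"
  by (induction "is") (auto simp: norm_mult intro!: mult_mono component_le_maxnorm maxnorm_nonneg)

lemma norm_prod_list_uminus:
  fixes \<xi> :: "real ^ 'n::finite"
  shows "cmod (\<Prod>k\<leftarrow>is. - (\<i> * \<xi> $ k)) = cmod (\<Prod>k\<leftarrow>is. \<i> * \<xi> $ k)"
  by (induction "is") (auto simp: norm_mult)

lemma pairing_test_function:
  assumes "K \<subseteq> \<Omega>" "\<And>x. x \<notin> K \<Longrightarrow> \<phi> x = 0"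
  shows "pairing \<Omega> u \<phi> = (\<integral>x. \<phi> x * u x \<partial>lborel)"
  unfolding pairing_def set_lebesgue_integral_def
  by (rule Bochner_Integration.integral_cong) (use assms in \<open>auto simp: indicator_def\<close>)

context weight begin

lemma test_function_mult:
  assumes "open \<Omega>" "K \<in> regular_compacts \<Omega>" "\<phi> \<in> test_functions_on M \<Omega> K" "ultra_bounded f"
  shows "(\<lambda>x. \<phi> x * f x) \<in> test_functions_on M \<Omega> K"
  using ultra_bounded_ultra_diff[OF ultra_bounded_mult[OF test_functions_ultra_bounded[OF assms(1-3)] assms(4)]] assms(3)
  by (auto simp: test_functions_on_def)

text \<open>By \<open>power_le_E\<close> at |\<xi>| divided by \<open>h\<close>, a derivative of
  order \<open>p\<close> of a plane wave is at most
  \<open>h ^ p * M p * E (maxnorm \<xi> / h)\<close>, and coefficients summable against all these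
  weights give Beurling bounds. The levels \<open>l\<close> are natural numbers to match the gliding
  hump; level \<open>l\<close> serves all \<open>h\<close> with
  \<open>1 / h \<le> l\<close>.\<close>

lemma trigonometric_series:
  fixes a :: "nat \<Rightarrow> real" and \<xi> :: "nat \<Rightarrow> real ^ 'n::finite"
  assumes summ: "\<And>l::nat. summable (\<lambda>j. \<bar>a j\<bar> * E (real l * maxnorm (\<xi> j)))"
  shows "ultra_bounded (\<lambda>x. \<Sum>j. a j * wave (\<xi> j) x)"
proof -
  define F where "F N is x = (\<Sum>j<N. a j * ((\<Prod>k\<leftarrow>is. \<i> * \<xi> j $ k) * wave (\<xi> j) x))" for N "is" and x :: "real ^ 'n"
  define P where "P is x = (\<Sum>j. a j * ((\<Prod>k\<leftarrow>is. \<i> * \<xi> j $ k) * wave (\<xi> j) x))" for "is" and x :: "real ^ 'n"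
  have F: "(F N is has_derivative gradient_map (\<lambda>i. F N (i # is) x)) (at x)" for N "is" x
  proof -
    have "((\<lambda>x. a j * iter_partial is (wave (\<xi> j)) x) has_derivative
       (\<lambda>h. a j * gradient_map (\<lambda>i. iter_partial (i # is) (wave (\<xi> j)) x) h)) (at x)" for j
      by (intro has_derivative_mult_right smooth_on_has_derivative[OF open_UNIV smooth_on_wave UNIV_I])
    then have "((\<lambda>x. \<Sum>j<N. a j * iter_partial is (wave (\<xi> j)) x) has_derivative
       (\<lambda>h. \<Sum>j<N. a j * gradient_map (\<lambda>i. iter_partial (i # is) (wave (\<xi> j)) x) h)) (at x)"
      by (rule has_derivative_sum)
    moreover have "(\<Sum>j<N. a j * gradient_map (\<lambda>i. iter_partial (i # is) (wave (\<xi> j)) x) h)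
      = gradient_map (\<lambda>i. \<Sum>j<N. a j * iter_partial (i # is) (wave (\<xi> j)) x) h" for h
      unfolding gradient_map_def by (simp add: sum_distrib_left scaleR_sum_right) (rule sum.swap)
    ultimately show ?thesis unfolding F_def[abs_def] iter_partial_wave[symmetric] by simp
  qed
  have F0: "F N [] x = (\<Sum>j<N. a j * wave (\<xi> j) x)" for N x by (simp add: F_def)
  have smF: "smooth_on UNIV (\<lambda>x. \<Sum>j<N. a j * wave (\<xi> j) x)"
    and itF: "iter_partial is (\<lambda>x. \<Sum>j<N. a j * wave (\<xi> j) x) x = F N is x" for N "is" x
    using smooth_on_family[of UNIV "F N", OF open_UNIV F0 F]
      iter_partial_family[of UNIV "F N", OF open_UNIV F0 F UNIV_I] by auto
  have tm: "cmod (a j * ((\<Prod>k\<leftarrow>is. \<i> * \<xi> j $ k) * wave (\<xi> j) x)) \<le> \<bar>a j\<bar> * E (real l * maxnorm (\<xi> j)) * (h ^ length is * M (length is))"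
    if "h > 0" "1 / h \<le> real l" for j "is" x h l
  proof -
    let ?p = "length is" and ?m = "maxnorm (\<xi> j)"
    have m0: "?m \<ge> 0" by (rule maxnorm_nonneg)
    have "?m ^ ?p = h ^ ?p * (?m / h) ^ ?p" using that(1) by (simp add: power_divide)
    also have "\<dots> \<le> h ^ ?p * (M ?p * E (?m / h))"
      by (intro mult_left_mono power_le_E) (use that(1) m0 in auto)
    also have "\<dots> \<le> h ^ ?p * (M ?p * E (real l * ?m))"
      using mult_right_mono[OF that(2) m0] that(1) m0 M_pos[of ?p]
      by (intro mult_left_mono E_mono) auto
    finally have "cmod (\<Prod>k\<leftarrow>is. \<i> * \<xi> j $ k) \<le> h ^ ?p * (M ?p * E (real l * ?m))"
      using prod_list_le_maxnorm order_trans by blast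
    then have "\<bar>a j\<bar> * cmod (\<Prod>k\<leftarrow>is. \<i> * \<xi> j $ k) \<le> \<bar>a j\<bar> * (h ^ ?p * (M ?p * E (real l * ?m)))"
      by (rule mult_left_mono) simp
    then show ?thesis by (simp add: norm_mult mult_ac)
  qed
  \<comment> \<open>For each list, the case \<open>h = 1\<close>, \<open>l = 1\<close> of the term
    estimate is a summable majorant independent of the point.\<close>
  have ul: "uniform_limit UNIV (\<lambda>N. iter_partial is (\<lambda>x. \<Sum>j<N. a j * wave (\<xi> j) x)) (P is) sequentially" for "is"
    unfolding itF[abs_def] unfolding F_def P_def
    by (rule Weierstrass_m_test[OF _ summable_mult2[OF summ[of 1]]]) (rule tm[of 1 1], auto)
  have lim: "\<exists>r>0. ball x r \<subseteq> UNIV \<and>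
      uniform_limit (ball x r) (\<lambda>N. iter_partial is (\<lambda>x. \<Sum>j<N. a j * wave (\<xi> j) x)) (P is) sequentially" for x "is"
    using uniform_limit_on_subset[OF ul] by (intro exI[of _ 1]) auto
  have P0: "(\<Sum>j. a j * wave (\<xi> j) x) = P [] x" for x by (simp add: P_def)
  note limit = smooth_on_limit[OF open_UNIV smF lim P0] iter_partial_limit[OF open_UNIV smF lim P0 UNIV_I]
  show ?thesis
    unfolding ultra_bounded_def
  proof (intro conjI allI impI)
    show "smooth_on UNIV (\<lambda>x. \<Sum>j. a j * wave (\<xi> j) x)" by (rule limit(1))
    fix h :: real assume h: "h > 0"
    obtain l :: nat where l: "1 / h \<le> real l" using real_arch_simple by blast
    let ?C = "\<Sum>j. \<bar>a j\<bar> * E (real l * maxnorm (\<xi> j))"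
    have "?C \<ge> 0" by (intro suminf_nonneg summ) (simp add: less_imp_le[OF E_pos])
    moreover have "cmod (multi_deriv \<alpha> (\<lambda>x. \<Sum>j. a j * wave (\<xi> j) x) x) \<le> ?C * h ^ (\<Sum>i\<in>UNIV. \<alpha> i) * M (\<Sum>i\<in>UNIV. \<alpha> i)" for x \<alpha>
    proof -
      have "cmod (P (midx \<alpha>) x) \<le> (\<Sum>j. \<bar>a j\<bar> * E (real l * maxnorm (\<xi> j)) * (h ^ length (midx \<alpha>) * M (length (midx \<alpha>))))"
        unfolding P_def by (rule norm_suminf_le[OF tm[OF h l] summable_mult2[OF summ]])
      also have "\<dots> = ?C * (h ^ length (midx \<alpha>) * M (length (midx \<alpha>)))" by (rule suminf_mult2[OF summ, symmetric])
      finally show ?thesis by (simp add: multi_deriv_midx limit(2) length_midx mult_ac)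
    qed
    ultimately show "\<exists>C\<ge>0. \<forall>x \<alpha>. cmod (multi_deriv \<alpha> (\<lambda>x. \<Sum>j. a j * wave (\<xi> j) x) x) \<le> C * h ^ (\<Sum>i\<in>UNIV. \<alpha> i) * M (\<Sum>i\<in>UNIV. \<alpha> i)"
      by blast
  qed
qed

text \<open>The inverse of \<open>decay\<close> is bounded by a polynomial of degree
  \<open>2 * CARD('n)\<close> in |\<xi>|, and \<open>power_le_E\<close> absorbs a polynomial into
  \<open>E\<close>.\<close>

lemma inverse_decay_le: "\<exists>C\<ge>0. \<forall>\<xi> :: real ^ 'n::finite. 1 \<le> C * E (maxnorm \<xi>) * decay \<xi>"
proof -
  let ?d = "CARD('n)"
  let ?C = "2 ^ ?d * (1 + M (2 * ?d))"
  have "1 \<le> ?C * E (maxnorm \<xi>) * decay \<xi>" for \<xi> :: "real ^ 'n"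
  proof -
    let ?m = "maxnorm \<xi>"
    have m0: "?m \<ge> 0" by (rule maxnorm_nonneg)
    have sq: "(\<xi> $ i)\<^sup>2 \<le> ?m\<^sup>2" for i
      using component_le_maxnorm[of \<xi> i] m0 by (simp add: abs_le_square_iff[symmetric])
    have inv: "1 / decay \<xi> = (\<Prod>i\<in>UNIV. 1 + (\<xi> $ i)\<^sup>2)" by (simp add: decay_def prod_dividef)
    have "1 / decay \<xi> \<le> (\<Prod>i\<in>(UNIV :: 'n set). 1 + ?m\<^sup>2)"
      unfolding inv by (rule prod_mono) (use sq in auto)
    also have "\<dots> = (1 + ?m\<^sup>2) ^ ?d" by simp
    also have "\<dots> \<le> 2 ^ ?d * (1 + ?m ^ (2 * ?d))"
    proof (cases "?m \<le> 1")
      case True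
      then have "1 + ?m\<^sup>2 \<le> 2" using m0 by (simp add: power_le_one)
      then have "(1 + ?m\<^sup>2) ^ ?d \<le> 2 ^ ?d" by (intro power_mono) auto
      also have "\<dots> \<le> 2 ^ ?d * (1 + ?m ^ (2 * ?d))" using m0 by simp
      finally show ?thesis .
    next
      case False
      then have "1 + ?m\<^sup>2 \<le> 2 * ?m\<^sup>2" using one_le_power[of ?m 2] by simp
      then have "(1 + ?m\<^sup>2) ^ ?d \<le> (2 * ?m\<^sup>2) ^ ?d" by (intro power_mono) auto
      then show ?thesis by (simp add: power_mult_distrib power_mult[symmetric] algebra_simps add_increasing)
    qed
    also have "\<dots> \<le> 2 ^ ?d * (E ?m + M (2 * ?d) * E ?m)"
      by (intro mult_left_mono add_mono power_le_E E_ge_1 m0) auto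
    finally show ?thesis using decay_pos[of \<xi>] by (simp add: field_simps)
  qed
  moreover have "?C \<ge> 0" using M_pos[of "2 * ?d"] by simp
  ultimately show ?thesis by blast
qed

end

section \<open>The Fourier estimate\<close>

text \<open>The functions \<open>u n\<close> will be differences of consecutive members of the net \<open>g\<close>, taken at the parameters
  \<open>1 / \<tau> n\<close>.\<close>

locale interpolation = weight M for M :: "nat \<Rightarrow> real" +
  fixes \<Omega> K :: "(real ^ 'n::finite) set" and \<chi>\<^sub>0 :: "real ^ 'n \<Rightarrow> complex"
    and u :: "nat \<Rightarrow> real ^ 'n \<Rightarrow> complex" and \<tau> :: "nat \<Rightarrow> real" and \<kappa> b :: real
  assumes open_\<Omega>: "open \<Omega>" and K: "K \<in> regular_compacts \<Omega>" and \<chi>\<^sub>0: "\<chi>\<^sub>0 \<in> test_functions_on M \<Omega> K"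
    and u: "\<And>n. smooth_on \<Omega> (u n)" and \<tau>: "\<And>n. \<tau> n > 0" and \<kappa>: "\<kappa> > 0" and b: "b > 0"
    and regular: "\<And>h. h > 0 \<Longrightarrow> \<exists>C\<ge>0. \<forall>n. \<forall>x\<in>K. \<forall>\<alpha>. cmod (multi_deriv \<alpha> (u n) x)
      \<le> C * E (\<kappa> * \<tau> n) * h ^ (\<Sum>i\<in>UNIV. \<alpha> i) * M (\<Sum>i\<in>UNIV. \<alpha> i)"
    and weakly_small: "\<And>\<phi>. \<phi> \<in> test_functions_on M \<Omega> K \<Longrightarrow> \<exists>C. \<forall>n. cmod (pairing \<Omega> (u n) \<phi>) * E (b * \<tau> n) \<le> C"
begin

definition v :: "nat \<Rightarrow> real ^ 'n \<Rightarrow> complex" where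
  "v n x = \<chi>\<^sub>0 x * u n x"

definition ft :: "nat \<Rightarrow> real ^ 'n \<Rightarrow> complex" where
  "ft n \<xi> = (\<integral>x. v n x * wave \<xi> x \<partial>lborel)"

lemma compact_K: "compact K" and K_subset: "K \<subseteq> \<Omega>"
  using compact_regular_compacts[OF K] by auto

lemma smooth_\<chi>\<^sub>0: "smooth_on \<Omega> \<chi>\<^sub>0" and \<chi>\<^sub>0_outside: "x \<notin> K \<Longrightarrow> \<chi>\<^sub>0 x = 0"
  using \<chi>\<^sub>0 by (auto simp: test_functions_on_def ultra_diff_def)

lemma v_outside: "x \<notin> K \<Longrightarrow> v n x = 0"
  using \<chi>\<^sub>0_outside by (simp add: v_def)

lemma smooth_v: "smooth_on UNIV (v n)"
  and iter_partial_v_outside: "x \<notin> K \<Longrightarrow> iter_partial is (v n) x = 0"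
proof -
  have "smooth_on \<Omega> (v n)"
    unfolding v_def by (rule smooth_on_mult[OF open_\<Omega> smooth_\<chi>\<^sub>0 u])
  note ext = open_\<Omega> this compact_imp_closed[OF compact_K] K_subset v_outside
  show "smooth_on UNIV (v n)" "x \<notin> K \<Longrightarrow> iter_partial is (v n) x = 0"
    using smooth_on_extend[OF ext] iter_partial_outside[OF ext] by auto
qed

lemma continuous_v: "continuous_on UNIV (iter_partial is (v n))"
  by (rule smooth_on_continuous[OF smooth_v])

lemma integrable_v_mult: "continuous_on UNIV f \<Longrightarrow> integrable lborel (\<lambda>x. v n x * f x)"
  using continuous_v[of "[]" n]
  by (intro integrable_compact_support[OF _ compact_K] continuous_intros) (auto simp: v_outside)

text \<open>If \<open>W\<close> is a rapidly convergent series of plane waves, then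
  \<open>\<chi>\<^sub>0\<close> times \<open>W\<close> is a test function supported in
  \<open>K\<close>, and its pairing with \<open>u n\<close> is the series of the
  \<open>a j * ft n (\<xi> j)\<close>. Thus \<open>weakly_small\<close> supplies the hypothesis of
  the gliding hump for the transforms multiplied by \<open>E (b * \<tau> n)\<close>, and one
  \<open>l\<close> serves all \<open>n\<close>.\<close>

lemma ft_growth: "\<exists>l\<ge>0. \<exists>C. \<forall>n \<xi>. cmod (ft n \<xi>) * E (b * \<tau> n) \<le> C * E (l * maxnorm \<xi>)"
proof -
  define \<Lambda> where "\<Lambda> n \<xi> = of_real (E (b * \<tau> n)) * ft n \<xi>" for n \<xi>
  have "\<exists>l C. \<forall>n \<xi>. cmod (\<Lambda> n \<xi>) \<le> C * E (real l * maxnorm \<xi>)"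
  proof (rule uniform_bound_gliding_hump)
    show "1 \<le> E (real l * maxnorm \<xi>)" for l and \<xi> :: "real ^ 'n" by (intro E_ge_1 mult_nonneg_nonneg maxnorm_nonneg) simp
    show "E (real l * maxnorm \<xi>) \<le> E (real m * maxnorm \<xi>)" if "l \<le> m" for l m and \<xi> :: "real ^ 'n"
      using that by (intro E_mono mult_nonneg_nonneg mult_right_mono maxnorm_nonneg) auto
    show "\<exists>B. \<forall>\<xi>. cmod (\<Lambda> n \<xi>) \<le> B" for n
    proof (intro exI allI)
      fix \<xi>
      have "cmod (ft n \<xi>) \<le> (\<integral>x. cmod (v n x * wave \<xi> x) \<partial>lborel)"
        unfolding ft_def by (rule integral_norm_bound)
      then have "cmod (ft n \<xi>) \<le> (\<integral>x. cmod (v n x) \<partial>lborel)" by (simp add: norm_mult)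
      then show "cmod (\<Lambda> n \<xi>) \<le> E (b * \<tau> n) * (\<integral>x. cmod (v n x) \<partial>lborel)"
        using E_pos[of "b * \<tau> n"] by (simp add: \<Lambda>_def norm_mult)
    qed
    fix a :: "nat \<Rightarrow> real" and \<xi> :: "nat \<Rightarrow> real ^ 'n"
    assume summ: "\<And>l. summable (\<lambda>j. \<bar>a j\<bar> * E (real l * maxnorm (\<xi> j)))"
    \<comment> \<open>Since \<open>E 0 = 1\<close>, level 0 is plain absolute summability.\<close>
    have sa: "summable (\<lambda>j. \<bar>a j\<bar>)" using summ[of 0] by (simp add: weight_exp_def assoc_fun_def)
    define W where "W x = (\<Sum>j. a j * wave (\<xi> j) x)" for x
    have W: "ultra_bounded W" unfolding W_def by (rule trigonometric_series[OF summ])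
    have t: "(\<lambda>x. \<chi>\<^sub>0 x * W x) \<in> test_functions_on M \<Omega> K" by (rule test_function_mult[OF open_\<Omega> K \<chi>\<^sub>0 W])
    obtain C where C: "\<And>n. cmod (pairing \<Omega> (u n) (\<lambda>x. \<chi>\<^sub>0 x * W x)) * E (b * \<tau> n) \<le> C"
      using weakly_small[OF t] by blast
    have sum_ft: "pairing \<Omega> (u n) (\<lambda>x. \<chi>\<^sub>0 x * W x) = (\<Sum>j. a j * ft n (\<xi> j))" for n
    proof -
      have sw: "summable (\<lambda>j. complex_of_real (a j) * wave (\<xi> j) x)" for x
        by (rule summable_norm_cancel) (simp add: norm_mult sa)
      have "pairing \<Omega> (u n) (\<lambda>x. \<chi>\<^sub>0 x * W x) = (\<integral>x. \<chi>\<^sub>0 x * W x * u n x \<partial>lborel)"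
        by (rule pairing_test_function[OF K_subset]) (simp add: \<chi>\<^sub>0_outside)
      also have "\<dots> = (\<integral>x. (\<Sum>j. v n x * (a j * wave (\<xi> j) x)) \<partial>lborel)"
        unfolding W_def v_def suminf_mult[OF sw] by (simp add: mult_ac)
      also have "\<dots> = (\<Sum>j. \<integral>x. v n x * (a j * wave (\<xi> j) x) \<partial>lborel)"
      proof (rule integral_suminf)
        show "integrable lborel (\<lambda>x. v n x * (a j * wave (\<xi> j) x))" for j
          by (intro integrable_v_mult continuous_intros)
        show "AE x in lborel. summable (\<lambda>j. norm (v n x * (a j * wave (\<xi> j) x)))"
          by (simp add: norm_mult summable_mult sa)
        show "summable (\<lambda>j. \<integral>x. norm (v n x * (a j * wave (\<xi> j) x)) \<partial>lborel)"
          by (simp add: norm_mult summable_mult sa)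
      qed
      also have "\<dots> = (\<Sum>j. a j * ft n (\<xi> j))"
        unfolding ft_def integral_mult_right_zero[symmetric] by (simp add: mult_ac)
      finally show ?thesis .
    qed
    have "summable (\<lambda>j. a j * ft n (\<xi> j))" for n
    proof (rule summable_comparison_test')
      show "summable (\<lambda>j. \<bar>a j\<bar> * (\<integral>x. cmod (v n x) \<partial>lborel))" by (rule summable_mult2[OF sa])
      fix j :: nat assume "0 \<le> j"
      have "cmod (ft n (\<xi> j)) \<le> (\<integral>x. cmod (v n x * wave (\<xi> j) x) \<partial>lborel)"
        unfolding ft_def by (rule integral_norm_bound)
      then show "norm (a j * ft n (\<xi> j)) \<le> \<bar>a j\<bar> * (\<integral>x. cmod (v n x) \<partial>lborel)"
        by (simp add: norm_mult mult_left_mono)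
    qed
    then have "(\<Sum>j. a j * \<Lambda> n (\<xi> j)) = of_real (E (b * \<tau> n)) * (\<Sum>j. a j * ft n (\<xi> j))" for n
      unfolding \<Lambda>_def by (subst suminf_mult[symmetric]) (auto simp: mult_ac)
    then have "cmod (\<Sum>j. a j * \<Lambda> n (\<xi> j)) \<le> C" for n
      using C[of n] E_pos[of "b * \<tau> n"] unfolding sum_ft by (simp add: norm_mult mult.commute)
    then show "\<exists>C. \<forall>n. cmod (\<Sum>j. a j * \<Lambda> n (\<xi> j)) \<le> C" by blast
  qed
  then obtain l C where "\<And>n \<xi>. cmod (\<Lambda> n \<xi>) \<le> C * E (real l * maxnorm \<xi>)" by blast
  then have "\<forall>n \<xi>. cmod (ft n \<xi>) * E (b * \<tau> n) \<le> C * E (real l * maxnorm \<xi>)"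
    using E_pos by (simp add: \<Lambda>_def norm_mult mult.commute less_imp_le)
  then show ?thesis by (intro exI[of _ "real l"]) auto
qed

text \<open>Differentiating \<open>p\<close> times along the coordinate that attains
  \<open>maxnorm \<xi>\<close> multiplies the modulus of the transform by
  \<open>maxnorm \<xi> ^ p\<close>. Leibniz' rule with \<open>h / 2\<close> for each factor bounds
  the result for every \<open>p\<close>, and \<open>E_least\<close> combines these bounds.\<close>

lemma ft_decay:
  assumes "h > 0"
  shows "\<exists>C\<ge>0. \<forall>n \<xi>. cmod (ft n \<xi>) * E (maxnorm \<xi> / h) \<le> C * E (\<kappa> * \<tau> n)"
proof -
  have "h / 2 > 0" using assms by simp
  obtain A where A: "A \<ge> 0" "\<And>x \<alpha>. cmod (multi_deriv \<alpha> \<chi>\<^sub>0 x) \<le> A * (h / 2) ^ (\<Sum>i\<in>UNIV. \<alpha> i) * M (\<Sum>i\<in>UNIV. \<alpha> i)"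
    using test_functions_ultra_bounded[OF open_\<Omega> K \<chi>\<^sub>0] \<open>h / 2 > 0\<close> unfolding ultra_bounded_def by blast
  obtain B where B: "B \<ge> 0" "\<And>n x \<alpha>. x \<in> K \<Longrightarrow> cmod (multi_deriv \<alpha> (u n) x)
      \<le> B * E (\<kappa> * \<tau> n) * (h / 2) ^ (\<Sum>i\<in>UNIV. \<alpha> i) * M (\<Sum>i\<in>UNIV. \<alpha> i)"
    using regular[OF \<open>h / 2 > 0\<close>] by blast
  define V where "V = measure lborel K"
  have "cmod (ft n \<xi>) * E (maxnorm \<xi> / h) \<le> (V * A * B) * E (\<kappa> * \<tau> n)" for n \<xi>
  proof (rule E_least)
    fix p
    obtain i where i: "maxnorm \<xi> = \<bar>\<xi> $ i\<bar>" using maxnorm_attained by blast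
    obtain \<alpha> where \<alpha>: "replicate p i = midx \<alpha>" using replicate_is_midx by blast
    then have p: "(\<Sum>i\<in>UNIV. \<alpha> i) = p" by (metis length_midx length_replicate)
    define c where "c = A * (B * E (\<kappa> * \<tau> n)) * h ^ p * M p"
    have bound: "cmod (iter_partial (replicate p i) (v n) x) \<le> c" if "x \<in> K" for x
      using multi_deriv_mult_bound[OF open_\<Omega> smooth_\<chi>\<^sub>0 u _ A(1) _ _ _ A(2) B(2)[OF that], where \<alpha>=\<alpha>] that K_subset B(1) assms E_pos[of "\<kappa> * \<tau> n"]
      unfolding p c_def v_def[abs_def] \<alpha> multi_deriv_midx by (auto simp: less_imp_le)
    have "maxnorm \<xi> ^ p * cmod (ft n \<xi>) = cmod ((\<Prod>k\<leftarrow>replicate p i. - (\<i> * \<xi> $ k)) * ft n \<xi>)"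
      by (simp add: norm_mult norm_power i)
    also have "\<dots> = cmod (\<integral>x. iter_partial (replicate p i) (v n) x * wave \<xi> x \<partial>lborel)"
      unfolding ft_def by (subst fourier_iter_partial[OF smooth_v compact_K v_outside]) auto
    also have "\<dots> \<le> (\<integral>x. cmod (iter_partial (replicate p i) (v n) x * wave \<xi> x) \<partial>lborel)"
      by (rule integral_norm_bound)
    also have "\<dots> \<le> (\<integral>x. indicator K x * c \<partial>lborel)"
    proof (rule Bochner_Integration.integral_mono)
      show "integrable lborel (\<lambda>x. cmod (iter_partial (replicate p i) (v n) x * wave \<xi> x))"
        by (intro integrable_norm integrable_compact_support[OF _ compact_K] continuous_intros continuous_v)
          (simp add: iter_partial_v_outside)
      show "integrable lborel (\<lambda>x. indicator K x * c)"
        using borel_integrable_compact[OF compact_K, of "\<lambda>_. c"] by simp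
      show "norm (iter_partial (replicate p i) (v n) x * wave \<xi> x) \<le> indicator K x * c" for x
        using bound[of x] iter_partial_v_outside[of x "replicate p i" n] by (cases "x \<in> K") (auto simp: norm_mult)
    qed
    also have "\<dots> = V * c"
      using compact_K by (simp add: V_def borel_compact)
    finally have "maxnorm \<xi> ^ p * cmod (ft n \<xi>) \<le> V * c" .
    then show "cmod (ft n \<xi>) * (maxnorm \<xi> / h) ^ p \<le> V * A * B * E (\<kappa> * \<tau> n) * M p"
      using assms by (simp add: c_def power_divide field_simps)
  qed (use assms in \<open>auto intro!: divide_nonneg_pos maxnorm_nonneg\<close>)
  moreover have "V * A * B \<ge> 0" using A B by (simp add: V_def)
  ultimately show ?thesis by blast
qed

text \<open>In each regime there is an argument \<rho> at which the known bound reads: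
  \<open>cmod (ft n \<xi>) * E (H * \<rho>)\<close> is at most a constant times
  \<open>E \<rho>\<close>. The surplus dilation \<open>H\<close> pays for the remaining factors by
  \<open>E_fourth\<close>.\<close>

lemma ft_estimate:
  assumes "L \<ge> 0"
  shows "\<exists>C\<ge>0. \<forall>n \<xi>. cmod (ft n \<xi>) * \<tau> n * E (L * maxnorm \<xi>) \<le> C * decay \<xi>"
proof -
  obtain l C1 where l: "l \<ge> 0" "\<And>n \<xi>. cmod (ft n \<xi>) * E (b * \<tau> n) \<le> C1 * E (l * maxnorm \<xi>)"
    using ft_growth by blast
  have C1: "C1 \<ge> 0"
  proof -
    have "0 \<le> C1 * E (l * maxnorm (0 :: real ^ 'n))"
      by (rule order_trans[OF _ l(2)[of 0 0]]) (simp add: E_pos less_imp_le)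
    then show ?thesis using E_pos[of "l * maxnorm (0 :: real ^ 'n)"] by (simp add: zero_le_mult_iff)
  qed
  obtain c H where H: "c \<ge> 1" "H \<ge> 1" "\<And>\<rho>. \<rho> \<ge> 0 \<Longrightarrow> E \<rho> ^ 4 \<le> c * E (H * \<rho>)" using E_fourth by blast
  obtain D where D: "D \<ge> 0" "\<And>\<xi> :: real ^ 'n. 1 \<le> D * E (maxnorm \<xi>) * decay \<xi>" using inverse_decay_le by blast
  \<comment> \<open>Chosen so that \<open>H * \<rho> = b * \<tau> n\<close> means
    \<open>\<rho> = (l + L + 1) * (s * \<tau> n)\<close>. Where |\<xi>| is at most
    \<open>s * \<tau> n\<close>, this \<rho> dominates |\<xi>| and its multiples by \<open>l\<close>
    and \<open>L\<close>.\<close>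
  define s where "s = b / (H * (l + L + 1))"
  have s: "s > 0" using b H l(1) assms by (simp add: s_def)
  \<comment> \<open>In the other regime \<rho> is \<open>\<sigma> * maxnorm \<xi>\<close>. The
    summand \<open>\<kappa> / s\<close> makes it at least \<open>\<kappa> * \<tau> n\<close>, the
    argument on the right of \<open>ft_decay\<close>.\<close>
  define \<sigma> where "\<sigma> = \<kappa> / s + L + 1"
  have \<sigma>: "\<sigma> > 0" "\<sigma> \<ge> L" "\<sigma> \<ge> 1" "\<sigma> \<ge> \<kappa> / s" using \<kappa> s assms by (auto simp: \<sigma>_def add_nonneg_pos)
  \<comment> \<open>Here the freedom of \<open>h\<close> is used:
    \<open>1 / h = H * \<sigma>\<close> turns the gain into \<open>E (H * \<rho>)\<close>, although
    \<open>\<sigma>\<close> depends on \<open>\<kappa>\<close> and on the constants \<open>l\<close>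
    and \<open>b\<close> of the first regime.\<close>
  obtain C2 where C2: "C2 \<ge> 0" "\<And>n \<xi>. cmod (ft n \<xi>) * E (maxnorm \<xi> / (1 / (H * \<sigma>))) \<le> C2 * E (\<kappa> * \<tau> n)"
    using ft_decay[of "1 / (H * \<sigma>)"] H \<sigma> by auto
  define C where "C = (C1 + C2) * (M 1 / s) * c * D"
  have C0: "C \<ge> 0" using C1 C2 s H D M_pos[of 1] by (simp add: C_def)
  have mult4: "p * q * r * t \<le> p' * q' * r' * t'"
    if "p \<le> p'" "q \<le> q'" "r \<le> r'" "t \<le> t'" "0 \<le> p" "0 \<le> q" "0 \<le> r" "0 \<le> t" for p q r t p' q' r' t' :: real
    using that by (intro mult_mono mult_nonneg_nonneg) auto
  \<comment> \<open>In both regimes all factors are dominated by powers of \<open>E\<close> at one common argument.\<close>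
  have key: "cmod (ft n \<xi>) * \<tau> n * E (L * maxnorm \<xi>) \<le> C * decay \<xi>"
    if \<rho>: "\<rho> \<ge> 0" and ft: "cmod (ft n \<xi>) * E (H * \<rho>) \<le> (C1 + C2) * E \<rho>"
      and arg: "s * \<tau> n \<le> \<rho>" "L * maxnorm \<xi> \<le> \<rho>" "maxnorm \<xi> \<le> \<rho>" for n \<xi> \<rho>
  proof -
    have m0: "maxnorm \<xi> \<ge> 0" by (rule maxnorm_nonneg)
    have "s * \<tau> n \<le> M 1 * E (s * \<tau> n)" using power_le_E[of "s * \<tau> n" 1] s \<tau>[of n] by simp
    also have "\<dots> \<le> M 1 * E \<rho>" using s \<tau>[of n] M_pos[of 1] arg by (intro mult_left_mono E_mono) auto
    finally have t: "\<tau> n \<le> (M 1 / s) * E \<rho>" using s by (simp add: field_simps)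
    have EL: "E (L * maxnorm \<xi>) \<le> E \<rho>" using assms m0 arg by (intro E_mono) auto
    have "1 \<le> D * E (maxnorm \<xi>) * decay \<xi>" by (rule D(2))
    also have "\<dots> \<le> D * E \<rho> * decay \<xi>"
      using D(1) m0 arg decay_pos[of \<xi>] by (intro mult_right_mono mult_left_mono E_mono) auto
    finally have dc: "1 \<le> D * E \<rho> * decay \<xi>" .
    \<comment> \<open>The claim is multiplied by \<open>E (H * \<rho>)\<close>, which cancels at the
      end. Each of the four factors costs one \<open>E \<rho>\<close>; the fourth is the number 1,
      replaced by its bound \<open>dc\<close> so that \<open>decay \<xi>\<close> appears.\<close>
    have "cmod (ft n \<xi>) * \<tau> n * E (L * maxnorm \<xi>) * E (H * \<rho>)
      = (cmod (ft n \<xi>) * E (H * \<rho>)) * \<tau> n * E (L * maxnorm \<xi>) * 1" by (simp add: mult_ac)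
    also have "\<dots> \<le> ((C1 + C2) * E \<rho>) * ((M 1 / s) * E \<rho>) * E \<rho> * (D * E \<rho> * decay \<xi>)"
      by (rule mult4[OF ft t EL dc]) (use E_pos \<tau>[of n] in \<open>auto simp: less_imp_le\<close>)
    also have "\<dots> = ((C1 + C2) * (M 1 / s) * D * decay \<xi>) * E \<rho> ^ 4" by (simp add: power4_eq_xxxx mult_ac)
    also have "\<dots> \<le> ((C1 + C2) * (M 1 / s) * D * decay \<xi>) * (c * E (H * \<rho>))"
      using C1 C2 s D M_pos[of 1] decay_pos[of \<xi>] by (intro mult_left_mono H(3) \<rho>) auto
    also have "\<dots> = C * decay \<xi> * E (H * \<rho>)" by (simp add: C_def mult_ac)
    finally show ?thesis using E_pos[of "H * \<rho>"] by simp
  qed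
  have "cmod (ft n \<xi>) * \<tau> n * E (L * maxnorm \<xi>) \<le> C * decay \<xi>" for n \<xi>
  proof (cases "maxnorm \<xi> \<le> s * \<tau> n")
    case True
    define \<rho> where "\<rho> = b / H * \<tau> n"
    have m0: "maxnorm \<xi> \<ge> 0" by (rule maxnorm_nonneg)
    have "q * (b / (H * q) * \<tau> n) = b / H * \<tau> n" if "q > 0" for q using that by simp
    from this[of "l + L + 1"] have \<rho>: "\<rho> = (l + L + 1) * (s * \<tau> n)" using l(1) assms by (simp only: \<rho>_def s_def)
    have st: "s * \<tau> n \<ge> 0" using s \<tau>[of n] by simp
    have le: "x * maxnorm \<xi> \<le> \<rho>" if "0 \<le> x" "x \<le> l + L + 1" for x
      unfolding \<rho> using True m0 that by (intro mult_mono) auto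
    have "cmod (ft n \<xi>) * E (b * \<tau> n) \<le> C1 * E (l * maxnorm \<xi>)" by (rule l(2))
    also have "\<dots> \<le> C1 * E \<rho>" using C1 l(1) m0 le[of l] assms by (intro mult_left_mono E_mono) auto
    also have "\<dots> \<le> (C1 + C2) * E \<rho>" using C2(1) E_pos[of \<rho>] by (intro mult_right_mono) auto
    finally have "cmod (ft n \<xi>) * E (H * \<rho>) \<le> (C1 + C2) * E \<rho>" using H by (simp add: \<rho>_def)
    moreover have "s * \<tau> n \<le> \<rho>" unfolding \<rho> using mult_right_mono[OF _ st, of 1 "l + L + 1"] l(1) assms by simp
    moreover have "\<rho> \<ge> 0" using b H \<tau>[of n] by (simp add: \<rho>_def)
    ultimately show ?thesis using key le[of L] le[of 1] l(1) assms by simp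
  next
    case False
    define \<rho> where "\<rho> = \<sigma> * maxnorm \<xi>"
    have m0: "maxnorm \<xi> \<ge> 0" by (rule maxnorm_nonneg)
    have le: "x * maxnorm \<xi> \<le> \<rho>" if "x \<le> \<sigma>" for x
      unfolding \<rho>_def using m0 that by (intro mult_right_mono) auto
    have "\<kappa> * \<tau> n = (\<kappa> / s) * (s * \<tau> n)" using s by simp
    also have "\<dots> \<le> (\<kappa> / s) * maxnorm \<xi>" using False \<kappa> s by (intro mult_left_mono) auto
    also have "\<dots> \<le> \<rho>" by (rule le[OF \<sigma>(4)])
    finally have kt: "\<kappa> * \<tau> n \<le> \<rho>" .
    have "cmod (ft n \<xi>) * E (H * \<rho>) \<le> C2 * E (\<kappa> * \<tau> n)" using C2(2)[of n \<xi>] by (simp add: \<rho>_def mult_ac)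
    also have "\<dots> \<le> C2 * E \<rho>" using C2(1) kt \<kappa> \<tau>[of n] by (intro mult_left_mono E_mono) auto
    also have "\<dots> \<le> (C1 + C2) * E \<rho>" using C1 E_pos[of \<rho>] by (intro mult_right_mono) auto
    finally have "cmod (ft n \<xi>) * E (H * \<rho>) \<le> (C1 + C2) * E \<rho>" .
    moreover have "s * \<tau> n \<le> \<rho>" using False le[of 1] \<sigma>(3) by simp
    moreover have "\<rho> \<ge> 0" using \<sigma> m0 by (simp add: \<rho>_def)
    ultimately show ?thesis using key le[OF \<sigma>(2)] le[of 1] \<sigma>(3) by simp
  qed
  then show ?thesis using C0 by blast
qed

text \<open>With \<open>L = 1 / h\<close> the weight in \<open>ft_estimate\<close> pays for the
  powers of |\<xi>| that the derivatives produce, and what is left is integrable in \<xi>. The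
  factor \<open>1 / \<tau> n\<close> will make the differences summable.\<close>

lemma strongly_small:
  assumes "h > 0"
  shows "\<exists>C\<ge>0. \<forall>n is x. cmod (iter_partial is (v n) x) \<le> C / \<tau> n * h ^ length is * M (length is)"
proof -
  obtain C where C: "C \<ge> 0" "\<And>n \<xi>. cmod (ft n \<xi>) * \<tau> n * E (1 / h * maxnorm \<xi>) \<le> C * decay \<xi>"
    using ft_estimate[of "1 / h"] assms by auto
  define D where "D = (\<integral>\<xi>. decay (\<xi> :: real ^ 'n) \<partial>lborel)"
  have D: "D \<ge> 0" unfolding D_def by (intro Bochner_Integration.integral_nonneg) (simp add: less_imp_le[OF decay_pos])
  have "cmod (iter_partial is (v n) x) \<le> (C / \<tau> n * h ^ length is * M (length is)) * D" for n "is" x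
    unfolding D_def
  proof (rule sup_le_fourier_decay[OF continuous_v compact_K iter_partial_v_outside])
    fix \<xi> :: "real ^ 'n"
    let ?p = "length is" and ?m = "maxnorm \<xi>"
    have "cmod (\<integral>x. iter_partial is (v n) x * wave \<xi> x \<partial>lborel) = cmod (\<Prod>k\<leftarrow>is. \<i> * \<xi> $ k) * cmod (ft n \<xi>)"
      unfolding ft_def by (subst fourier_iter_partial[OF smooth_v compact_K v_outside])
        (auto simp: norm_mult norm_prod_list_uminus)
    also have "\<dots> \<le> ?m ^ ?p * cmod (ft n \<xi>)" by (intro mult_right_mono prod_list_le_maxnorm) auto
    also have "\<dots> = h ^ ?p * (1 / h * ?m) ^ ?p * cmod (ft n \<xi>)" using assms by (simp add: power_divide)
    also have "\<dots> \<le> h ^ ?p * (M ?p * E (1 / h * ?m)) * cmod (ft n \<xi>)"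
      using assms maxnorm_nonneg[of \<xi>] by (intro mult_right_mono mult_left_mono power_le_E) auto
    also have "\<dots> = h ^ ?p * M ?p / \<tau> n * (cmod (ft n \<xi>) * \<tau> n * E (1 / h * ?m))"
      using \<tau>[of n] by (simp add: field_simps)
    also have "\<dots> \<le> h ^ ?p * M ?p / \<tau> n * (C * decay \<xi>)"
      using assms M_pos[of ?p] \<tau>[of n] by (intro mult_left_mono C(2)) auto
    finally show "cmod (\<integral>x. iter_partial is (v n) x * wave \<xi> x \<partial>lborel) \<le> C / \<tau> n * h ^ ?p * M ?p * decay \<xi>"
      by (simp add: mult_ac)
  qed auto
  then show ?thesis using C(1) D by (intro exI[of _ "C * D"]) (auto simp: mult_ac)
qed

end

section \<open>Convergence of regular nets\<close>

context weight begin

section \<open>Pairings with test functions\<close>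

lemma integrable_mult_test_function:
  assumes "open \<Omega>" "K \<in> regular_compacts \<Omega>" "\<phi> \<in> test_functions_on M \<Omega> K" "smooth_on \<Omega> w"
  shows "integrable lborel (\<lambda>x. \<phi> x * w x)"
proof -
  have K: "compact K" "K \<subseteq> \<Omega>" using compact_regular_compacts assms(2) by blast+
  have \<phi>: "smooth_on \<Omega> \<phi>" "\<And>x. x \<notin> K \<Longrightarrow> \<phi> x * w x = 0"
    using assms(3) by (auto simp: test_functions_on_def ultra_diff_def)
  have "smooth_on UNIV (\<lambda>x. \<phi> x * w x)"
    by (rule smooth_on_extend[OF assms(1) smooth_on_mult[OF assms(1) \<phi>(1) assms(4)] compact_imp_closed[OF K(1)] K(2) \<phi>(2)])
  then show ?thesis
    using integrable_compact_support[OF _ K(1) \<phi>(2)] smooth_on_continuous[of UNIV _ "[]"] by force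
qed

lemma integrable_test_function:
  assumes "open \<Omega>" "K \<in> regular_compacts \<Omega>" "\<phi> \<in> test_functions_on M \<Omega> K"
  shows "integrable lborel \<phi>"
proof -
  have "smooth_on \<Omega> (\<lambda>_. 1)"
    by (rule smooth_on_family[of \<Omega> "\<lambda>is _. if is = [] then 1 else 0"])
      (auto simp: assms(1) gradient_map_def[abs_def])
  from integrable_mult_test_function[OF assms this] show ?thesis by simp
qed

lemma pairing_test_functions_on:
  assumes "K \<in> regular_compacts \<Omega>" "\<phi> \<in> test_functions_on M \<Omega> K"
  shows "pairing \<Omega> w \<phi> = (\<integral>x. \<phi> x * w x \<partial>lborel)"
  using assms compact_regular_compacts[OF assms(1)]
  by (intro pairing_test_function[of K]) (auto simp: test_functions_on_def)

lemma pairing_diff: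
  assumes "open \<Omega>" "K \<in> regular_compacts \<Omega>" "\<phi> \<in> test_functions_on M \<Omega> K" "smooth_on \<Omega> w" "smooth_on \<Omega> w'"
  shows "pairing \<Omega> (\<lambda>x. w x - w' x) \<phi> = pairing \<Omega> w \<phi> - pairing \<Omega> w' \<phi>"
  using integrable_mult_test_function[OF assms(1-3)] assms(4,5)
  by (simp add: pairing_test_functions_on[OF assms(2,3)] right_diff_distrib)

lemma pairing_bound:
  assumes "open \<Omega>" "K \<in> regular_compacts \<Omega>" "\<phi> \<in> test_functions_on M \<Omega> K"
    and "\<And>x. x \<in> K \<Longrightarrow> cmod (w x) \<le> c"
  shows "cmod (pairing \<Omega> w \<phi>) \<le> c * (\<integral>x. cmod (\<phi> x) \<partial>lborel)"
proof -
  have z: "x \<notin> K \<Longrightarrow> \<phi> x = 0" for x using assms(3) by (auto simp: test_functions_on_def)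
  have "cmod (pairing \<Omega> w \<phi>) \<le> (\<integral>x. cmod (\<phi> x * w x) \<partial>lborel)"
    unfolding pairing_test_functions_on[OF assms(2,3)] by (rule integral_norm_bound)
  also have "\<dots> \<le> (\<integral>x. c * cmod (\<phi> x) \<partial>lborel)"
  proof (rule integral_mono')
    show "integrable lborel (\<lambda>x. c * cmod (\<phi> x))"
      by (intro integrable_mult_right integrable_norm integrable_test_function[OF assms(1-3)])
    have *: "cmod (\<phi> x * w x) \<le> c * cmod (\<phi> x)" for x
      using assms(4)[of x] z[of x] by (cases "x \<in> K") (auto simp: norm_mult mult.commute[of "cmod (\<phi> x)"] intro: mult_right_mono)
    then show "cmod (\<phi> x * w x) \<le> c * cmod (\<phi> x)" for x .
    show "0 \<le> c * cmod (\<phi> x)" for x using order_trans[OF norm_ge_zero *] .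
  qed
  finally show ?thesis by simp
qed

lemma midx_0: "midx (\<lambda>_. 0) = []"
  by (metis length_0_conv length_midx sum.neutral_const)

text \<open>The sequence telescopes into the differences \<open>u n\<close>, in which
  \<open>T\<close> cancels. They are estimated near each point, then on compact sets by a finite
  cover; the limit inherits the bounds, and dominated convergence identifies it with
  \<open>T\<close>.\<close>

lemma converging_net:
  fixes g :: "nat \<Rightarrow> real ^ 'n::finite \<Rightarrow> complex"
  defines "\<tau> \<equiv> \<lambda>n. 2 ^ Suc n :: real"
  assumes \<Omega>: "open \<Omega>" and nontrivial: "\<phi>\<^sub>0 \<in> test_functions M \<Omega>" "\<phi>\<^sub>0 z \<noteq> 0"
    and g: "\<And>n. g n \<in> ultra_diff M \<Omega>"
    and regular: "\<And>K. K \<in> regular_compacts \<Omega> \<Longrightarrow> \<exists>k>0. \<forall>h>0. \<exists>C\<ge>0. \<forall>n. \<forall>x\<in>K. \<forall>\<alpha>.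
      cmod (multi_deriv \<alpha> (g n) x) \<le> C * E (k * \<tau> n) * h ^ (\<Sum>i\<in>UNIV. \<alpha> i) * M (\<Sum>i\<in>UNIV. \<alpha> i)"
    and assoc: "\<And>K. K \<in> regular_compacts \<Omega> \<Longrightarrow> \<exists>b>0. \<forall>\<phi>\<in>test_functions_on M \<Omega> K. \<exists>C. \<forall>n.
      cmod (pairing \<Omega> (g n) \<phi> - T \<phi>) * E (b * \<tau> n) \<le> C"
  shows "\<exists>f\<in>ultra_diff M \<Omega>. \<forall>\<phi>\<in>test_functions M \<Omega>. T \<phi> = pairing \<Omega> f \<phi>"
proof -
  define u where "u n x = g (Suc n) x - g n x" for n x
  have \<tau>: "\<tau> n > 0" "\<tau> (Suc n) = 2 * \<tau> n" for n by (auto simp: \<tau>_def)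
  have smg: "smooth_on \<Omega> (g n)" for n using g by (auto simp: ultra_diff_def)
  have smu: "smooth_on \<Omega> (u n)" for n unfolding u_def by (rule smooth_on_diff[OF \<Omega> smg smg])
  have itu: "iter_partial is (u n) x = iter_partial is (g (Suc n)) x - iter_partial is (g n) x" if "x \<in> \<Omega>" for "is" n x
    unfolding u_def by (rule iter_partial_diff[OF \<Omega> smg smg that])
  \<comment> \<open>\<open>k\<close> and \<open>b\<close> depend on the compact set, so one cutoff
    is fixed at a time; where it equals 1, the functions \<open>v n\<close> and \<open>u n\<close>
    have the same derivatives.\<close>
  have local: "\<exists>r>0. ball x\<^sub>0 r \<subseteq> \<Omega> \<and> (\<forall>h>0. \<exists>C\<ge>0. \<forall>n is. \<forall>x\<in>ball x\<^sub>0 r.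
      cmod (iter_partial is (u n) x) \<le> C / \<tau> n * h ^ length is * M (length is))" if "x\<^sub>0 \<in> \<Omega>" for x\<^sub>0
  proof -
    obtain K \<eta> r where \<eta>: "r > 0" "K \<in> regular_compacts \<Omega>" "\<eta> \<in> test_functions_on M \<Omega> K"
      "\<And>x. x \<in> ball x\<^sub>0 r \<Longrightarrow> \<eta> x = 1"
      using bump_function[OF \<Omega> nontrivial \<open>x\<^sub>0 \<in> \<Omega>\<close>] by blast
    obtain r' where r': "r' > 0" "ball x\<^sub>0 r' \<subseteq> \<Omega>" using \<Omega> \<open>x\<^sub>0 \<in> \<Omega>\<close> open_contains_ball by blast
    obtain k where k: "k > 0" "\<And>h. h > 0 \<Longrightarrow> \<exists>C\<ge>0. \<forall>n. \<forall>x\<in>K. \<forall>\<alpha>.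
      cmod (multi_deriv \<alpha> (g n) x) \<le> C * E (k * \<tau> n) * h ^ (\<Sum>i\<in>UNIV. \<alpha> i) * M (\<Sum>i\<in>UNIV. \<alpha> i)"
      using regular[OF \<eta>(2)] by blast
    obtain b where b: "b > 0" "\<And>\<phi>. \<phi> \<in> test_functions_on M \<Omega> K \<Longrightarrow> \<exists>C. \<forall>n.
      cmod (pairing \<Omega> (g n) \<phi> - T \<phi>) * E (b * \<tau> n) \<le> C"
      using assoc[OF \<eta>(2)] by blast
    have K: "K \<subseteq> \<Omega>" using compact_regular_compacts[OF \<eta>(2)] by blast
    \<comment> \<open>\<open>\<tau>\<close> doubles from one index to the next, so the later of the
      two members is bounded with \<open>2 * k\<close> at \<open>\<tau> n\<close>; this becomes
      \<open>\<kappa>\<close> in the locale.\<close>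
    have reg_u: "\<exists>C\<ge>0. \<forall>n. \<forall>x\<in>K. \<forall>\<alpha>. cmod (multi_deriv \<alpha> (u n) x)
      \<le> C * E (2 * k * \<tau> n) * h ^ (\<Sum>i\<in>UNIV. \<alpha> i) * M (\<Sum>i\<in>UNIV. \<alpha> i)" if h: "h > 0" for h
    proof -
      obtain C where C: "C \<ge> 0" "\<And>n x \<alpha>. x \<in> K \<Longrightarrow>
        cmod (multi_deriv \<alpha> (g n) x) \<le> C * E (k * \<tau> n) * h ^ (\<Sum>i\<in>UNIV. \<alpha> i) * M (\<Sum>i\<in>UNIV. \<alpha> i)"
        using k(2)[OF h] by blast
      have "cmod (multi_deriv \<alpha> (u n) x) \<le> (2 * C) * E (2 * k * \<tau> n) * h ^ (\<Sum>i\<in>UNIV. \<alpha> i) * M (\<Sum>i\<in>UNIV. \<alpha> i)"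
        if "x \<in> K" for n x \<alpha>
      proof -
        let ?p = "\<Sum>i\<in>UNIV. \<alpha> i"
        have "x \<in> \<Omega>" using K that by blast
        have "cmod (multi_deriv \<alpha> (u n) x) \<le> cmod (multi_deriv \<alpha> (g (Suc n)) x) + cmod (multi_deriv \<alpha> (g n) x)"
          unfolding multi_deriv_midx itu[OF \<open>x \<in> \<Omega>\<close>] by (rule norm_triangle_ineq4)
        also have "\<dots> \<le> C * E (2 * k * \<tau> n) * h ^ ?p * M ?p + C * E (2 * k * \<tau> n) * h ^ ?p * M ?p"
        proof (rule add_mono)
          show "cmod (multi_deriv \<alpha> (g (Suc n)) x) \<le> C * E (2 * k * \<tau> n) * h ^ ?p * M ?p"
            using C(2)[OF that, of \<alpha> "Suc n"] by (simp add: \<tau>(2) mult_ac)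
          have "C * E (k * \<tau> n) * h ^ ?p * M ?p \<le> C * E (2 * k * \<tau> n) * h ^ ?p * M ?p"
            using C(1) \<open>h > 0\<close> M_pos[of ?p] k(1) \<tau>(1)[of n] by (intro mult_right_mono mult_left_mono E_mono) auto
          then show "cmod (multi_deriv \<alpha> (g n) x) \<le> C * E (2 * k * \<tau> n) * h ^ ?p * M ?p"
            using C(2)[OF that, of \<alpha> n] by linarith
        qed
        finally show ?thesis by (simp add: mult_ac)
      qed
      then show ?thesis using C(1) by (intro exI[of _ "2 * C"]) auto
    qed
    have weak_u: "\<exists>C. \<forall>n. cmod (pairing \<Omega> (u n) \<phi>) * E (b * \<tau> n) \<le> C" if \<phi>: "\<phi> \<in> test_functions_on M \<Omega> K" for \<phi>
    proof -
      obtain C where C: "\<And>n. cmod (pairing \<Omega> (g n) \<phi> - T \<phi>) * E (b * \<tau> n) \<le> C" using b(2)[OF \<phi>] by blast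
      have "cmod (pairing \<Omega> (u n) \<phi>) * E (b * \<tau> n) \<le> C + C" for n
      proof -
        have "cmod (pairing \<Omega> (u n) \<phi>) \<le> cmod (pairing \<Omega> (g (Suc n)) \<phi> - T \<phi>) + cmod (pairing \<Omega> (g n) \<phi> - T \<phi>)"
          unfolding u_def pairing_diff[OF \<Omega> \<eta>(2) \<phi> smg smg]
          using norm_triangle_ineq4[of "pairing \<Omega> (g (Suc n)) \<phi> - T \<phi>" "pairing \<Omega> (g n) \<phi> - T \<phi>"] by simp
        then have "cmod (pairing \<Omega> (u n) \<phi>) * E (b * \<tau> n)
          \<le> cmod (pairing \<Omega> (g (Suc n)) \<phi> - T \<phi>) * E (b * \<tau> n) + cmod (pairing \<Omega> (g n) \<phi> - T \<phi>) * E (b * \<tau> n)"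
          using mult_right_mono[OF _ less_imp_le[OF E_pos]] by (simp add: distrib_right[symmetric])
        \<comment> \<open>The weight is enlarged to the one at \<open>Suc n\<close>, for which the
          association bound of the later member is stated.\<close>
        moreover have "cmod (pairing \<Omega> (g (Suc n)) \<phi> - T \<phi>) * E (b * \<tau> n) \<le> cmod (pairing \<Omega> (g (Suc n)) \<phi> - T \<phi>) * E (b * \<tau> (Suc n))"
          using b(1) \<tau>(1)[of n] by (intro mult_left_mono E_mono) (auto simp: \<tau>(2))
        ultimately show ?thesis using C[of n] C[of "Suc n"] by linarith
      qed
      then show ?thesis by blast
    qed
    interpret interpolation M \<Omega> K \<eta> u \<tau> "2 * k" b
      using \<Omega> \<eta>(2,3) smu \<tau>(1) k(1) b(1) reg_u weak_u by unfold_locales auto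
    define R where "R = min r r'"
    have R: "R > 0" "ball x\<^sub>0 R \<subseteq> \<Omega>" "ball x\<^sub>0 R \<subseteq> ball x\<^sub>0 r"
      using \<eta>(1) r' subset_ball[of R r' x\<^sub>0] subset_ball[of R r x\<^sub>0] by (auto simp: R_def)
    have eq: "iter_partial is (v n) x = iter_partial is (u n) x" if "x \<in> ball x\<^sub>0 R" for n "is" x
      by (rule iter_partial_cong[OF open_ball that]) (use \<eta>(4) R(3) in \<open>auto simp: v_def\<close>)
    show ?thesis
      using R(1,2) strongly_small eq by (intro exI[of _ R]) metis
  qed
  have on_compact: "\<exists>C\<ge>0. \<forall>n is. \<forall>x\<in>K. cmod (iter_partial is (u n) x) \<le> C / \<tau> n * h ^ length is * M (length is)"
    if K: "compact K" "K \<subseteq> \<Omega>" and h: "h > 0" for K h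
  proof -
    obtain r where r: "\<And>x. x \<in> \<Omega> \<Longrightarrow> r x > 0"
      "\<And>x. x \<in> \<Omega> \<Longrightarrow> \<exists>C\<ge>0. \<forall>n is. \<forall>y\<in>ball x (r x). cmod (iter_partial is (u n) y) \<le> C / \<tau> n * h ^ length is * M (length is)"
      using local h by metis
    obtain C where C: "\<And>x. x \<in> \<Omega> \<Longrightarrow> C x \<ge> 0"
      "\<And>x n is y. x \<in> \<Omega> \<Longrightarrow> y \<in> ball x (r x) \<Longrightarrow> cmod (iter_partial is (u n) y) \<le> C x / \<tau> n * h ^ length is * M (length is)"
      using r(2) by metis
    have "K \<subseteq> (\<Union>x\<in>K. ball x (r x))" using r(1) K(2) by force
    then obtain F where F: "F \<subseteq> K" "finite F" "K \<subseteq> (\<Union>x\<in>F. ball x (r x))"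
      using compactE_image[OF K(1), of K "\<lambda>x. ball x (r x)"] by (metis open_ball)
    have FO: "F \<subseteq> \<Omega>" using F(1) K(2) by blast
    have "cmod (iter_partial is (u n) y) \<le> (\<Sum>x\<in>F. C x) / \<tau> n * h ^ length is * M (length is)" if y: "y \<in> K" for n "is" y
    proof -
      obtain x where x: "x \<in> F" "y \<in> ball x (r x)" using F(3) y by blast
      have "C x \<le> (\<Sum>x\<in>F. C x)" by (rule member_le_sum[OF x(1)]) (use F(2) C(1) FO in auto)
      then have "C x / \<tau> n * h ^ length is * M (length is) \<le> (\<Sum>x\<in>F. C x) / \<tau> n * h ^ length is * M (length is)"
        using h M_pos[of "length is"] \<tau>(1)[of n] by (intro mult_right_mono divide_right_mono) auto
      moreover have "x \<in> \<Omega>" using x(1) FO by blast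
      ultimately show ?thesis using C(2)[OF \<open>x \<in> \<Omega>\<close> x(2), of "is" n] by linarith
    qed
    moreover have "(\<Sum>x\<in>F. C x) \<ge> 0" by (rule sum_nonneg) (use C(1) FO in auto)
    ultimately show ?thesis by blast
  qed
  \<comment> \<open>The reciprocals of \<open>2 ^ Suc n\<close> sum to 1, so terms bounded by
    \<open>c / \<tau> n\<close> have all partial sums and the limit bounded by
    \<open>c\<close>.\<close>
  have s\<tau>: "(\<lambda>n. c / \<tau> n) sums c" for c :: real
    using sums_mult[OF power_half_series, of c] by (simp add: \<tau>_def power_divide)
  define P where "P is x = iter_partial is (g 0) x + (\<Sum>j. iter_partial is (u j) x)" for "is" x
  have tele: "iter_partial is (g n) x = iter_partial is (g 0) x + (\<Sum>j<n. iter_partial is (u j) x)" if "x \<in> \<Omega>" for "is" n x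
    by (induction n) (auto simp: itu[OF that])
  have ul: "uniform_limit K (\<lambda>n. iter_partial is (g n)) (P is) sequentially" if K: "compact K" "K \<subseteq> \<Omega>" for K "is"
  proof -
    \<comment> \<open>For convergence one value of \<open>h\<close> is enough; \<open>h = 1\<close>
      leaves a bound depending only on the length of the list.\<close>
    obtain C where C: "C \<ge> 0" "\<And>n is x. x \<in> K \<Longrightarrow> cmod (iter_partial is (u n) x) \<le> C / \<tau> n * 1 ^ length is * M (length is)"
      using on_compact[OF K, of 1] by auto
    have "uniform_limit K (\<lambda>n x. \<Sum>j<n. iter_partial is (u j) x) (\<lambda>x. \<Sum>j. iter_partial is (u j) x) sequentially"
      by (rule Weierstrass_m_test[OF C(2)]) (auto intro!: summable_mult2 sums_summable[OF s\<tau>])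
    then have "uniform_limit K (\<lambda>n x. iter_partial is (g 0) x + (\<Sum>j<n. iter_partial is (u j) x)) (P is) sequentially"
      unfolding P_def by (intro uniform_limit_intros)
    then show ?thesis
    proof (rule uniform_limit_cong[THEN iffD1, rotated -1])
      show "\<forall>\<^sub>F n in sequentially. \<forall>x\<in>K. iter_partial is (g 0) x + (\<Sum>j<n. iter_partial is (u j) x) = iter_partial is (g n) x"
        using K(2) by (intro always_eventually allI ballI tele[symmetric]) blast
    qed simp
  qed
  have lim: "\<exists>r>0. ball x r \<subseteq> \<Omega> \<and> uniform_limit (ball x r) (\<lambda>n. iter_partial is (g n)) (P is) sequentially"
    if "x \<in> \<Omega>" for x "is"
  proof -
    obtain r where r: "r > 0" "cball x r \<subseteq> \<Omega>" using \<Omega> \<open>x \<in> \<Omega>\<close> open_contains_cball by blast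
    then show ?thesis
      using uniform_limit_on_subset[OF ul[OF compact_cball r(2)] ball_subset_cball] ball_subset_cball by blast
  qed
  define f where "f = P []"
  have smf: "smooth_on \<Omega> f" and itf: "\<And>is x. x \<in> \<Omega> \<Longrightarrow> iter_partial is f x = P is x"
    using smooth_on_limit[OF \<Omega> smg lim, of f] iter_partial_limit[OF \<Omega> smg lim, of f] by (auto simp: f_def)
  have bound_series: "cmod (\<Sum>j\<in>J. iter_partial is (u j) x) \<le> c" "cmod (\<Sum>j. iter_partial is (u j) x) \<le> c"
    if "finite J" "\<And>n. cmod (iter_partial is (u n) x) \<le> c / \<tau> n" for J "is" x c
  proof -
    have c: "0 \<le> c / \<tau> n" for n using order_trans[OF norm_ge_zero that(2)] .
    have "cmod (\<Sum>j\<in>J. iter_partial is (u j) x) \<le> (\<Sum>j\<in>J. c / \<tau> j)" by (rule sum_norm_le) (rule that(2))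
    also have "\<dots> \<le> (\<Sum>j. c / \<tau> j)" by (rule sum_le_suminf[OF sums_summable[OF s\<tau>] that(1)]) (use c in auto)
    finally show "cmod (\<Sum>j\<in>J. iter_partial is (u j) x) \<le> c" using sums_unique[OF s\<tau>, of c] by simp
    have "cmod (\<Sum>j. iter_partial is (u j) x) \<le> (\<Sum>j. c / \<tau> j)"
      by (rule norm_suminf_le[OF that(2) sums_summable[OF s\<tau>]])
    then show "cmod (\<Sum>j. iter_partial is (u j) x) \<le> c" using sums_unique[OF s\<tau>, of c] by simp
  qed
  have "f \<in> ultra_diff M \<Omega>"
    unfolding ultra_diff_def
  proof (intro CollectI conjI smf ballI allI impI)
    fix K h assume "K \<in> regular_compacts \<Omega>" and h: "(h :: real) > 0"
    then have K: "compact K" "K \<subseteq> \<Omega>" using compact_regular_compacts by blast+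
    obtain C where C: "C \<ge> 0" "\<And>n is x. x \<in> K \<Longrightarrow> cmod (iter_partial is (u n) x) \<le> C / \<tau> n * h ^ length is * M (length is)"
      using on_compact[OF K h] by blast
    have "ultra_norm M K h (g 0) < \<infinity>" using g[of 0] \<open>K \<in> regular_compacts \<Omega>\<close> h by (simp add: ultra_diff_def)
    then obtain D where D: "\<And>x \<alpha>. x \<in> K \<Longrightarrow> cmod (multi_deriv \<alpha> (g 0) x) \<le> D * h ^ (\<Sum>i\<in>UNIV. \<alpha> i) * M (\<Sum>i\<in>UNIV. \<alpha> i)"
      using ultra_norm_finiteD[OF h] by blast
    \<comment> \<open>\<open>D\<close> accounts for the initial member \<open>g 0\<close> and
      \<open>C\<close> for the sum of all differences, both at the same \<open>h\<close>.\<close>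
    have "ultra_norm M K h f \<le> ennreal (D + C)"
    proof (rule ultra_norm_leI[OF h])
      fix x and \<alpha> :: "'n \<Rightarrow> nat" assume x: "x \<in> K"
      let ?p = "\<Sum>i\<in>UNIV. \<alpha> i"
      have "cmod (\<Sum>j. iter_partial (midx \<alpha>) (u j) x) \<le> C * h ^ ?p * M ?p"
        by (rule bound_series(2)[of "{}"]) (use C(2)[OF x, of "midx \<alpha>"] in \<open>simp_all add: length_midx\<close>)
      then have "cmod (multi_deriv \<alpha> f x) \<le> D * h ^ ?p * M ?p + C * h ^ ?p * M ?p"
        using D[OF x, of \<alpha>] norm_triangle_ineq[of "iter_partial (midx \<alpha>) (g 0) x" "\<Sum>j. iter_partial (midx \<alpha>) (u j) x"] itf[of x "midx \<alpha>"] x K(2)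
        by (auto simp: multi_deriv_midx P_def)
      then show "cmod (multi_deriv \<alpha> f x) \<le> (D + C) * h ^ ?p * M ?p" by (simp add: algebra_simps)
    qed
    also have "\<dots> < \<infinity>" by simp
    finally show "ultra_norm M K h f < \<infinity>" .
  qed
  moreover have "T \<phi> = pairing \<Omega> f \<phi>" if test: "\<phi> \<in> test_functions M \<Omega>" for \<phi>
  proof -
    obtain K where K: "K \<in> regular_compacts \<Omega>" and \<phi>: "\<phi> \<in> test_functions_on M \<Omega> K"
      using test by (auto simp: test_functions_def)
    have cK: "compact K" "K \<subseteq> \<Omega>" using compact_regular_compacts[OF K] by blast+
    obtain b C where b: "b > 0" "\<And>n. cmod (pairing \<Omega> (g n) \<phi> - T \<phi>) * E (b * \<tau> n) \<le> C"
      using assoc[OF K] \<phi> by blast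
    \<comment> \<open>The first power alone gives
      \<open>E (b * \<tau> n) \<ge> b * \<tau> n / M 1\<close>, so association implies convergence
      of the pairings.\<close>
    have "(\<lambda>n. pairing \<Omega> (g n) \<phi> - T \<phi>) \<longlonglongrightarrow> 0"
    proof (rule Lim_null_comparison)
      show "(\<lambda>n. (C * M 1 / b) / \<tau> n) \<longlonglongrightarrow> 0" by (rule summable_LIMSEQ_zero[OF sums_summable[OF s\<tau>]])
      have "cmod (pairing \<Omega> (g n) \<phi> - T \<phi>) \<le> (C * M 1 / b) / \<tau> n" for n
      proof -
        have C0: "C \<ge> 0" using order_trans[OF _ b(2)[of 0]] E_pos[of "b * \<tau> 0"] by simp
        have "cmod (pairing \<Omega> (g n) \<phi> - T \<phi>) \<le> C / E (b * \<tau> n)"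
          using b(2)[of n] E_pos[of "b * \<tau> n"] by (simp add: field_simps)
        also have "\<dots> \<le> C / (b * \<tau> n / M 1)"
        proof (rule divide_left_mono[OF _ C0])
          show "b * \<tau> n / M 1 \<le> E (b * \<tau> n)"
            using power_le_E[of "b * \<tau> n" 1] b(1) \<tau>(1)[of n] M_pos[of 1] by (simp add: field_simps)
          show "0 < E (b * \<tau> n) * (b * \<tau> n / M 1)" using E_pos b(1) \<tau>(1)[of n] M_pos[of 1] by simp
        qed
        finally show ?thesis by (simp add: field_simps)
      qed
      then show "\<forall>\<^sub>F n in sequentially. norm (pairing \<Omega> (g n) \<phi> - T \<phi>) \<le> (C * M 1 / b) / \<tau> n" by simp
    qed
    then have "(\<lambda>n. pairing \<Omega> (g n) \<phi>) \<longlonglongrightarrow> T \<phi>" by (rule LIM_zero_cancel)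
    moreover have "(\<lambda>n. pairing \<Omega> (g n) \<phi>) \<longlonglongrightarrow> pairing \<Omega> f \<phi>"
    proof -
      have \<phi>0: "x \<notin> K \<Longrightarrow> \<phi> x = 0" for x using \<phi> by (auto simp: test_functions_on_def)
      obtain C where C: "C \<ge> 0" "\<And>n is x. x \<in> K \<Longrightarrow> cmod (iter_partial is (u n) x) \<le> C / \<tau> n * 1 ^ length is * M (length is)"
        using on_compact[OF cK, of 1] by auto
      have "bounded (g 0 ` K)"
        using smooth_on_continuous[OF smg[of 0], of "[]"] cK
        by (auto intro!: compact_imp_bounded compact_continuous_image intro: continuous_on_subset)
      then obtain B where B: "\<And>x. x \<in> K \<Longrightarrow> cmod (g 0 x) \<le> B" by (auto simp: bounded_iff)
      show ?thesis
        unfolding pairing_test_functions_on[OF K \<phi>]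
      proof (rule integral_dominated_convergence)
        show "(\<lambda>x. \<phi> x * f x) \<in> borel_measurable lborel"
          using borel_measurable_integrable[OF integrable_mult_test_function[OF \<Omega> K \<phi> smf]] .
        show "(\<lambda>x. \<phi> x * g n x) \<in> borel_measurable lborel" for n
          using borel_measurable_integrable[OF integrable_mult_test_function[OF \<Omega> K \<phi> smg]] .
        show "integrable lborel (\<lambda>x. cmod (\<phi> x) * (B + C))"
          by (intro integrable_mult_left integrable_norm integrable_test_function[OF \<Omega> K \<phi>])
        show "AE x in lborel. (\<lambda>n. \<phi> x * g n x) \<longlonglongrightarrow> \<phi> x * f x"
        proof (rule AE_I2)
          fix x show "(\<lambda>n. \<phi> x * g n x) \<longlonglongrightarrow> \<phi> x * f x"
            using tendsto_uniform_limitI[OF ul[OF cK, of "[]"], of x] \<phi>0[of x]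
            by (cases "x \<in> K") (auto simp: f_def intro!: tendsto_mult_left)
        qed
        show "AE x in lborel. norm (\<phi> x * g n x) \<le> cmod (\<phi> x) * (B + C)" for n
        proof (rule AE_I2)
          fix x
          show "norm (\<phi> x * g n x) \<le> cmod (\<phi> x) * (B + C)"
          proof (cases "x \<in> K")
            case True
            have "cmod (\<Sum>j<n. iter_partial [] (u j) x) \<le> C"
              by (rule bound_series(1)) (use C(2)[OF True, of "[]"] in \<open>simp_all add: M_0\<close>)
            then have "cmod (g n x) \<le> B + C"
              using tele[of x "[]" n] True cK(2) B[OF True]
                norm_triangle_ineq[of "g 0 x" "\<Sum>j<n. u j x"] by auto
            then show ?thesis by (simp add: norm_mult mult_left_mono)
          qed (simp add: \<phi>0)
        qed
      qed
    qed
    ultimately show ?thesis by (rule LIMSEQ_unique)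
  qed
  ultimately show ?thesis by blast
qed

end

section \<open>From nets to dyadic sequences\<close>

lemma net_bigo_dyadic:
  assumes "net_bigo a r" "\<And>n. a (1 / 2 ^ Suc n) < \<infinity>" "\<And>\<epsilon>. r \<epsilon> > 0"
  shows "\<exists>C\<ge>0. \<forall>n. a (1 / 2 ^ Suc n) \<le> ennreal (C * r (1 / 2 ^ Suc n))"
proof -
  obtain C \<epsilon>\<^sub>0 where C: "C > 0" "\<epsilon>\<^sub>0 > 0" "\<And>\<epsilon>. 0 < \<epsilon> \<Longrightarrow> \<epsilon> < \<epsilon>\<^sub>0 \<Longrightarrow> a \<epsilon> \<le> ennreal (C * r \<epsilon>)"
    using assms(1) unfolding net_bigo_def by auto
  let ?e = "\<lambda>n. 1 / 2 ^ Suc n :: real"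
  have "(\<lambda>n. (1 / 2 :: real) ^ Suc n) \<longlonglongrightarrow> 0" by (rule LIMSEQ_Suc[OF LIMSEQ_power_zero]) simp
  then have "\<forall>\<^sub>F n in sequentially. ?e n < \<epsilon>\<^sub>0"
    using order_tendstoD(2)[of _ 0 sequentially \<epsilon>\<^sub>0] C(2) by (simp add: power_divide)
  then obtain N where N: "\<And>n. n \<ge> N \<Longrightarrow> ?e n < \<epsilon>\<^sub>0" by (auto simp: eventually_sequentially)
  \<comment> \<open>The asymptotic bound says nothing about the finitely many indices below
    \<open>N\<close>. Their values are finite, and adding their ratios to the constant covers
    them.\<close>
  define D where "D = C + (\<Sum>n<N. enn2real (a (?e n)) / r (?e n))"
  have pos: "enn2real (a (?e n)) / r (?e n) \<ge> 0" for n using assms(3)[of "?e n"] by simp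
  have sum0: "(\<Sum>n<N. enn2real (a (?e n)) / r (?e n)) \<ge> 0" by (rule sum_nonneg) (rule pos)
  have "a (?e n) \<le> ennreal (D * r (?e n))" for n
  proof (cases "n < N")
    case True
    have "enn2real (a (?e n)) / r (?e n) \<le> (\<Sum>n<N. enn2real (a (?e n)) / r (?e n))"
      by (rule member_le_sum) (use True pos in auto)
    then have "enn2real (a (?e n)) / r (?e n) \<le> D" using C(1) by (simp add: D_def)
    then have "enn2real (a (?e n)) \<le> D * r (?e n)" using assms(3)[of "?e n"] by (simp add: field_simps)
    then have "ennreal (enn2real (a (?e n))) \<le> ennreal (D * r (?e n))" by (rule ennreal_leI)
    then show ?thesis using assms(2)[of n] by simp
  next
    case False
    have "a (?e n) \<le> ennreal (C * r (?e n))" by (rule C(3)) (use N[of n] False in auto)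
    also have "\<dots> \<le> ennreal (D * r (?e n))"
      using sum0 assms(3)[of "?e n"] by (intro ennreal_leI mult_right_mono) (auto simp: D_def)
    finally show ?thesis .
  qed
  moreover have "D \<ge> 0" using sum0 C(1) by (simp add: D_def)
  ultimately show ?thesis by blast
qed

text \<open>The norm at \<open>h = 1\<close>, read at the multi-index 0, bounds the net itself on
  \<open>K\<close>. Negligibility holds for every exponent, so the \<open>b\<close> of the
  association can be matched.\<close>

lemma (in weight) pairing_negligible:
  assumes "open \<Omega>" "w \<in> negligible_nets M \<Omega>" "K \<in> regular_compacts \<Omega>" "\<phi> \<in> test_functions_on M \<Omega> K" "b > 0"
  shows "\<exists>C. \<forall>n. cmod (pairing \<Omega> (w (1 / 2 ^ Suc n)) \<phi>) * E (b * 2 ^ Suc n) \<le> C"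
proof -
  have bo: "net_bigo (\<lambda>\<epsilon>. ultra_norm M K 1 (w \<epsilon>)) (\<lambda>\<epsilon>. exp (- assoc_fun M (b / \<epsilon>)))"
    using assms(2,3,5) unfolding negligible_nets_def by auto
  have ud: "w (1 / 2 ^ Suc n) \<in> ultra_diff M \<Omega>" for n
  proof -
    have "1 < (2::real) ^ Suc n" by (rule one_less_power) auto
    then have "1 / 2 ^ Suc n \<in> {0<..<1::real}" by simp
    then show ?thesis using assms(2) unfolding negligible_nets_def by blast
  qed
  then have "ultra_norm M K 1 (w (1 / 2 ^ Suc n)) < \<infinity>" for n
    using assms(3) by (simp add: ultra_diff_def)
  from net_bigo_dyadic[OF bo this] obtain C where C: "C \<ge> 0"
    "\<And>n. ultra_norm M K 1 (w (1 / 2 ^ Suc n)) \<le> ennreal (C * (1 / E (b * 2 ^ Suc n)))"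
    by (auto simp: exp_neg_assoc_fun E_pos)
  have "cmod (pairing \<Omega> (w (1 / 2 ^ Suc n)) \<phi>) * E (b * 2 ^ Suc n) \<le> C * (\<integral>x. cmod (\<phi> x) \<partial>lborel)" for n
  proof -
    have "cmod (w (1 / 2 ^ Suc n) x) \<le> C * (1 / E (b * 2 ^ Suc n))" if "x \<in> K" for x
      using ultra_norm_leD[OF _ _ C(2) that, of n "\<lambda>_. 0"] C(1) E_pos[of "b * 2 ^ Suc n"]
      by (simp add: multi_deriv_midx midx_0 M_0)
    from pairing_bound[OF assms(1,3,4) this]
    have "cmod (pairing \<Omega> (w (1 / 2 ^ Suc n)) \<phi>) \<le> C * (1 / E (b * 2 ^ Suc n)) * (\<integral>x. cmod (\<phi> x) \<partial>lborel)" .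
    then show ?thesis using E_pos[of "b * 2 ^ Suc n"] by (simp add: field_simps)
  qed
  then show ?thesis by blast
qed

theorem theorem2:
  fixes \<Omega> :: "(real ^ 'n::finite) set"
    and M :: "nat \<Rightarrow> real"
    and G :: "'n net set"
    and T :: "(real ^ 'n \<Rightarrow> complex) \<Rightarrow> complex"
  assumes "open \<Omega>"
    and "weight_sequence M"
    and "G \<in> regular_generalized_ultradistributions M \<Omega>"
    and "T \<in> ultradistributions M \<Omega>"
    and "strongly_B_associated M \<Omega> G T"
  shows "\<exists>f\<in>ultra_diff M \<Omega>. \<forall>\<phi>\<in>test_functions M \<Omega>. T \<phi> = pairing \<Omega> f \<phi>"
proof -
  interpret weight M by standard (rule assms(2))
  let ?e = "\<lambda>n. 1 / 2 ^ Suc n :: real"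
  \<comment> \<open>The exponent \<open>Suc n\<close> keeps even the first parameter, which is 1/2,
    inside the open interval.\<close>
  have e: "?e n \<in> {0<..<1}" for n
  proof -
    have "1 < (2::real) ^ Suc n" by (rule one_less_power) auto
    then show ?thesis by simp
  qed
  obtain g where "g \<in> G" and g: "\<And>K. K \<in> regular_compacts \<Omega> \<Longrightarrow> \<exists>k>0. \<forall>h>0.
      net_bigo (\<lambda>\<epsilon>. ultra_norm M K h (g \<epsilon>)) (\<lambda>\<epsilon>. exp (assoc_fun M (k / \<epsilon>)))"
    using assms(3) unfolding regular_generalized_ultradistributions_def by blast
  \<comment> \<open>Regularity and association may be witnessed by different representatives
    \<open>g\<close> and \<open>g'\<close>. Both are compared with the \<open>f\<close> whose class
    is \<open>G\<close>.\<close>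
  obtain g' where "g' \<in> G" and g': "\<And>K. K \<in> regular_compacts \<Omega> \<Longrightarrow> \<exists>b>0. \<forall>\<phi>\<in>test_functions_on M \<Omega> K.
       net_bigo (\<lambda>\<epsilon>. ennreal (cmod (pairing \<Omega> (g' \<epsilon>) \<phi> - T \<phi>))) (\<lambda>\<epsilon>. exp (- assoc_fun M (b / \<epsilon>)))"
    using assms(5) unfolding strongly_B_associated_def by blast
  obtain f where "G = net_equiv M \<Omega> `` {f}"
    using assms(3) unfolding regular_generalized_ultradistributions_def generalized_ultradistributions_def quotient_def by auto
  then have eqv: "(f, g) \<in> net_equiv M \<Omega>" "(f, g') \<in> net_equiv M \<Omega>" using \<open>g \<in> G\<close> \<open>g' \<in> G\<close> by auto
  then have mod: "f \<in> moderate_nets M \<Omega>" "g \<in> moderate_nets M \<Omega>" "g' \<in> moderate_nets M \<Omega>"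
    and neg: "(\<lambda>\<epsilon> x. f \<epsilon> x - g \<epsilon> x) \<in> negligible_nets M \<Omega>" "(\<lambda>\<epsilon> x. f \<epsilon> x - g' \<epsilon> x) \<in> negligible_nets M \<Omega>"
    unfolding net_equiv_def by auto
  have ud: "w (?e n) \<in> ultra_diff M \<Omega>" if "w \<in> moderate_nets M \<Omega>" for w n
    using that e unfolding moderate_nets_def by blast
  have sm: "smooth_on \<Omega> (w (?e n))" if "w \<in> moderate_nets M \<Omega>" for w n
    using ud[OF that, of n] by (simp add: ultra_diff_def)
  show ?thesis
  proof (cases "\<exists>\<phi>\<in>test_functions M \<Omega>. \<exists>z. \<phi> z \<noteq> 0")
    case False
    \<comment> \<open>The zero function is the only possible test function here. \<open>T\<close>
      vanishes on it by linearity, so any member of the net represents \<open>T\<close>.\<close>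
    have "T \<phi> = pairing \<Omega> (g (?e 0)) \<phi>" if "\<phi> \<in> test_functions M \<Omega>" for \<phi>
    proof -
      have \<phi>: "\<phi> = (\<lambda>x. 0)" using False that by blast
      have "\<forall>a b. T (\<lambda>x. a * \<phi> x + b * \<phi> x) = a * T \<phi> + b * T \<phi>"
        using assms(4) that unfolding ultradistributions_def by blast
      then have "T (\<lambda>x. 0 * \<phi> x + 0 * \<phi> x) = 0 * T \<phi> + 0 * T \<phi>" by blast
      then show ?thesis by (simp add: \<phi> pairing_def)
    qed
    then show ?thesis using ud[OF mod(2)] by blast
  next
    case True
    then obtain \<phi>\<^sub>0 z where nontrivial: "\<phi>\<^sub>0 \<in> test_functions M \<Omega>" "\<phi>\<^sub>0 z \<noteq> 0" by blast
    show ?thesis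
    proof (rule converging_net[OF assms(1) nontrivial ud[OF mod(2)]])
      fix K assume K: "K \<in> regular_compacts \<Omega>"
      obtain k where k: "k > 0" "\<And>h. h > 0 \<Longrightarrow> net_bigo (\<lambda>\<epsilon>. ultra_norm M K h (g \<epsilon>)) (\<lambda>\<epsilon>. exp (assoc_fun M (k / \<epsilon>)))"
        using g[OF K] by blast
      have "\<exists>C\<ge>0. \<forall>n. \<forall>x\<in>K. \<forall>\<alpha>. cmod (multi_deriv \<alpha> (g (?e n)) x)
        \<le> C * E (k * 2 ^ Suc n) * h ^ (\<Sum>i\<in>UNIV. \<alpha> i) * M (\<Sum>i\<in>UNIV. \<alpha> i)" if h: "h > 0" for h
      proof -
        have "ultra_norm M K h (g (?e n)) < \<infinity>" for n
          using ud[OF mod(2), of n] K h by (simp add: ultra_diff_def)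
        from net_bigo_dyadic[OF k(2)[OF h] this] obtain C where C: "C \<ge> 0"
          "\<And>n. ultra_norm M K h (g (?e n)) \<le> ennreal (C * E (k * 2 ^ Suc n))"
          by (auto simp: weight_exp_def)
        have "cmod (multi_deriv \<alpha> (g (?e n)) x) \<le> C * E (k * 2 ^ Suc n) * h ^ (\<Sum>i\<in>UNIV. \<alpha> i) * M (\<Sum>i\<in>UNIV. \<alpha> i)"
          if "x \<in> K" for n x \<alpha>
          by (rule ultra_norm_leD[OF h _ C(2) that]) (use C(1) E_pos[of "k * 2 ^ Suc n"] in simp)
        then show ?thesis using C(1) by blast
      qed
      then show "\<exists>k>0. \<forall>h>0. \<exists>C\<ge>0. \<forall>n. \<forall>x\<in>K. \<forall>\<alpha>. cmod (multi_deriv \<alpha> (g (?e n)) x)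
        \<le> C * E (k * 2 ^ Suc n) * h ^ (\<Sum>i\<in>UNIV. \<alpha> i) * M (\<Sum>i\<in>UNIV. \<alpha> i)"
        using k(1) by blast
      obtain b where b: "b > 0" "\<And>\<phi>. \<phi> \<in> test_functions_on M \<Omega> K \<Longrightarrow>
         net_bigo (\<lambda>\<epsilon>. ennreal (cmod (pairing \<Omega> (g' \<epsilon>) \<phi> - T \<phi>))) (\<lambda>\<epsilon>. exp (- assoc_fun M (b / \<epsilon>)))"
        using g'[OF K] by blast
      have "\<exists>C. \<forall>n. cmod (pairing \<Omega> (g (?e n)) \<phi> - T \<phi>) * E (b * 2 ^ Suc n) \<le> C"
        if \<phi>: "\<phi> \<in> test_functions_on M \<Omega> K" for \<phi>
      proof -
        obtain C where C: "C \<ge> 0" "\<And>n. cmod (pairing \<Omega> (g' (?e n)) \<phi> - T \<phi>) * E (b * 2 ^ Suc n) \<le> C"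
        proof -
          obtain C where C: "C \<ge> 0"
            "\<And>n. ennreal (cmod (pairing \<Omega> (g' (?e n)) \<phi> - T \<phi>)) \<le> ennreal (C * (1 / E (b * 2 ^ Suc n)))"
            using net_bigo_dyadic[OF b(2)[OF \<phi>]] by (auto simp: exp_neg_assoc_fun E_pos)
          have "cmod (pairing \<Omega> (g' (?e n)) \<phi> - T \<phi>) * E (b * 2 ^ Suc n) \<le> C" for n
          proof -
            have "0 \<le> C * (1 / E (b * 2 ^ Suc n))" using C(1) E_pos[of "b * 2 ^ Suc n"] by simp
            then have "cmod (pairing \<Omega> (g' (?e n)) \<phi> - T \<phi>) \<le> C * (1 / E (b * 2 ^ Suc n))"
              using C(2)[of n] by (simp only: ennreal_le_iff)
            then show ?thesis using E_pos[of "b * 2 ^ Suc n"] by (simp add: field_simps)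
          qed
          then show thesis using that C(1) by blast
        qed
        obtain C1 where C1: "\<And>n. cmod (pairing \<Omega> (\<lambda>x. f (?e n) x - g (?e n) x) \<phi>) * E (b * 2 ^ Suc n) \<le> C1"
          using pairing_negligible[OF assms(1) neg(1) K \<phi> b(1)] by blast
        obtain C2 where C2: "\<And>n. cmod (pairing \<Omega> (\<lambda>x. f (?e n) x - g' (?e n) x) \<phi>) * E (b * 2 ^ Suc n) \<le> C2"
          using pairing_negligible[OF assms(1) neg(2) K \<phi> b(1)] by blast
        have "cmod (pairing \<Omega> (g (?e n)) \<phi> - T \<phi>) * E (b * 2 ^ Suc n) \<le> C + C1 + C2" for n
        proof -
          let ?A = "pairing \<Omega> (g' (?e n)) \<phi> - T \<phi>"
          let ?B = "pairing \<Omega> (\<lambda>x. f (?e n) x - g (?e n) x) \<phi>"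
          let ?D = "pairing \<Omega> (\<lambda>x. f (?e n) x - g' (?e n) x) \<phi>"
          \<comment> \<open>The representative is exchanged through \<open>f\<close>:
            \<open>?B\<close> and \<open>?D\<close> are pairings of negligible differences, and
            \<open>?A\<close> is the associated one.\<close>
          have dec: "pairing \<Omega> (g (?e n)) \<phi> - T \<phi> = ?A - ?B + ?D"
            unfolding pairing_diff[OF assms(1) K \<phi> sm[OF mod(1)] sm[OF mod(2)]]
              pairing_diff[OF assms(1) K \<phi> sm[OF mod(1)] sm[OF mod(3)]] by simp
          have "cmod (pairing \<Omega> (g (?e n)) \<phi> - T \<phi>) \<le> cmod ?A + cmod ?B + cmod ?D"
            unfolding dec using norm_triangle_ineq[of "?A - ?B" ?D] norm_triangle_ineq4[of ?A ?B] by linarith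
          then have "cmod (pairing \<Omega> (g (?e n)) \<phi> - T \<phi>) * E (b * 2 ^ Suc n)
            \<le> (cmod ?A + cmod ?B + cmod ?D) * E (b * 2 ^ Suc n)"
            by (rule mult_right_mono[OF _ less_imp_le[OF E_pos]])
          also have "\<dots> \<le> C + C1 + C2"
            unfolding distrib_right using C(2)[of n] C1[of n] C2[of n] by (intro add_mono) auto
          finally show ?thesis .
        qed
        then show ?thesis by blast
      qed
      then show "\<exists>b>0. \<forall>\<phi>\<in>test_functions_on M \<Omega> K. \<exists>C. \<forall>n. cmod (pairing \<Omega> (g (?e n)) \<phi> - T \<phi>) * E (b * 2 ^ Suc n) \<le> C"
        using b(1) by blast
    qed
  qed
qed

end
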